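(* There exist a control gain $F=[F_l]_{l=1}^{\mathbf N}$ with $F_l\in\mathbb F^{n_u\times n_x}$ and a filtering gain $M=[M_n]_{n=1}^{\mathbf I}$ with $M_n\in\mathbb F^{n_x\times n_y}$ such that the closed-loop dynamics $$\mathcal E_{k+1}=\begin{bmatrix}A+\nu_kBF_{\theta_{k-1}} & -\nu_kBF_{\theta_{k-1}}\\ 0 & A+\gamma_kM_{\eta_k}L\end{bmatrix}\mathcal E_k+\begin{bmatrix}G\\ G+\gamma_kM_{\eta_k}H\end{bmatrix}w_k,\qquad \mathcal E_k=\begin{bmatrix}x_k\\ \tilde e_k\end{bmatrix},$$ obtained by interconnecting the Markov jump linear system (S) with the Luenberger-like observer (O), is mean square stable, if and only if system (S) is both mean square detectable with respect to the sensing channel and mean square stabilizable with one time-step delay in the observation of the actuation channel mode. (System (S), observer (O), and these notions are defined in the context.)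
   Context: $\mathbb F$ is $\mathbb R$ or $\mathbb C$; $^*$ is conjugate transpose. The plant (S) is $$x_{k+1}=Ax_k+\nu_kBu_k+Gw_k,\qquad y_k=\gamma_k(Lx_k+Hw_k),\qquad z_k=Cx_k+\nu_kDu_k,$$ with state $x_k\in\mathbb F^{n_x}$, control $u_k\in\mathbb F^{n_u}$, received measurement $y_k\in\mathbb F^{n_y}$, output $z_k\in\mathbb F^{n_z}$, noise $w_k\in\mathbb F^{n_w}$, and constant matrices of compatible sizes satisfying $GG^*\succeq0$, $GH^*=0$, $HH^*\succ0$, $C^*D=0$, $D^*D\succ0$. Noise: $\mathbb E[w_k]=0$, $\mathbb E[w_kw_k^*]=I_{n_w}$, $\mathbb E[w_kw_l^*]=0$ for $k\ne l$. Channels: $\theta$ (actuation) and $\eta$ (sensing) are time-homogeneous ergodic (irreducible, aperiodic) Markov chains on $\{1,\dots,\mathbf N\}$ and $\mathbb S_\eta=\{1,\dots,\mathbf I\}$ with transition matrices $P=[p_{ij}]$ and $Q=[q_{mn}]$, respectively. $\nu_k,\gamma_k\in\{0,1\}$ are packet-delivery indicators with $\mathbb P(\nu_k=1\mid\theta_k=i)=\hat\nu_i$ and $\mathbb P(\gamma_k=1\mid\eta_k=n)=\hat\gamma_n$. Given the current channel mode, each indicator is independent of the past, so that $\mathbb P(\gamma_{k+1}=1,\eta_{k+1}=n\mid\eta_k=m)=\hat\gamma_nq_{mn}$ and $\mathbb P(\gamma_{k+1}=0,\eta_{k+1}=n\mid\eta_k=m)=(1-\hat\gamma_n)q_{mn}$,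 and analogously for $(\nu_k,\theta_k)$. The initial conditions $x_0,\theta_0,\eta_0$ are independent; $\{w_k\}$, the process $(\nu_k,\theta_k)$ and the process $(\gamma_k,\eta_k)$ are independent sequences, and $w$ is independent of the initial conditions. The mode $\theta_{k-1}$ used at $k=0$ is part of the initial data. Initial states have finite second moments. Observer (O), with gains $F$ and $M$: $$\tilde x_{k+1}=A\tilde x_k+\nu_kBu_k-M_{\eta_k}(y_k-\gamma_kL\tilde x_k),\qquad u_k=F_{\theta_{k-1}}\tilde x_k,$$ with initial state $\tilde x_0$. The estimation error is $\tilde e_k=x_k-\tilde x_k$, and it satisfies $\tilde e_{k+1}=(A+\gamma_kM_{\eta_k}L)\tilde e_k+(G+\gamma_kM_{\eta_k}H)w_k$. Mean square stability: a Markov jump linear system with state $\xi_k$ is mean square stable if there exist $\mu_e$ and $Q_e$, independent of the initial conditions, such that for every initial condition (initial state and initial modes) $\lim_{k\to\infty}\|\mathbb E(\xi_k)-\mu_e\|=0$ and $\lim_{k\to\infty}\|\mathbb E(\xi_k\xi_k^* )-Q_e\|=0$. Mean square stabilizability with one time-step delay: there exists $F=[F_l]_{l=1}^{\mathbf N}$ such that the state feedback $u_k=F_{\theta_{k-1}}x_k$ makes (S) mean square stable, i.e. $x_{k+1}=(A+\nu_kBF_{\theta_{k-1}})x_k+Gw_k$ is mean square stable. Mean square detectability with respect to the sensing channel: there exists $M=[M_n]_{n=1}^{\mathbf I}$ such that $\rho(\mathcal V)<1$, where $\rho$ is the spectral radius and $\mathcal V=[\mathcal V_n]_{n=1}^{\mathbf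 I}$ is the linear operator acting on $\mathbf I$-tuples $\mathbf S=[S_m]_{m=1}^{\mathbf I}$ of matrices in $\mathbb F^{n_x\times n_x}$ by $$\mathcal V_n(\mathbf S)=\hat\gamma_n(A+M_nL)\mathcal D_n(\mathbf S)(A+M_nL)^*+(1-\hat\gamma_n)A\mathcal D_n(\mathbf S)A^*,\qquad \mathcal D_n(\mathbf S)=\sum_{m=1}^{\mathbf I}q_{mn}S_m.$$ *)

theory Defs
  imports "HOL-Probability.Probability"
begin

section \<open>Matrices over the real or the complex field\<close>

text \<open>
  The scalar field is a set \<open>\<FF>\<close> of complex numbers, either \<open>\<real>\<close> or \<open>UNIV\<close>, and vectors and
  matrices over it are complex vectors and matrices with all entries in \<open>\<FF>\<close>.
\<close>

definition vec_over :: "complex set \<Rightarrow> complex^'n \<Rightarrow> bool" where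
  "vec_over \<FF> v \<longleftrightarrow> (\<forall>i. v $ i \<in> \<FF>)"

definition mat_over :: "complex set \<Rightarrow> complex^'n^'m \<Rightarrow> bool" where
  "mat_over \<FF> A \<longleftrightarrow> (\<forall>i j. A $ i $ j \<in> \<FF>)"

definition adj :: "complex^'n^'m \<Rightarrow> complex^'m^'n" where
  "adj A = (\<chi> i j. cnj (A $ j $ i))"

definition outer :: "complex^'m \<Rightarrow> complex^'n \<Rightarrow> complex^'n^'m" where
  "outer v w = (\<chi> i j. v $ i * cnj (w $ j))"

definition quad_form :: "complex^'n^'n \<Rightarrow> complex^'n \<Rightarrow> complex" where
  "quad_form A v = (\<Sum>i\<in>UNIV. cnj (v $ i) * (A *v v) $ i)"

definition pos_semidef :: "complex^'n^'n \<Rightarrow> bool" where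
  "pos_semidef A \<longleftrightarrow> adj A = A \<and> (\<forall>v. 0 \<le> Re (quad_form A v))"

definition pos_def :: "complex^'n^'n \<Rightarrow> bool" where
  "pos_def A \<longleftrightarrow> adj A = A \<and> (\<forall>v. v \<noteq> 0 \<longrightarrow> 0 < Re (quad_form A v))"

definition block_mat ::
  "'a^'n1^'m1 \<Rightarrow> 'a^'n2^'m1 \<Rightarrow> 'a^'n1^'m2 \<Rightarrow> 'a^'n2^'m2 \<Rightarrow> 'a^('n1 + 'n2)^('m1 + 'm2)" where
  "block_mat A B C D = (\<chi> i j. case i of
       Inl a \<Rightarrow> (case j of Inl c \<Rightarrow> A $ a $ c | Inr d \<Rightarrow> B $ a $ d)
     | Inr b \<Rightarrow> (case j of Inl c \<Rightarrow> C $ b $ c | Inr d \<Rightarrow> D $ b $ d))"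

definition stack :: "'a^'m1 \<Rightarrow> 'a^'m2 \<Rightarrow> 'a^('m1 + 'm2)" where
  "stack v w = (\<chi> i. case i of Inl a \<Rightarrow> v $ a | Inr b \<Rightarrow> w $ b)"


section \<open>Ergodic Markov chains, channels and noise\<close>

definition stochastic :: "real^'m^'m \<Rightarrow> bool" where
  "stochastic P \<longleftrightarrow> (\<forall>i j. 0 \<le> P $ i $ j) \<and> (\<forall>i. (\<Sum>j\<in>UNIV. P $ i $ j) = 1)"

definition mat_power :: "real^'m^'m \<Rightarrow> nat \<Rightarrow> real^'m^'m" where
  "mat_power P k = (((**) P) ^^ k) (mat 1)"

definition irreducible_chain :: "real^'m^'m \<Rightarrow> bool" where
  "irreducible_chain P \<longleftrightarrow> (\<forall>i j. \<exists>k. 0 < mat_power P k $ i $ j)"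

definition aperiodic_chain :: "real^'m^'m \<Rightarrow> bool" where
  "aperiodic_chain P \<longleftrightarrow> (\<forall>i. Gcd {k. 0 < k \<and> 0 < mat_power P k $ i $ i} = 1)"

definition ergodic_chain :: "real^'m^'m \<Rightarrow> bool" where
  "ergodic_chain P \<longleftrightarrow> stochastic P \<and> irreducible_chain P \<and> aperiodic_chain P"

definition bernoulli_prob :: "real \<Rightarrow> bool \<Rightarrow> real" where
  "bernoulli_prob p b = (if b then p else 1 - p)"

text \<open>
  \<open>c\<close> is initial data preceding time \<open>0\<close>, which belongs to the past on which the laws of
  \<open>\<theta>\<close> and \<open>\<nu>\<close> are conditioned; neither its law nor its joint law with \<open>\<theta> 0\<close> is restricted.
\<close>

definition channel_process ::
  "'o measure \<Rightarrow> real^'m^'m \<Rightarrow> ('m \<Rightarrow> real) \<Rightarrow> ('o \<Rightarrow> 'c) \<Rightarrow> (nat \<Rightarrow> 'o \<Rightarrow> 'm) \<Rightarrow> (nat \<Rightarrow> 'o \<Rightarrow> bool) \<Rightarrow> bool"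
  where
  "channel_process \<Omega> P p c \<theta> \<nu> \<longleftrightarrow>
     c \<in> measurable \<Omega> (count_space UNIV) \<and>
     (\<forall>k. \<theta> k \<in> measurable \<Omega> (count_space UNIV)) \<and>
     (\<forall>k. \<nu> k \<in> measurable \<Omega> (count_space UNIV)) \<and>
     (\<forall>d i b. \<P>(\<omega> in \<Omega>. c \<omega> = d \<and> \<theta> 0 \<omega> = i) \<noteq> 0 \<longrightarrow>
        \<P>(\<omega> in \<Omega>. \<nu> 0 \<omega> = b \<bar> c \<omega> = d \<and> \<theta> 0 \<omega> = i) = bernoulli_prob (p i) b) \<and>
     (\<forall>k d s a i b.
        \<P>(\<omega> in \<Omega>. c \<omega> = d \<and> (\<forall>j\<le>k. \<theta> j \<omega> = s j \<and> \<nu> j \<omega> = a j)) \<noteq> 0 \<longrightarrow>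
        \<P>(\<omega> in \<Omega>. \<theta> (Suc k) \<omega> = i \<and> \<nu> (Suc k) \<omega> = b \<bar>
             c \<omega> = d \<and> (\<forall>j\<le>k. \<theta> j \<omega> = s j \<and> \<nu> j \<omega> = a j))
        = bernoulli_prob (p i) b * P $ s k $ i)"

abbreviation noise_space :: "(nat \<Rightarrow> complex^'w) measure" where
  "noise_space \<equiv> \<Pi>\<^sub>M k\<in>UNIV. borel"

text \<open>\<open>W\<close> is the joint law of the whole noise sequence.\<close>

definition noise_law :: "complex set \<Rightarrow> (nat \<Rightarrow> complex^'w) measure \<Rightarrow> bool" where
  "noise_law \<FF> W \<longleftrightarrow>
     prob_space W \<and> sets W = sets noise_space \<and>
     (\<forall>k. AE w in W. vec_over \<FF> (w k)) \<and>
     (\<forall>k. integrable W (\<lambda>w. (norm (w k))\<^sup>2)) \<and>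
     (\<forall>k. (\<integral>w. w k \<partial>W) = 0) \<and>
     (\<forall>k l. (\<integral>w. outer (w k) (w l) \<partial>W) = (if k = l then mat 1 else 0))"


section \<open>Mean square stability of Markov jump linear systems\<close>

text \<open>
  The system is \<open>\<xi>\<^sub>k\<^sub>+\<^sub>1 = \<Phi> \<theta>\<^sub>k\<^sub>-\<^sub>1 \<nu>\<^sub>k \<eta>\<^sub>k \<gamma>\<^sub>k \<xi>\<^sub>k + \<Gamma> \<eta>\<^sub>k \<gamma>\<^sub>k w\<^sub>k\<close>; the argument \<open>l\<close> of \<open>mjls\<close> is
  the delayed mode sequence \<open>\<theta>\<^sub>k\<^sub>-\<^sub>1\<close>.
\<close>

primrec mjls ::
  "('m \<Rightarrow> bool \<Rightarrow> 's \<Rightarrow> bool \<Rightarrow> complex^'n^'n) \<Rightarrow> ('s \<Rightarrow> bool \<Rightarrow> complex^'w^'n) \<Rightarrow> complex^'n \<Rightarrow>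
   (nat \<Rightarrow> 'm) \<Rightarrow> (nat \<Rightarrow> bool) \<Rightarrow> (nat \<Rightarrow> 's) \<Rightarrow> (nat \<Rightarrow> bool) \<Rightarrow> (nat \<Rightarrow> complex^'w) \<Rightarrow>
   nat \<Rightarrow> complex^'n" where
  "mjls \<Phi> \<Gamma> \<xi>0 l \<nu> \<eta> \<gamma> w 0 = \<xi>0"
| "mjls \<Phi> \<Gamma> \<xi>0 l \<nu> \<eta> \<gamma> w (Suc k) =
     \<Phi> (l k) (\<nu> k) (\<eta> k) (\<gamma> k) *v mjls \<Phi> \<Gamma> \<xi>0 l \<nu> \<eta> \<gamma> w k + \<Gamma> (\<eta> k) (\<gamma> k) *v w k"

definition delayed :: "'m \<Rightarrow> (nat \<Rightarrow> 'm) \<Rightarrow> nat \<Rightarrow> 'm" where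
  "delayed \<theta>m \<theta> k = (case k of 0 \<Rightarrow> \<theta>m | Suc j \<Rightarrow> \<theta> j)"

abbreviation channel_space :: "(nat \<Rightarrow> 'm \<times> bool) measure" where
  "channel_space \<equiv> \<Pi>\<^sub>M k\<in>UNIV. count_space UNIV"

text \<open>
  The initial state, the noise, the actuation channel (with its mode \<open>\<theta>m\<close> at time \<open>-1\<close>) and
  the sensing channel are mutually independent: the list holds the \<open>\<sigma>\<close>-algebras they generate.
\<close>

definition realization ::
  "complex set \<Rightarrow> (nat \<Rightarrow> complex^'w) measure \<Rightarrow> real^'m^'m \<Rightarrow> ('m \<Rightarrow> real) \<Rightarrow>
   real^'s^'s \<Rightarrow> ('s \<Rightarrow> real) \<Rightarrow>
   'o measure \<Rightarrow> ('o \<Rightarrow> complex^'n) \<Rightarrow> ('o \<Rightarrow> 'm) \<Rightarrow> (nat \<Rightarrow> 'o \<Rightarrow> 'm) \<Rightarrow> (nat \<Rightarrow> 'o \<Rightarrow> bool) \<Rightarrow>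
   (nat \<Rightarrow> 'o \<Rightarrow> 's) \<Rightarrow> (nat \<Rightarrow> 'o \<Rightarrow> bool) \<Rightarrow> (nat \<Rightarrow> 'o \<Rightarrow> complex^'w) \<Rightarrow> bool" where
  "realization \<FF> W P \<nu>h Q \<gamma>h \<Omega> \<xi>0 \<theta>m \<theta> \<nu> \<eta> \<gamma> w \<longleftrightarrow>
     prob_space \<Omega> \<and>
     \<xi>0 \<in> borel_measurable \<Omega> \<and>
     (\<forall>\<omega>\<in>space \<Omega>. vec_over \<FF> (\<xi>0 \<omega>)) \<and>
     integrable \<Omega> (\<lambda>\<omega>. (norm (\<xi>0 \<omega>))\<^sup>2) \<and>
     (\<forall>k. w k \<in> borel_measurable \<Omega>) \<and>
     distr \<Omega> noise_space (\<lambda>\<omega> k. w k \<omega>) = W \<and>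
     channel_process \<Omega> P \<nu>h \<theta>m \<theta> \<nu> \<and>
     channel_process \<Omega> Q \<gamma>h (\<lambda>_. ()) \<eta> \<gamma> \<and>
     prob_space.indep_sets \<Omega>
       (\<lambda>i. sets ([vimage_algebra (space \<Omega>) \<xi>0 borel,
                   vimage_algebra (space \<Omega>) (\<lambda>\<omega> k. w k \<omega>) noise_space,
                   vimage_algebra (space \<Omega>) (\<lambda>\<omega>. (\<theta>m \<omega>, \<lambda>k. (\<theta> k \<omega>, \<nu> k \<omega>)))
                     (count_space UNIV \<Otimes>\<^sub>M channel_space),
                   vimage_algebra (space \<Omega>) (\<lambda>\<omega> k. (\<eta> k \<omega>, \<gamma> k \<omega>)) channel_space] ! i))
       {..<4}"

text \<open>
  HOL cannot quantify over sample types inside a definition. Every joint law of the data is a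
  law on the path space below, so taking it as sample type loses no initial condition.
\<close>

type_synonym ('n, 'w, 'm, 's) path =
  "(complex^'n) \<times> (nat \<Rightarrow> complex^'w) \<times> ('m \<times> (nat \<Rightarrow> 'm \<times> bool)) \<times> (nat \<Rightarrow> 's \<times> bool)"

definition mean_square_stable ::
  "complex set \<Rightarrow> (nat \<Rightarrow> complex^'w) measure \<Rightarrow> real^'m^'m \<Rightarrow> ('m \<Rightarrow> real) \<Rightarrow>
   real^'s^'s \<Rightarrow> ('s \<Rightarrow> real) \<Rightarrow>
   ('m \<Rightarrow> bool \<Rightarrow> 's \<Rightarrow> bool \<Rightarrow> complex^'n^'n) \<Rightarrow> ('s \<Rightarrow> bool \<Rightarrow> complex^'w^'n) \<Rightarrow> bool" where
  "mean_square_stable \<FF> W P \<nu>h Q \<gamma>h \<Phi> \<Gamma> \<longleftrightarrow>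
     (\<exists>\<mu>e Qe. \<forall>(\<Omega> :: ('n, 'w, 'm, 's) path measure) \<xi>0 \<theta>m \<theta> \<nu> \<eta> \<gamma> w.
        realization \<FF> W P \<nu>h Q \<gamma>h \<Omega> \<xi>0 \<theta>m \<theta> \<nu> \<eta> \<gamma> w \<longrightarrow>
        (let \<xi> = (\<lambda>k \<omega>. mjls \<Phi> \<Gamma> (\<xi>0 \<omega>) (delayed (\<theta>m \<omega>) (\<lambda>j. \<theta> j \<omega>))
                         (\<lambda>j. \<nu> j \<omega>) (\<lambda>j. \<eta> j \<omega>) (\<lambda>j. \<gamma> j \<omega>) (\<lambda>j. w j \<omega>) k)
         in (\<lambda>k. norm ((\<integral>\<omega>. \<xi> k \<omega> \<partial>\<Omega>) - \<mu>e)) \<longlonglongrightarrow> 0 \<and>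
            (\<lambda>k. norm ((\<integral>\<omega>. outer (\<xi> k \<omega>) (\<xi> k \<omega>) \<partial>\<Omega>) - Qe)) \<longlonglongrightarrow> 0))"


section \<open>Stabilizability and detectability\<close>

definition state_feedback ::
  "complex^'x^'x \<Rightarrow> complex^'u^'x \<Rightarrow> ('m \<Rightarrow> complex^'x^'u) \<Rightarrow>
   'm \<Rightarrow> bool \<Rightarrow> 's \<Rightarrow> bool \<Rightarrow> complex^'x^'x" where
  "state_feedback A B F = (\<lambda>l \<nu> n \<gamma>. A + of_bool \<nu> *\<^sub>R (B ** F l))"

definition ms_stabilizable_delay ::
  "complex set \<Rightarrow> (nat \<Rightarrow> complex^'w) measure \<Rightarrow> real^'m^'m \<Rightarrow> ('m \<Rightarrow> real) \<Rightarrow>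
   real^'s^'s \<Rightarrow> ('s \<Rightarrow> real) \<Rightarrow>
   complex^'x^'x \<Rightarrow> complex^'u^'x \<Rightarrow> complex^'w^'x \<Rightarrow> bool" where
  "ms_stabilizable_delay \<FF> W P \<nu>h Q \<gamma>h A B G \<longleftrightarrow>
     (\<exists>F. (\<forall>l. mat_over \<FF> (F l)) \<and>
        mean_square_stable \<FF> W P \<nu>h Q \<gamma>h (state_feedback A B F) (\<lambda>n \<gamma>. G))"

definition detect_D :: "real^'s^'s \<Rightarrow> complex^'x^'x^'s \<Rightarrow> 's \<Rightarrow> complex^'x^'x" where
  "detect_D Q S n = (\<Sum>m\<in>UNIV. Q $ m $ n *\<^sub>R S $ m)"

definition detect_V ::
  "complex^'x^'x \<Rightarrow> complex^'x^'y \<Rightarrow> real^'s^'s \<Rightarrow> ('s \<Rightarrow> real) \<Rightarrow> ('s \<Rightarrow> complex^'y^'x) \<Rightarrow>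
   complex^'x^'x^'s \<Rightarrow> complex^'x^'x^'s" where
  "detect_V A L Q \<gamma>h M S = (\<chi> n.
      \<gamma>h n *\<^sub>R ((A + M n ** L) ** detect_D Q S n ** adj (A + M n ** L))
      + (1 - \<gamma>h n) *\<^sub>R (A ** detect_D Q S n ** adj A))"

text \<open>
  Eigenvalues are taken on tuples of complex matrices. For real data this is the
  complexification of the operator, which is what the spectral radius of a real operator means.
\<close>

definition eigenvalue_set ::
  "(complex^'x^'x^'s \<Rightarrow> complex^'x^'x^'s) \<Rightarrow> complex set" where
  "eigenvalue_set T = {\<mu>. \<exists>S. S \<noteq> 0 \<and> T S = (\<chi> n i j. \<mu> * S $ n $ i $ j)}"

definition spec_radius :: "(complex^'x^'x^'s \<Rightarrow> complex^'x^'x^'s) \<Rightarrow> real" where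
  "spec_radius T = Max (cmod ` eigenvalue_set T)"

definition ms_detectable ::
  "complex set \<Rightarrow> real^'s^'s \<Rightarrow> ('s \<Rightarrow> real) \<Rightarrow> complex^'x^'x \<Rightarrow> complex^'x^'y \<Rightarrow> bool" where
  "ms_detectable \<FF> Q \<gamma>h A L \<longleftrightarrow>
     (\<exists>M. (\<forall>n. mat_over \<FF> (M n)) \<and> spec_radius (detect_V A L Q \<gamma>h M) < 1)"


section \<open>Plant, observer and closed loop\<close>

definition plant_next ::
  "complex^'x^'x \<Rightarrow> complex^'u^'x \<Rightarrow> complex^'w^'x \<Rightarrow>
   bool \<Rightarrow> complex^'x \<Rightarrow> complex^'u \<Rightarrow> complex^'w \<Rightarrow> complex^'x" where
  "plant_next A B G \<nu> x u w = A *v x + of_bool \<nu> *\<^sub>R (B *v u) + G *v w"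

definition plant_meas ::
  "complex^'x^'y \<Rightarrow> complex^'w^'y \<Rightarrow> bool \<Rightarrow> complex^'x \<Rightarrow> complex^'w \<Rightarrow> complex^'y" where
  "plant_meas L H \<gamma> x w = of_bool \<gamma> *\<^sub>R (L *v x + H *v w)"

definition plant_output ::
  "complex^'x^'z \<Rightarrow> complex^'u^'z \<Rightarrow> bool \<Rightarrow> complex^'x \<Rightarrow> complex^'u \<Rightarrow> complex^'z" where
  "plant_output C D \<nu> x u = C *v x + of_bool \<nu> *\<^sub>R (D *v u)"

definition observer_next ::
  "complex^'x^'x \<Rightarrow> complex^'u^'x \<Rightarrow> complex^'x^'y \<Rightarrow> ('s \<Rightarrow> complex^'y^'x) \<Rightarrow>
   's \<Rightarrow> bool \<Rightarrow> bool \<Rightarrow> complex^'x \<Rightarrow> complex^'u \<Rightarrow> complex^'y \<Rightarrow> complex^'x" where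
  "observer_next A B L M n \<nu> \<gamma> xo u y =
     A *v xo + of_bool \<nu> *\<^sub>R (B *v u) - M n *v (y - of_bool \<gamma> *\<^sub>R (L *v xo))"

definition closed_loop ::
  "complex^'x^'x \<Rightarrow> complex^'u^'x \<Rightarrow> complex^'x^'y \<Rightarrow>
   ('m \<Rightarrow> complex^'x^'u) \<Rightarrow> ('s \<Rightarrow> complex^'y^'x) \<Rightarrow>
   'm \<Rightarrow> bool \<Rightarrow> 's \<Rightarrow> bool \<Rightarrow> complex^('x + 'x)^('x + 'x)" where
  "closed_loop A B L F M = (\<lambda>l \<nu> n \<gamma>.
     block_mat (A + of_bool \<nu> *\<^sub>R (B ** F l)) (- (of_bool \<nu> *\<^sub>R (B ** F l)))
               0 (A + of_bool \<gamma> *\<^sub>R (M n ** L)))"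

definition closed_loop_noise ::
  "complex^'w^'x \<Rightarrow> complex^'w^'y \<Rightarrow> ('s \<Rightarrow> complex^'y^'x) \<Rightarrow>
   's \<Rightarrow> bool \<Rightarrow> complex^'w^('x + 'x)" where
  "closed_loop_noise G H M = (\<lambda>n \<gamma>. stack G (G + of_bool \<gamma> *\<^sub>R (M n ** H)))"

lemma block_mat_stack:
  fixes A :: "'a::semiring_1^'n1^'m1" and D :: "'a^'n2^'m2"
  shows "block_mat A B C D *v stack v w = stack (A *v v + B *v w) (C *v v + D *v w)"
  unfolding vec_eq_iff
proof
  fix i :: "'m1 + 'm2"
  show "(block_mat A B C D *v stack v w) $ i = stack (A *v v + B *v w) (C *v v + D *v w) $ i"
    by (cases i)
      (simp_all add: matrix_vector_mult_def block_mat_def stack_def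
        UNIV_Plus_UNIV[symmetric] sum.Plus del: UNIV_Plus_UNIV)
qed

lemma stack_matrix_vector_mult:
  fixes A :: "'a::semiring_1^'n^'m1" and B :: "'a^'n^'m2"
  shows "stack A B *v v = stack (A *v v) (B *v v)"
  unfolding vec_eq_iff
proof
  fix i :: "'m1 + 'm2"
  show "(stack A B *v v) $ i = stack (A *v v) (B *v v) $ i"
    by (cases i) (simp_all add: matrix_vector_mult_def stack_def)
qed

text \<open>One step of the interconnected plant and observer is one step of the closed loop.\<close>

lemma closed_loop_interconnection:
  fixes x xo :: "complex^'x"
  assumes "u = F l *v xo" and "y = plant_meas L H \<gamma> x w"
    and "x' = plant_next A B G \<nu> x u w"
    and "xo' = observer_next A B L M n \<nu> \<gamma> xo u y"
  shows "stack x' (x' - xo') =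
    closed_loop A B L F M l \<nu> n \<gamma> *v stack x (x - xo) + closed_loop_noise G H M n \<gamma> *v w"
proof -
  have add: "stack a b + stack c d = stack (a + c) (b + d)" for a b c d :: "complex^'x"
    by (auto simp: vec_eq_iff stack_def split: sum.splits)
  have minus: "(- K) *v v = - (K *v v)" for K :: "complex^'x^'x" and v
    by (simp add: vec_eq_iff matrix_vector_mult_def sum_negf)
  show ?thesis
    unfolding assms closed_loop_def closed_loop_noise_def block_mat_stack
      stack_matrix_vector_mult add plant_meas_def plant_next_def observer_next_def
    by (cases \<nu>; cases \<gamma>)
      (simp_all add: matrix_vector_mul_assoc[symmetric] matrix_vector_mult_add_rdistrib
        matrix_vector_mult_diff_distrib matrix_vector_right_distrib
        minus algebra_simps)
qed

end

theory Submission
  imports Defs "HOL-Computational_Algebra.Fundamental_Theorem_Algebra"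
begin

text \<open>
  Split \<open>E[\<xi>\<^sub>k \<xi>\<^sub>k\<^sup>*]\<close> according to the pair of channel modes \<open>(\<theta>\<^sub>k\<^sub>-\<^sub>1, \<eta>\<^sub>k\<^sub>-\<^sub>1)\<close>. The resulting tuples obey an
  affine recursion \<open>Z\<^sub>k\<^sub>+\<^sub>1 = T Z\<^sub>k + N\<^sub>k\<close> with a positive linear operator \<open>T\<close> that does not depend on the
  noise, and \<open>N\<^sub>k\<close> converges because the chains are ergodic. Hence mean square stability is equivalent
  to \<open>T\<^sup>k \<rightarrow> 0\<close>: subtracting the moments started at \<open>0\<close> from those started at a deterministic vector
  leaves the homogeneous part. For the closed loop \<open>T\<close> is block triangular, with diagonal blocks the
  operators of the state feedback and of the estimation error, and a mixed block that is dominated by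
  these two. Summing over the modes of the actuation channel turns the operator of the error into
  the operator of the detectability condition, whose powers tend to \<open>0\<close> iff its spectral radius is
  below \<open>1\<close>.
\<close>

section \<open>Stable linear maps\<close>

text \<open>Stability as defined speaks only of the total second moment, and over the reals only of
  real initial states, whereas \<open>T\<close> acts on tuples of complex matrices. Positivity
  closes this gap. The tuples started at \<open>dyad c (axis i 1) (axis i 1)\<close> keep
  nonnegative diagonal entries, so a vanishing sum over the modes makes each of them vanish; a
  Cauchy-Schwarz type bound then controls all other entries, and dyads span the space. The same
  bound handles the mixed block of the closed loop, and the same nonnegativity allows the return
  from a sum over the actuation modes to the single modes.

  The noise is white only to second order, so no Markov property of the state is available. Along a
  fixed channel history, however, the state is a fixed linear combination of the initial state and
  the noise, and the channels are independent of both; hence moments are computed history by history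
  and then averaged. The mean needs no recursion of its own: it equals the mean of the noise-free
  system, which is bounded by the second moment of that system.\<close>

lemma contraction_tendsto_0:
  fixes a e :: "nat \<Rightarrow> real"
  assumes r: "0 \<le> r" "r < 1" and m: "0 < m" and a: "\<And>k. 0 \<le> a k"
    and step: "\<And>k. a (k + m) \<le> r * a k + e k" and e: "e \<longlonglongrightarrow> 0"
  shows "a \<longlonglongrightarrow> 0"
proof (rule LIMSEQ_I)
  fix \<epsilon> :: real assume \<epsilon>: "0 < \<epsilon>"
  \<comment> \<open>With this bound on the forcing, \<open>\<epsilon> / 2\<close> is the fixed point
    of the one-step estimate, so it survives every step of the induction below.\<close>
  then have "0 < \<epsilon> * (1 - r) / 2" using r by simp
  from LIMSEQ_D[OF e this] obtain K where K: "\<And>k. k \<ge> K \<Longrightarrow> \<bar>e k\<bar> < \<epsilon> * (1 - r) / 2"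
    by auto
  \<comment> \<open>\<open>A\<close> dominates \<open>a (K + i)\<close> for every
    \<open>i < m\<close>, so one geometric bound serves all residue classes modulo
    \<open>m\<close>.\<close>
  define A where "A = (\<Sum>i<m. a (K + i))"
  have A: "0 \<le> A" unfolding A_def by (simp add: sum_nonneg a)
  have bound: "a (K + i + j * m) \<le> r ^ j * A + \<epsilon> / 2" if "i < m" for i j
  proof (induction j)
    case 0
    have "a (K + i) \<le> A"
      unfolding A_def using that by (intro member_le_sum) (auto simp: a)
    then show ?case using \<epsilon> by simp
  next
    case (Suc j)
    have "a (K + i + Suc j * m) \<le> r * a (K + i + j * m) + e (K + i + j * m)"
      using step[of "K + i + j * m"] by (simp add: algebra_simps)
    also have "\<dots> \<le> r * (r ^ j * A + \<epsilon> / 2) + \<epsilon> * (1 - r) / 2"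
      using K[of "K + i + j * m"] r Suc by (intro add_mono mult_left_mono) auto
    finally show ?case by (simp add: algebra_simps add_divide_distrib diff_divide_distrib)
  qed
  have "(\<lambda>j. r ^ j * A) \<longlonglongrightarrow> 0 * A"
    using r by (intro tendsto_intros LIMSEQ_realpow_zero) auto
  from LIMSEQ_D[OF this, of "\<epsilon> / 2"] \<epsilon> obtain J where J: "\<And>j. j \<ge> J \<Longrightarrow> \<bar>r ^ j * A\<bar> < \<epsilon> / 2"
    by auto
  have "norm (a k - 0) < \<epsilon>" if k: "k \<ge> K + J * m" for k
  proof -
    let ?i = "(k - K) mod m" and ?j = "(k - K) div m"
    have k_eq: "k = K + ?i + ?j * m" using k by simp
    have "J \<le> ?j" using k m by (simp add: less_eq_div_iff_mult_less_eq)
    with J have "\<bar>r ^ ?j * A\<bar> < \<epsilon> / 2" by blast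
    moreover have "a k \<le> r ^ ?j * A + \<epsilon> / 2"
      using bound[of ?i ?j] m k_eq by (metis mod_less_divisor)
    ultimately show ?thesis using a[of k] by simp
  qed
  then show "\<exists>no. \<forall>k\<ge>no. norm (a k - 0) < \<epsilon>" by blast
qed

text \<open>Pointwise decay is what the moment recursions deliver; in finite dimension it already
  forces some power of a linear map to be a contraction.\<close>

definition stable_map :: "('a::real_normed_vector \<Rightarrow> 'a) \<Rightarrow> bool" where
  "stable_map T \<longleftrightarrow> (\<forall>x. (\<lambda>k. (T ^^ k) x) \<longlonglongrightarrow> 0)"

lemma linear_funpow: "linear T \<Longrightarrow> linear (T ^^ k)"
  for T :: "'a::real_vector \<Rightarrow> 'a"
  by (induction k) (auto intro: linear_compose linear_id simp del: o_apply)

text \<open>Decay on the finitely many basis vectors makes one power \<open>T ^^ m\<close> at least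
  halve every norm. Taking \<open>m\<close> steps at a time leaves a scalar contraction with
  vanishing forcing.\<close>

lemma stable_affine_tendsto_0:
  fixes T :: "'a::euclidean_space \<Rightarrow> 'a"
  assumes T: "linear T" "stable_map T" and d: "d \<longlonglongrightarrow> 0"
    and x: "\<And>k. x (Suc k) = T (x k) + d k"
  shows "x \<longlonglongrightarrow> 0"
proof -
  have "(\<lambda>k. \<Sum>b\<in>Basis. norm ((T ^^ k) b)) \<longlonglongrightarrow> (\<Sum>b\<in>(Basis::'a set). 0)"
    using T(2) unfolding stable_map_def by (intro tendsto_sum) (simp add: tendsto_norm_zero)
  then have "eventually (\<lambda>k. (\<Sum>b\<in>Basis. norm ((T ^^ k) b)) < 1/2) sequentially"
    by (rule order_tendstoD) simp
  then have "eventually (\<lambda>k. (\<Sum>b\<in>Basis. norm ((T ^^ k) b)) < 1/2 \<and> 0 < k) sequentially"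
    using eventually_gt_at_top[of 0] by eventually_elim simp
  then obtain m where m: "(\<Sum>b\<in>Basis. norm ((T ^^ m) b)) < 1/2" "0 < m"
    unfolding eventually_sequentially by blast
  have contr: "norm ((T ^^ m) y) \<le> 1/2 * norm y" for y
  proof -
    interpret L: linear "T ^^ m" by (rule linear_funpow[OF T(1)])
    have "(T ^^ m) y = (T ^^ m) (\<Sum>b\<in>Basis. (y \<bullet> b) *\<^sub>R b)"
      by (simp add: euclidean_representation)
    also have "\<dots> = (\<Sum>b\<in>Basis. (y \<bullet> b) *\<^sub>R (T ^^ m) b)"
      by (simp add: L.sum L.scale)
    also have "norm \<dots> \<le> (\<Sum>b\<in>Basis. norm y * norm ((T ^^ m) b))"
      by (rule order_trans[OF norm_sum])
        (auto intro!: sum_mono mult_right_mono simp: Basis_le_norm)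
    also have "\<dots> \<le> norm y * (1/2)"
      using m(1) unfolding sum_distrib_left[symmetric] by (intro mult_left_mono) auto
    finally show ?thesis by simp
  qed
  \<comment> \<open>The forcing gathered over \<open>n\<close> steps is a sum of \<open>n\<close>
    terms, each transported by a power of \<open>T\<close>; as \<open>n\<close> is fixed, it still
    tends to 0.\<close>
  have "\<exists>f. f \<longlonglongrightarrow> 0 \<and> (\<forall>k. x (k + n) = (T ^^ n) (x k) + f k)" for n
  proof (induction n)
    case 0
    show ?case by (rule exI[of _ "\<lambda>_. 0"]) simp
  next
    case (Suc n)
    then obtain f where f: "f \<longlonglongrightarrow> 0" "\<And>k. x (k + n) = (T ^^ n) (x k) + f k" by blast
    have "isCont T 0" using linear_continuous_at[of T 0] T(1) linear_conv_bounded_linear by blast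
    then have "(\<lambda>k. T (f k)) \<longlonglongrightarrow> T 0" using f(1) by (rule isCont_tendsto_compose)
    moreover have "(\<lambda>k. d (k + n)) \<longlonglongrightarrow> 0" using d by (rule LIMSEQ_ignore_initial_segment)
    ultimately have "(\<lambda>k. T (f k) + d (k + n)) \<longlonglongrightarrow> 0"
      using tendsto_add linear_0[OF T(1)] by fastforce
    moreover have "x (k + Suc n) = (T ^^ Suc n) (x k) + (T (f k) + d (k + n))" for k
      using x[of "k + n"] f(2)[of k] by (simp add: linear_add[OF T(1)])
    ultimately show ?case by blast
  qed
  then obtain f where f: "f \<longlonglongrightarrow> 0" "\<And>k. x (k + m) = (T ^^ m) (x k) + f k" by blast
  have "(\<lambda>k. norm (x k)) \<longlonglongrightarrow> 0"
  proof (rule contraction_tendsto_0[of "1/2" m _ "\<lambda>k. norm (f k)"])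
    show "norm (x (k + m)) \<le> 1/2 * norm (x k) + norm (f k)" for k
      using norm_triangle_ineq[of "(T ^^ m) (x k)" "f k"] contr[of "x k"] f(2)[of k] by simp
  qed (use m f in \<open>auto intro: tendsto_norm_zero\<close>)
  then show ?thesis by (simp add: tendsto_norm_zero_iff)
qed

text \<open>A stable \<open>T\<close> fixes only 0, so \<open>z - T z = d\<^sub>0\<close> is
  solvable, and the deviation from \<open>z\<close> obeys a recursion with vanishing forcing. The
  quantifier order matters: \<open>z\<close> does not depend on the starting point, which is the
  uniformity that mean square stability demands.\<close>

lemma stable_affine_limit:
  fixes T :: "'a::euclidean_space \<Rightarrow> 'a"
  assumes T: "linear T" "stable_map T"
  shows "\<exists>z. \<forall>x d. d \<longlonglongrightarrow> d\<^sub>0 \<and> (\<forall>k. x (Suc k) = T (x k) + d k) \<longrightarrow> x \<longlonglongrightarrow> z"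
proof -
  have lin: "linear (\<lambda>z. z - T z)" using T(1) by (intro linear_compose_sub linear_ident)
  have "inj (\<lambda>z. z - T z)"
    unfolding linear_injective_0[OF lin]
  proof (intro allI impI)
    fix z assume "z - T z = 0"
    then have "(T ^^ k) z = z" for k by (induction k) auto
    moreover have "(\<lambda>k. (T ^^ k) z) \<longlonglongrightarrow> 0" using T(2) by (simp add: stable_map_def)
    ultimately show "z = 0" by (simp add: LIMSEQ_const_iff)
  qed
  then have "surj (\<lambda>z. z - T z)" by (rule linear_inj_imp_surj[OF lin])
  then obtain z where z: "d\<^sub>0 = z - T z" by (auto simp: surj_def)
  have "x \<longlonglongrightarrow> z" if d: "d \<longlonglongrightarrow> d\<^sub>0" and x: "\<And>k. x (Suc k) = T (x k) + d k" for x d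
  proof -
    have "(\<lambda>k. x k - z) \<longlonglongrightarrow> 0"
    proof (rule stable_affine_tendsto_0[OF T])
      show "(\<lambda>k. d k - d\<^sub>0) \<longlonglongrightarrow> 0" using d by (simp add: LIM_zero)
      show "x (Suc k) - z = T (x k - z) + (d k - d\<^sub>0)" for k
        by (simp add: x z linear_diff[OF T(1)])
    qed
    then show ?thesis by (rule LIM_zero_cancel)
  qed
  then show ?thesis by blast
qed

section \<open>Spectral radius\<close>

text \<open>
  The type of matrix tuples only carries real scalars, so complex scaling is a parameter \<open>sc\<close>.
\<close>

locale complex_linear_map =
  fixes sc :: "complex \<Rightarrow> 'a::euclidean_space \<Rightarrow> 'a" and T :: "'a \<Rightarrow> 'a"
  assumes sc_add: "sc a (x + y) = sc a x + sc a y"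
    and add_sc: "sc (a + b) x = sc a x + sc b x"
    and sc_sc: "sc a (sc b x) = sc (a * b) x"
    and sc_of_real: "sc (of_real r) x = r *\<^sub>R x"
    and norm_sc: "norm (sc a x) = cmod a * norm x"
    and T_add: "T (x + y) = T x + T y"
    and T_sc: "T (sc a x) = sc a (T x)"
begin

lemma sc_0: "sc 0 x = 0" and sc_1: "sc 1 x = x" and sc_zero: "sc a 0 = 0"
  using sc_of_real[of 0 x] sc_of_real[of 1 x] sc_add[of a 0 0] by auto

lemma sc_minus: "sc (- a) x = - sc a x"
  using add_sc[of a "- a" x] by (simp add: sc_0 eq_neg_iff_add_eq_0 add.commute)

lemma linear_T: "linear T"
  by (rule linearI) (metis T_add, metis T_sc sc_of_real)

lemma linear_sc: "linear (sc a)"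
  by (rule linearI) (simp add: sc_add, metis sc_of_real sc_sc mult.commute)

text \<open>This is p(T) by Horner's scheme, the complex coefficients acting through
  \<open>sc\<close>.\<close>

definition act :: "complex poly \<Rightarrow> 'a \<Rightarrow> 'a" where
  "act p = fold_coeffs (\<lambda>a f x. sc a x + T (f x)) p (\<lambda>x. 0)"

lemma act_0: "act 0 x = 0"
  by (simp add: act_def)

lemma act_pCons: "act (pCons a p) x = sc a x + T (act p x)"
  by (cases "p = 0 \<and> a = 0") (auto simp: act_def sc_0 linear_0[OF linear_T])

lemma linear_act: "linear (act p)"
proof (induction p)
  case 0
  have "act 0 = (\<lambda>x. 0)" by (rule ext) (simp add: act_0)
  then show ?case by (simp add: linear_zero)
next
  case (pCons a p)
  have "act (pCons a p) = (\<lambda>x. sc a x + (T \<circ> act p) x)" by (rule ext) (simp add: act_pCons)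
  then show ?case
    using linear_compose_add[OF linear_sc linear_compose[OF pCons.IH linear_T]] by simp
qed

lemma act_smult: "act (smult a p) x = sc a (act p x)"
  by (induction p) (auto simp: act_0 act_pCons sc_zero sc_add sc_sc T_sc)

lemma act_add: "act (p + q) x = act p x + act q x"
proof (induction p q rule: poly_induct2)
  case (pCons a p b q)
  then show ?case by (simp add: act_pCons add_sc T_add)
qed (simp add: act_0)

lemma act_mult: "act (p * q) x = act p (act q x)"
  by (induction p)
    (auto simp: act_0 act_pCons act_add act_smult sc_0)

lemma act_sum: "act (sum f I) x = (\<Sum>i\<in>I. act (f i) x)"
  by (induction I rule: infinite_finite_induct) (auto simp: act_0 act_add)

lemma act_monom: "act (monom c k) x = sc c ((T ^^ k) x)"
  by (induction k) (auto simp: monom_0 monom_Suc act_pCons act_0 T_sc sc_0 linear_0[OF linear_T])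

lemma act_linear_factor: "act [:- z, 1:] x = T x - sc z x"
  by (simp add: act_pCons act_0 sc_1 sc_minus linear_0[OF linear_T])

text \<open>More iterates of \<open>x\<close> than the real dimension must be dependent, even over
  the reals. Coinciding iterates are treated apart because dependence is a property of the set of
  iterates, in which a repetition would be lost.\<close>

lemma annihilating_poly: "\<exists>p. p \<noteq> 0 \<and> act p x = 0"
proof (cases "inj_on (\<lambda>i. (T ^^ i) x) {..DIM('a)}")
  case False
  then obtain i j where ij: "i \<noteq> j" "(T ^^ i) x = (T ^^ j) x" by (auto simp: inj_on_def)
  have "coeff (monom 1 i + smult (- 1) (monom 1 j)) i \<noteq> (0::complex)" using ij(1) by simp
  then have "monom 1 i + smult (- 1) (monom 1 j) \<noteq> (0::complex poly)" by (metis coeff_0)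
  moreover have "act (monom 1 i + smult (- 1) (monom 1 j)) x = 0"
    using ij(2) by (simp only: act_add act_smult act_monom sc_1 sc_minus) simp
  ultimately show ?thesis by blast
next
  case True
  let ?B = "(\<lambda>i. (T ^^ i) x) ` {..DIM('a)}"
  have "dependent ?B"
    using True by (intro dependent_biggerset) (auto simp: card_image)
  then obtain S u where S: "finite S" "S \<subseteq> ?B" "(\<Sum>v\<in>S. u v *\<^sub>R v) = 0" "\<exists>v\<in>S. u v \<noteq> 0"
    unfolding dependent_explicit by auto
  define I where "I = {i\<in>{..DIM('a)}. (T ^^ i) x \<in> S}"
  have SI: "S = (\<lambda>i. (T ^^ i) x) ` I" using S(2) by (auto simp: I_def)
  have I: "finite I" "inj_on (\<lambda>i. (T ^^ i) x) I"
    using True by (auto simp: I_def intro: inj_on_subset)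
  define c where "c = (\<lambda>i. complex_of_real (u ((T ^^ i) x)))"
  define p where "p = (\<Sum>i\<in>I. monom (c i) i)"
  have "act p x = (\<Sum>i\<in>I. u ((T ^^ i) x) *\<^sub>R (T ^^ i) x)"
    by (simp add: p_def act_sum act_monom c_def sc_of_real)
  also have "\<dots> = 0" using S(3) unfolding SI by (simp add: sum.reindex[OF I(2)])
  finally have "act p x = 0" .
  moreover from S(4) obtain i where "i \<in> I" "c i \<noteq> 0" unfolding SI c_def by auto
  then have "coeff p i \<noteq> 0" by (simp add: p_def coeff_sum I(1))
  then have "p \<noteq> 0" by auto
  ultimately show ?thesis by blast
qed

definition eigenvalues :: "complex set" where
  "eigenvalues = {z. \<exists>x. x \<noteq> 0 \<and> T x = sc z x}"

text \<open>Split a root \<open>z\<close> off \<open>p\<close>. Either the quotient \<open>q\<close>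
  still kills \<open>x\<close>, and the degree has dropped, or \<open>act q x\<close> is an
  eigenvector for \<open>z\<close>.\<close>

lemma eigenvalues_nonempty:
  assumes "p \<noteq> 0" "act p x = 0" "x \<noteq> 0"
  shows "eigenvalues \<noteq> {}"
  using assms
proof (induction "degree p" arbitrary: p x)
  case 0
  then obtain c where "p = [:c:]" "c \<noteq> 0" by (metis degree_0_id pCons_0_0)
  then have "norm (sc c x) = 0" using 0 by (simp add: act_pCons act_0 linear_0[OF linear_T])
  with \<open>c \<noteq> 0\<close> \<open>x \<noteq> 0\<close> show ?case by (simp add: norm_sc)
next
  case (Suc n)
  then have "\<not> constant (poly p)" by (simp add: constant_degree)
  then obtain z where "poly p z = 0" using fundamental_theorem_of_algebra by blast
  then obtain q where p: "p = [:- z, 1:] * q" unfolding poly_eq_0_iff_dvd dvd_def by blast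
  have q: "q \<noteq> 0" using Suc.prems p by auto
  have "degree q = n" using Suc.hyps(2) q unfolding p by (subst (asm) degree_mult_eq) auto
  show ?case
  proof (cases "act q x = 0")
    case True
    then show ?thesis using Suc.hyps(1)[of q x] q \<open>degree q = n\<close> Suc.prems by simp
  next
    case False
    have "T (act q x) = sc z (act q x)"
      using Suc.prems(2) unfolding p act_mult act_linear_factor by simp
    then show ?thesis using False unfolding eigenvalues_def by blast
  qed
qed

lemma act_eigenvector: "T x = sc z x \<Longrightarrow> act p x = sc (poly p z) x"
  by (induction p) (auto simp: act_0 act_pCons sc_0 T_sc sc_sc add_sc mult.commute)

text \<open>The product of polynomials annihilating the basis vectors annihilates everything, so
  every eigenvalue is one of its roots.\<close>

lemma finite_eigenvalues: "finite eigenvalues"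
proof -
  obtain p where p: "\<And>x. p x \<noteq> 0 \<and> act (p x) x = 0" using annihilating_poly by metis
  define r where "r = (\<Prod>b\<in>Basis. p b)"
  have r0: "r \<noteq> 0" using p by (simp add: r_def)
  have "act r b = 0" if "b \<in> Basis" for b
  proof -
    have "r = (\<Prod>b\<in>Basis - {b}. p b) * p b"
      unfolding r_def using that by (subst prod.remove[of _ b]) (auto simp: mult.commute)
    then show ?thesis using p[of b] by (simp add: act_mult linear_0[OF linear_act])
  qed
  then have r: "act r x = 0" for x
    by (subst euclidean_representation[of x, symmetric])
      (simp add: linear_sum[OF linear_act] linear_scale[OF linear_act])
  have "eigenvalues \<subseteq> {z. poly r z = 0}"
  proof
    fix z assume "z \<in> eigenvalues"
    then obtain x where "x \<noteq> 0" "T x = sc z x" by (auto simp: eigenvalues_def)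
    then have "norm (sc (poly r z) x) = 0" using act_eigenvector[of x z r] r by simp
    with \<open>x \<noteq> 0\<close> show "z \<in> {z. poly r z = 0}" by (simp add: norm_sc)
  qed
  then show ?thesis using poly_roots_finite[OF r0] finite_subset by blast
qed

text \<open>This replaces the Jordan form by induction on the degree of an annihilating polynomial.
  If \<open>z\<close> is a root, \<open>y = T x - sc z x\<close> is annihilated by a polynomial of
  smaller degree, and \<open>x\<close> obeys a scalar recursion with factor \<open>z\<close> and
  forcing \<open>(T ^^ k) y\<close>. The factor is contracting because \<open>z\<close> is an
  eigenvalue unless the quotient already kills \<open>x\<close>.\<close>

lemma funpow_tendsto_0:
  assumes eig: "\<forall>z\<in>eigenvalues. cmod z < 1" and "p \<noteq> 0" "act p x = 0"
  shows "(\<lambda>k. (T ^^ k) x) \<longlonglongrightarrow> 0"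
  using assms(2-)
proof (induction "degree p" arbitrary: p x)
  case 0
  then obtain c where "p = [:c:]" "c \<noteq> 0" by (metis degree_0_id pCons_0_0)
  then have "norm (sc c x) = 0" using 0 by (simp add: act_pCons act_0 linear_0[OF linear_T])
  with \<open>c \<noteq> 0\<close> have "x = 0" by (simp add: norm_sc)
  then show ?case by (simp add: linear_0[OF linear_funpow[OF linear_T]])
next
  case (Suc n)
  then have "\<not> constant (poly p)" by (simp add: constant_degree)
  then obtain z where "poly p z = 0" using fundamental_theorem_of_algebra by blast
  then obtain q where p: "p = [:- z, 1:] * q" unfolding poly_eq_0_iff_dvd dvd_def by blast
  have q: "q \<noteq> 0" using Suc.prems p by auto
  have deg: "n = degree q" using Suc.hyps(2) q unfolding p by (subst (asm) degree_mult_eq) auto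
  show ?case
  proof (cases "act q x = 0")
    case True
    then show ?thesis using Suc.hyps(1)[OF deg q] by simp
  next
    case False
    have "T (act q x) = sc z (act q x)"
      using Suc.prems(2) unfolding p act_mult act_linear_factor by simp
    then have z: "cmod z < 1" using eig False unfolding eigenvalues_def by blast
    define y where "y = T x - sc z x"
    have "act q y = 0"
      using Suc.prems(2) unfolding p mult.commute[of "[:- z, 1:]"] act_mult act_linear_factor
      by (simp add: y_def)
    then have y: "(\<lambda>k. (T ^^ k) y) \<longlonglongrightarrow> 0" using Suc.hyps(1)[OF deg q] by simp
    have step: "(T ^^ Suc k) x = sc z ((T ^^ k) x) + (T ^^ k) y" for k
    proof -
      have "(T ^^ k) (sc z x) = sc z ((T ^^ k) x)" by (induction k) (auto simp: T_sc)
      then show ?thesis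
        by (simp add: y_def linear_diff[OF linear_funpow[OF linear_T]] funpow_swap1)
    qed
    have "(\<lambda>k. norm ((T ^^ k) x)) \<longlonglongrightarrow> 0"
    proof (rule contraction_tendsto_0[of "cmod z" 1 _ "\<lambda>k. norm ((T ^^ k) y)"])
      show "norm ((T ^^ (k + 1)) x) \<le> cmod z * norm ((T ^^ k) x) + norm ((T ^^ k) y)" for k
        using norm_triangle_ineq[of "sc z ((T ^^ k) x)" "(T ^^ k) y"] step[of k]
        by (simp add: norm_sc)
    qed (use z y in \<open>auto intro: tendsto_norm_zero\<close>)
    then show ?thesis by (simp add: tendsto_norm_zero_iff)
  qed
qed

lemma stable_map_iff_eigenvalues: "stable_map T \<longleftrightarrow> (\<forall>z\<in>eigenvalues. cmod z < 1)"
proof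
  assume stable: "stable_map T"
  show "\<forall>z\<in>eigenvalues. cmod z < 1"
  proof
    fix z assume "z \<in> eigenvalues"
    then obtain x where x: "x \<noteq> 0" "T x = sc z x" by (auto simp: eigenvalues_def)
    have "(T ^^ k) x = sc (z ^ k) x" for k
      by (induction k) (auto simp: sc_1 T_sc x(2) sc_sc mult.commute)
    then have "(\<lambda>k. norm (sc (z ^ k) x)) \<longlonglongrightarrow> 0"
      using stable unfolding stable_map_def by (metis (no_types, lifting) ext tendsto_norm_zero)
    then have "(\<lambda>k. cmod z ^ k * norm x / norm x) \<longlonglongrightarrow> 0 / norm x"
      unfolding norm_sc norm_power by (intro tendsto_divide tendsto_const) (use x in auto)
    then have "(\<lambda>k. cmod z ^ k) \<longlonglongrightarrow> 0" using x by simp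
    then have "eventually (\<lambda>k. cmod z ^ k < 1) sequentially" by (rule order_tendstoD) simp
    then show "cmod z < 1"
      by (meson eventually_happens linorder_not_le one_le_power sequentially_bot)
  qed
next
  assume "\<forall>z\<in>eigenvalues. cmod z < 1"
  then show "stable_map T"
    unfolding stable_map_def using annihilating_poly funpow_tendsto_0 by metis
qed

text \<open>\<open>Max\<close> is meaningful only for a finite nonempty set; an annihilated basis
  vector supplies an eigenvalue.\<close>

lemma stable_map_iff_Max: "stable_map T \<longleftrightarrow> Max (cmod ` eigenvalues) < 1"
proof -
  obtain b :: 'a where "b \<in> Basis" using nonempty_Basis by blast
  then have "eigenvalues \<noteq> {}"
    using annihilating_poly[of b] eigenvalues_nonempty nonzero_Basis by blast
  then show ?thesis
    unfolding stable_map_iff_eigenvalues using finite_eigenvalues by (subst Max_less_iff) auto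
qed

end

section \<open>Ergodic chains converge\<close>

text \<open>The least positive difference \<open>d\<close> of two elements divides every element, so
  it is 1 and the set, with 0 added, contains some \<open>b\<close> and \<open>b + 1\<close>. These
  generate every \<open>k\<close> whose quotient by \<open>b\<close> is at least its remainder, as
  \<open>k = (q - r) * b + r * (b + 1)\<close>.\<close>

lemma add_closed_Gcd_1_eventually:
  fixes S :: "nat set"
  assumes add: "\<And>a b. a \<in> S \<Longrightarrow> b \<in> S \<Longrightarrow> a + b \<in> S" and S: "Gcd S = 1"
  shows "\<exists>K. \<forall>k\<ge>K. k \<in> S"
proof -
  define S0 where "S0 = insert 0 S"
  have add0: "a + b \<in> S0" if "a \<in> S0" "b \<in> S0" for a b
    using that add by (auto simp: S0_def)
  have mult0: "q * a \<in> S0" if "a \<in> S0" for q a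
  proof (induction q)
    case (Suc q)
    then show ?case using add0[OF that Suc] by simp
  qed (simp add: S0_def)
  define D where "D = {d. 0 < d \<and> (\<exists>a\<in>S0. \<exists>b\<in>S0. a = b + d)}"
  have "\<exists>s\<in>S. s \<noteq> 0" using S by (metis Gcd_0_iff subsetI zero_neq_one singleton_iff)
  then obtain s where "s \<in> S" "0 < s" by auto
  then have "s \<in> D" by (auto simp: D_def S0_def)
  define d where "d = (LEAST d. d \<in> D)"
  have d: "d \<in> D" unfolding d_def by (rule LeastI) (rule \<open>s \<in> D\<close>)
  then obtain a b where ab: "a \<in> S0" "b \<in> S0" "a = b + d" "0 < d" by (auto simp: D_def)
  have "d dvd t" if t: "t \<in> S" for t
  proof (rule ccontr)
    assume "\<not> d dvd t"
    then have r: "0 < t mod d" by (simp add: mod_greater_zero_iff_not_dvd)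
    \<comment> \<open>If \<open>d\<close> did not divide \<open>t\<close>, the remainder would be a
      smaller positive difference.\<close>
    have "t + (t div d) * b = (t div d) * a + t mod d"
      using ab(3) by (simp add: algebra_simps)
    moreover have "t + (t div d) * b \<in> S0" using t ab by (intro add0 mult0) (simp add: S0_def)
    moreover have "(t div d) * a \<in> S0" using ab by (intro mult0)
    ultimately have "t mod d \<in> D" using r unfolding D_def by blast
    then have "d \<le> t mod d" unfolding d_def by (rule Least_le)
    then show False using mod_less_divisor[OF ab(4), of t] by linarith
  qed
  then have "d dvd Gcd S" by (rule Gcd_greatest)
  then have "d = 1" using S by simp
  \<comment> \<open>From \<open>b * b\<close> on the quotient by \<open>b\<close> is at least
    \<open>b\<close>; the extra 1 excludes \<open>k = 0\<close>, which was added to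
    \<open>S0\<close> artificially.\<close>
  have "k \<in> S" if k: "k \<ge> b * b + 1" for k
  proof -
    have "k \<in> S0"
    proof (cases "b = 0")
      case True
      then show ?thesis using mult0[OF ab(1), of k] ab(3) \<open>d = 1\<close> by simp
    next
      case False
      let ?q = "k div b" and ?r = "k mod b"
      have "b \<le> ?q" using k False by (simp add: less_eq_div_iff_mult_less_eq)
      moreover have r: "?r < b" using False by simp
      ultimately have "?r \<le> ?q" by simp
      have "k = (?q - ?r) * b + ?r * a"
        using \<open>?r \<le> ?q\<close> ab(3) \<open>d = 1\<close>
        by (simp add: diff_mult_distrib algebra_simps)
      then show ?thesis using add0 mult0 ab by metis
    qed
    then show ?thesis using k by (auto simp: S0_def)
  qed
  then show ?thesis by blast
qed

lemma mat_power_add: "mat_power P (a + b) = mat_power P a ** mat_power P b"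
  by (induction a) (simp_all add: mat_power_def matrix_mul_assoc)

lemma funpow_vector_matrix: "((\<lambda>x. x v* P) ^^ k) x = x v* mat_power P k"
proof (induction k arbitrary: x)
  case (Suc k)
  have "((\<lambda>x. x v* P) ^^ Suc k) x = ((\<lambda>x. x v* P) ^^ k) (x v* P)" by (simp only: funpow_Suc_right o_apply)
  then show ?case by (simp add: Suc.IH mat_power_def vector_matrix_mul_assoc)
qed (simp add: mat_power_def)

lemma stochastic_mult: "stochastic P \<Longrightarrow> stochastic Q \<Longrightarrow> stochastic (P ** Q)"
  unfolding stochastic_def matrix_matrix_mult_def
  by (auto intro!: sum_nonneg simp: sum.swap[of _ UNIV UNIV] sum_distrib_left[symmetric])

lemma stochastic_mat_power: "stochastic P \<Longrightarrow> stochastic (mat_power P k)"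
proof (induction k)
  case 0
  show ?case by (simp add: mat_power_def stochastic_def mat_def)
qed (simp add: mat_power_def stochastic_mult)

text \<open>By aperiodicity every sufficiently long loop at \<open>i\<close> has positive
  probability, so a path from \<open>i\<close> to \<open>j\<close> can be padded at its start to a
  length \<open>N\<close> common to all pairs.\<close>

lemma ergodic_chain_primitive:
  assumes "ergodic_chain P"
  shows "\<exists>N>0. \<forall>i j. 0 < mat_power P N $ i $ j"
proof -
  have st: "stochastic (mat_power P k)" for k
    using assms by (simp add: ergodic_chain_def stochastic_mat_power)
  have pos: "0 < mat_power P (a + b) $ i $ j"
    if "0 < mat_power P a $ i $ l" "0 < mat_power P b $ l $ j" for a b i j l
  proof -
    have "0 < mat_power P a $ i $ l * mat_power P b $ l $ j" using that by simp
    also have "\<dots> \<le> mat_power P (a + b) $ i $ j"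
      unfolding mat_power_add matrix_matrix_mult_def
      using st by (auto simp: stochastic_def intro!: member_le_sum)
    finally show ?thesis .
  qed
  have "\<exists>K. \<forall>k\<ge>K. 0 < mat_power P k $ i $ i" for i
  proof -
    have "\<exists>K. \<forall>k\<ge>K. k \<in> {k. 0 < k \<and> 0 < mat_power P k $ i $ i}"
      using assms pos
      by (intro add_closed_Gcd_1_eventually)
        (auto simp: ergodic_chain_def aperiodic_chain_def)
    then show ?thesis by auto
  qed
  then obtain K where K: "\<And>i k. k \<ge> K i \<Longrightarrow> 0 < mat_power P k $ i $ i" by metis
  have "\<forall>i j. \<exists>k. 0 < mat_power P k $ i $ j"
    using assms by (simp add: ergodic_chain_def irreducible_chain_def)
  then obtain h where h: "\<And>i j. 0 < mat_power P (h i j) $ i $ j" by metis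
  \<comment> \<open>The sum exceeds every \<open>K i + h i j\<close>; the 1 keeps \<open>N\<close>
    positive, as an iterated contraction requires.\<close>
  define N where "N = 1 + (\<Sum>i\<in>UNIV. \<Sum>j\<in>UNIV. K i + h i j)"
  have "K i + h i j \<le> N" for i j
  proof -
    have "K i + h i j \<le> (\<Sum>j\<in>UNIV. K i + h i j)" by (rule member_le_sum) auto
    also have "\<dots> \<le> (\<Sum>i\<in>UNIV. \<Sum>j\<in>UNIV. K i + h i j)"
      by (rule member_le_sum[of i UNIV "\<lambda>i. \<Sum>j\<in>UNIV. K i + h i j"]) auto
    finally show ?thesis by (simp add: N_def)
  qed
  then have "0 < mat_power P (N - h i j + h i j) $ i $ j" for i j
    by (intro pos[OF K h]) (metis add_le_imp_le_diff)
  moreover have "N - h i j + h i j = N" for i j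
    using \<open>K i + h i j \<le> N\<close> by simp
  ultimately have "\<forall>i j. 0 < mat_power P N $ i $ j" by metis
  moreover have "N > 0" by (simp add: N_def)
  ultimately show ?thesis by blast
qed

lemma sum_vector_matrix_stochastic:
  "stochastic P \<Longrightarrow> (\<Sum>j\<in>UNIV. (x v* P) $ j) = (\<Sum>i\<in>UNIV. x $ i)"
  unfolding vector_matrix_mult_def stochastic_def
  by (simp, subst sum.swap, simp add: sum_distrib_left[symmetric])

text \<open>
  Subtracting a fixed probability vector keeps \<open>x \<mapsto> x P\<close> unchanged on vectors with sum \<open>0\<close>, where
  some power of \<open>P\<close> contracts, and maps every vector there.
\<close>

lemma ergodic_chain_stable:
  fixes P :: "real^'m^'m"
  assumes P: "ergodic_chain P"
  shows "stable_map (\<lambda>x. x v* P - (\<Sum>i\<in>UNIV. x $ i) *\<^sub>R axis l 1)"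
proof -
  define T where "T = (\<lambda>x. x v* P - (\<Sum>i\<in>UNIV. x $ i) *\<^sub>R axis l 1)"
  let ?s = "\<lambda>x :: real^'m. \<Sum>i\<in>UNIV. x $ i"
  have st: "stochastic P" using P by (simp add: ergodic_chain_def)
  obtain N where N: "0 < N" "\<And>i j. 0 < mat_power P N $ i $ j"
    using ergodic_chain_primitive[OF P] by blast
  define M where "M = mat_power P N"
  have M: "stochastic M" unfolding M_def by (rule stochastic_mat_power[OF st])
  define \<delta> where "\<delta> = Min (range (\<lambda>(i, j). M $ i $ j))"
  have \<delta>: "0 < \<delta>" "\<And>i j. \<delta> \<le> M $ i $ j"
  proof -
    show "0 < \<delta>" unfolding \<delta>_def by (subst Min_gr_iff) (auto simp: M_def N)
    show "\<delta> \<le> M $ i $ j" for i j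
      unfolding \<delta>_def by (rule Min_le) (auto intro: range_eqI[of _ _ "(i, j)"])
  qed
  \<comment> \<open>Doeblin's argument: lowering all entries of \<open>M\<close> by
    \<open>\<delta>\<close> does not change \<open>x v* M\<close> when \<open>x\<close> has sum 0,
    but it reduces each row sum to \<open>r\<close>, which becomes the contraction factor in the l1
    norm.\<close>
  define r where "r = 1 - real CARD('m) * \<delta>"
  have r_eq: "(\<Sum>j\<in>UNIV. M $ i $ j - \<delta>) = r" for i
    using M by (simp add: r_def sum_subtractf stochastic_def)
  have r: "0 \<le> r" "r < 1"
  proof -
    show "0 \<le> r" unfolding r_eq[of undefined, symmetric] by (rule sum_nonneg) (simp add: \<delta>)
    show "r < 1" using \<delta>(1) by (simp add: r_def)
  qed
  have contr: "(\<Sum>j\<in>UNIV. \<bar>(x v* M) $ j\<bar>) \<le> r * (\<Sum>i\<in>UNIV. \<bar>x $ i\<bar>)" if "?s x = 0" for x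
  proof -
    have "(x v* M) $ j = (\<Sum>i\<in>UNIV. (M $ i $ j - \<delta>) * x $ i)" for j
      using that by (simp add: vector_matrix_mult_def algebra_simps sum_subtractf
          sum_distrib_left[symmetric])
    then have "(\<Sum>j\<in>UNIV. \<bar>(x v* M) $ j\<bar>) \<le> (\<Sum>j\<in>UNIV. \<Sum>i\<in>UNIV. (M $ i $ j - \<delta>) * \<bar>x $ i\<bar>)"
      using \<delta>(2) by (auto intro!: sum_mono order_trans[OF sum_abs] simp: abs_mult)
    also have "\<dots> = (\<Sum>i\<in>UNIV. r * \<bar>x $ i\<bar>)"
      by (subst sum.swap) (simp add: sum_distrib_right[symmetric] r_eq)
    finally show ?thesis by (simp add: sum_distrib_left)
  qed
  have sum_T: "?s (T x) = 0" for x
    using sum_vector_matrix_stochastic[OF st, of x]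
    by (simp add: T_def sum_subtractf sum_distrib_left[symmetric] axis_def)
  have T_0: "T x = x v* P" if "?s x = 0" for x
    using that by (simp add: T_def)
  have funpow_T: "(T ^^ k) x = x v* mat_power P k \<and> ?s ((T ^^ k) x) = 0" if "?s x = 0" for x k
  proof -
    have "(T ^^ k) x = ((\<lambda>x. x v* P) ^^ k) x \<and> ?s ((T ^^ k) x) = 0"
    proof (induction k)
      case (Suc k)
      have "(T ^^ Suc k) x = T ((T ^^ k) x)" by simp
      also have "\<dots> = (T ^^ k) x v* P" by (rule T_0[OF conjunct2[OF Suc]])
      also have "\<dots> = ((\<lambda>x. x v* P) ^^ Suc k) x" using Suc by simp
      finally show ?case using sum_T[of "(T ^^ k) x"] by simp
    qed (simp add: that)
    then show ?thesis unfolding funpow_vector_matrix .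
  qed
  have lim0: "(\<lambda>k. (T ^^ k) x) \<longlonglongrightarrow> 0" if x: "?s x = 0" for x
  proof -
    have a: "(\<lambda>k. \<Sum>j\<in>UNIV. \<bar>((T ^^ k) x) $ j\<bar>) \<longlonglongrightarrow> 0"
    proof (rule contraction_tendsto_0[OF r N(1), of _ "\<lambda>_. 0"])
      fix k
      have "(T ^^ (k + N)) x = (T ^^ N) ((T ^^ k) x)"
        by (metis add.commute comp_apply funpow_add)
      also have "\<dots> = (T ^^ k) x v* M"
        unfolding M_def using funpow_T[OF x, of k] by (intro conjunct1[OF funpow_T]) blast
      finally show "(\<Sum>j\<in>UNIV. \<bar>((T ^^ (k + N)) x) $ j\<bar>) \<le> r * (\<Sum>j\<in>UNIV. \<bar>((T ^^ k) x) $ j\<bar>) + 0"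
        using contr[OF conjunct2[OF funpow_T[OF x, of k]]] by simp
    qed (auto simp: sum_nonneg)
    have "norm ((T ^^ k) x) \<le> (\<Sum>j\<in>UNIV. \<bar>((T ^^ k) x) $ j\<bar>)" for k
      using norm_le_l1_cart by auto
    then show ?thesis by (intro Lim_null_comparison[OF _ a]) auto
  qed
  show ?thesis
    unfolding stable_map_def T_def[symmetric]
  proof
    fix x
    have "(\<lambda>k. (T ^^ Suc k) x) \<longlonglongrightarrow> 0"
      using lim0[OF sum_T[of x]] by (simp only: funpow_Suc_right comp_apply)
    then show "(\<lambda>k. (T ^^ k) x) \<longlonglongrightarrow> 0" by (rule filterlim_sequentially_Suc[THEN iffD1])
  qed
qed

text \<open>On vectors with sum 1, \<open>x v* P\<close> is the stable map of
  \<open>ergodic_chain_stable\<close> plus the constant \<open>axis l 1\<close>, so the law of the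
  chain is an affine recursion with constant forcing. The mode \<open>l\<close> is
  arbitrary.\<close>

lemma ergodic_chain_limit:
  fixes P :: "real^'m^'m"
  assumes P: "ergodic_chain P"
  shows "\<exists>\<pi>. \<forall>\<mu>. (\<forall>k j. \<mu> (Suc k) j = (\<Sum>i\<in>UNIV. \<mu> k i * P $ i $ j)) \<and> (\<Sum>i\<in>UNIV. \<mu> 0 i) = 1
    \<longrightarrow> (\<forall>i. (\<lambda>k. \<mu> k i) \<longlonglongrightarrow> \<pi> i)"
proof -
  obtain l :: 'm where True by simp
  let ?T = "\<lambda>x :: real^'m. x v* P - (\<Sum>i\<in>UNIV. x $ i) *\<^sub>R axis l 1"
  have "linear ?T"
    by (rule linearI)
      (auto simp: vec_eq_iff vector_matrix_mult_def sum.distrib algebra_simps sum_distrib_left)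
  from stable_affine_limit[OF this ergodic_chain_stable[OF P], of "axis l 1"]
  obtain z where z: "\<And>x d. d \<longlonglongrightarrow> axis l 1 \<Longrightarrow> (\<forall>k. x (Suc k) = ?T (x k) + d k) \<Longrightarrow> x \<longlonglongrightarrow> z"
    by blast
  have "(\<lambda>k. \<mu> k i) \<longlonglongrightarrow> z $ i"
    if \<mu>: "\<And>k j. \<mu> (Suc k) j = (\<Sum>i\<in>UNIV. \<mu> k i * P $ i $ j)" "(\<Sum>i\<in>UNIV. \<mu> 0 i) = 1" for \<mu> i
  proof -
    define x where "x = (\<lambda>k. \<chi> i. \<mu> k i)"
    have x: "x (Suc k) = x k v* P" for k
      by (simp add: x_def vec_eq_iff vector_matrix_mult_def \<mu>(1) mult.commute)
    have sum1: "(\<Sum>i\<in>UNIV. x k $ i) = 1" for k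
    proof (induction k)
      case (Suc k)
      have "stochastic P" using P by (simp add: ergodic_chain_def)
      from sum_vector_matrix_stochastic[OF this] show ?case by (simp add: x Suc)
    qed (simp add: x_def \<mu>)
    have "x \<longlonglongrightarrow> z" by (rule z[of "\<lambda>_. axis l 1"]) (auto simp: x sum1)
    then have "(\<lambda>k. x k $ i) \<longlonglongrightarrow> z $ i" by (rule tendsto_vec_nth)
    then show ?thesis by (simp add: x_def)
  qed
  then show ?thesis by blast
qed

section \<open>Second moment operators\<close>

lemma linear_sandwich: "linear (\<lambda>Y. A ** Y ** B)"
  for A :: "complex^'n^'m" and B :: "complex^'q^'p"
  by (rule linearI)
    (simp_all add: vec_eq_iff matrix_matrix_mult_def sum.distrib algebra_simps
      sum_distrib_left sum_distrib_right scaleR_sum_right)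

lemma matrix_mult_add_rdistrib: "(A + B) ** C = A ** C + B ** C"
  for A B :: "complex^'n^'m"
  by (simp add: vec_eq_iff matrix_matrix_mult_def sum.distrib distrib_right)

definition kraus_op ::
  "('c \<Rightarrow> 'd \<Rightarrow> 'e \<Rightarrow> real) \<Rightarrow> ('c \<Rightarrow> 'd \<Rightarrow> 'e \<Rightarrow> complex^'n1^'n) \<Rightarrow>
   ('c \<Rightarrow> 'd \<Rightarrow> 'e \<Rightarrow> complex^'p1^'p) \<Rightarrow> complex^'p1^'n1^'c \<Rightarrow> complex^'p^'n^'d" where
  "kraus_op \<kappa> \<Phi> \<Psi> Y =
     (\<chi> d. \<Sum>c\<in>UNIV. \<Sum>e\<in>UNIV. \<kappa> c d e *\<^sub>R (\<Phi> c d e ** Y $ c ** adj (\<Psi> c d e)))"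

lemma linear_kraus_op: "linear (kraus_op \<kappa> \<Phi> \<Psi>)"
proof (rule linearI)
  note l = linear_sandwich
  show "kraus_op \<kappa> \<Phi> \<Psi> (Y + Z) = kraus_op \<kappa> \<Phi> \<Psi> Y + kraus_op \<kappa> \<Phi> \<Psi> Z" for Y Z
    unfolding kraus_op_def
    by (rule vec_eq_iff[THEN iffD2]) (simp add: linear_add[OF l] scaleR_add_right sum.distrib)
  show "kraus_op \<kappa> \<Phi> \<Psi> (r *\<^sub>R Y) = r *\<^sub>R kraus_op \<kappa> \<Phi> \<Psi> Y" for r Y
    unfolding kraus_op_def
    by (rule vec_eq_iff[THEN iffD2]) (simp add: linear_scale[OF l] scaleR_sum_right mult.commute)
qed

section \<open>Positivity and the Cauchy-Schwarz bound\<close>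

definition cdot :: "complex^'n \<Rightarrow> complex^'n \<Rightarrow> complex" where
  "cdot a b = (\<Sum>i\<in>UNIV. cnj (a $ i) * b $ i)"

lemma cdot_matrix: "cdot a (A *v b) = cdot (adj A *v a) b"
proof -
  have "cdot a (A *v b) = (\<Sum>i\<in>UNIV. \<Sum>j\<in>UNIV. cnj (a $ i) * A $ i $ j * b $ j)"
    by (simp add: cdot_def matrix_vector_mult_def sum_distrib_left mult.assoc)
  also have "\<dots> = (\<Sum>j\<in>UNIV. \<Sum>i\<in>UNIV. cnj (a $ i) * A $ i $ j * b $ j)" by (rule sum.swap)
  also have "\<dots> = cdot (adj A *v a) b"
    by (simp add: cdot_def matrix_vector_mult_def adj_def sum_distrib_left mult_ac)
  finally show ?thesis .
qed

lemma cdot_axis: "cdot (axis i 1) (Y *v axis j 1) = Y $ i $ j"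
proof -
  have "(Y *v axis j 1) $ k = Y $ k $ j" for k
    by (simp add: matrix_vector_mult_def axis_def if_distrib cong: if_cong)
  then show ?thesis by (simp add: cdot_def axis_def if_distrib if_distribR cong: if_cong)
qed

lemma linear_cdot_right: "linear (\<lambda>Y. cdot a (Y *v b))"
  by (rule linearI)
    (simp_all add: cdot_def matrix_vector_mult_def sum.distrib algebra_simps scaleR_sum_right
      sum_distrib_left)

lemma cdot_zero: "cdot a 0 = 0"
  by (simp add: cdot_def)

lemma cdot_outer: "cdot a (outer u v *v b) = cdot a u * cnj (cdot b v)"
  by (simp add: cdot_def matrix_vector_mult_def outer_def sum_product sum_distrib_left mult_ac)
    (rule sum.swap)

lemma cdot_sandwich: "cdot a ((X ** Z ** adj W) *v b) = cdot (adj X *v a) (Z *v (adj W *v b))"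
  by (simp only: matrix_vector_mul_assoc[symmetric] cdot_matrix[of a X])

lemma cdot_kraus_op:
  "cdot a (kraus_op \<kappa> \<Phi> \<Psi> Y $ d *v b) = (\<Sum>c\<in>UNIV. \<Sum>e\<in>UNIV. \<kappa> c d e *\<^sub>R
     cdot (adj (\<Phi> c d e) *v a) (Y $ c *v (adj (\<Psi> c d e) *v b)))"
  by (simp add: kraus_op_def linear_sum[OF linear_cdot_right] linear_scale[OF linear_cdot_right]
      cdot_sandwich)

text \<open>For \<open>u = v\<close> this is the second moment tuple of a deterministic state
  \<open>v\<close> with the modes fixed at \<open>c\<close>.\<close>

definition dyad :: "'c \<Rightarrow> complex^'n \<Rightarrow> complex^'p \<Rightarrow> complex^'p^'n^'c" where
  "dyad c u v = (\<chi> d. if d = c then outer u v else 0)"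

text \<open>
  The diagonal blocks of a positive semidefinite block matrix dominate the off-diagonal one, and
  the three operators act on the blocks as one positive map of the block matrix.
\<close>

lemma kraus_op_cross_bound:
  fixes \<Phi> :: "'c::finite \<Rightarrow> 'c \<Rightarrow> 'e \<Rightarrow> complex^'n^'n" and \<Psi> :: "'c \<Rightarrow> 'c \<Rightarrow> 'e \<Rightarrow> complex^'p^'p"
    and u :: "complex^'n" and v :: "complex^'p"
  assumes \<kappa>: "\<And>c d e. 0 \<le> \<kappa> c d e"
  shows "2 * cmod (cdot a (((kraus_op \<kappa> \<Phi> \<Psi> ^^ k) (dyad c u v)) $ d *v b)) \<le>
    Re (cdot a (((kraus_op \<kappa> \<Phi> \<Phi> ^^ k) (dyad c u u)) $ d *v a)) +
    Re (cdot b (((kraus_op \<kappa> \<Psi> \<Psi> ^^ k) (dyad c v v)) $ d *v b))"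
\<comment> \<open>The test vectors must be free: one application of the operator moves the adjoint
  matrices onto \<open>a\<close> and \<open>b\<close>.\<close>
proof (induction k arbitrary: a b d)
  case (0 a b d)
  have "2 * (cmod x * cmod y) \<le> Re (x * cnj x) + Re (y * cnj y)" for x y
    using sum_squares_bound[of "cmod x" "cmod y"]
    by (simp add: complex_mult_cnj cmod_power2 power2_eq_square[symmetric])
  from this[of "cdot a u" "cdot b v"] show ?case
    by (auto simp: dyad_def cdot_outer norm_mult cdot_zero)
next
  case (Suc k a b d)
  let ?Y = "(kraus_op \<kappa> \<Phi> \<Psi> ^^ k) (dyad c u v)"
  let ?U = "(kraus_op \<kappa> \<Phi> \<Phi> ^^ k) (dyad c u u)" and ?V = "(kraus_op \<kappa> \<Psi> \<Psi> ^^ k) (dyad c v v)"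
  let ?a = "\<lambda>c e. adj (\<Phi> c d e) *v a" and ?b = "\<lambda>c e. adj (\<Psi> c d e) *v b"
  have "2 * cmod (cdot a (kraus_op \<kappa> \<Phi> \<Psi> ?Y $ d *v b)) \<le>
      2 * (\<Sum>c\<in>UNIV. \<Sum>e\<in>UNIV. \<kappa> c d e * cmod (cdot (?a c e) (?Y $ c *v ?b c e)))"
    unfolding cdot_kraus_op
    by (intro mult_left_mono order_trans[OF norm_sum] sum_mono) (auto simp: \<kappa>)
  also have "\<dots> \<le> (\<Sum>c\<in>UNIV. \<Sum>e\<in>UNIV. \<kappa> c d e *
      (Re (cdot (?a c e) (?U $ c *v ?a c e)) + Re (cdot (?b c e) (?V $ c *v ?b c e))))"
    unfolding sum_distrib_left
  proof (intro sum_mono)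
    fix c e
    show "2 * (\<kappa> c d e * cmod (cdot (?a c e) (?Y $ c *v ?b c e))) \<le> \<kappa> c d e *
      (Re (cdot (?a c e) (?U $ c *v ?a c e)) + Re (cdot (?b c e) (?V $ c *v ?b c e)))"
      using mult_left_mono[OF Suc[where a = "?a c e" and d = c and b = "?b c e"] \<kappa>[of c d e]]
      by (simp only: mult.left_commute[of 2])
  qed
  also have "\<dots> = Re (cdot a (kraus_op \<kappa> \<Phi> \<Phi> ?U $ d *v a)) +
      Re (cdot b (kraus_op \<kappa> \<Psi> \<Psi> ?V $ d *v b))"
    unfolding cdot_kraus_op by (simp add: sum.distrib distrib_left)
  finally show ?case by simp
qed

text \<open>The cross bound with both families and all vectors equal reads
  \<open>2 * cmod z \<le> 2 * Re z\<close>, which forces nonnegativity.\<close>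

lemma kraus_op_diag_nonneg:
  fixes \<Phi> :: "'c::finite \<Rightarrow> 'c \<Rightarrow> 'e \<Rightarrow> complex^'n^'n"
  assumes "\<And>c d e. 0 \<le> \<kappa> c d e"
  shows "0 \<le> Re (((kraus_op \<kappa> \<Phi> \<Phi> ^^ k) (dyad c u u)) $ d $ i $ i)"
proof -
  let ?z = "((kraus_op \<kappa> \<Phi> \<Phi> ^^ k) (dyad c u u)) $ d $ i $ i"
  have "2 * cmod ?z \<le> Re ?z + Re ?z"
    using kraus_op_cross_bound[where \<kappa> = \<kappa> and a = "axis i 1" and b = "axis i 1" and \<Phi> = \<Phi>
        and \<Psi> = \<Phi> and u = u and v = u and k = k and c = c and d = d, OF assms]
    unfolding cdot_axis .
  then show ?thesis using norm_ge_zero[of ?z] by linarith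
qed

text \<open>Tuples carry only real scalars, so the complex coefficient is placed inside the first
  vector of the dyad.\<close>

lemma dyad_decomposition:
  "Y = (\<Sum>c\<in>UNIV. \<Sum>i\<in>UNIV. \<Sum>j\<in>UNIV. dyad c (axis i (Y $ c $ i $ j)) (axis j 1))"
proof -
  have "(\<Sum>c\<in>UNIV. \<Sum>i\<in>UNIV. \<Sum>j\<in>UNIV. dyad c (axis i (Y $ c $ i $ j)) (axis j 1)) $ d $ p $ q
      = (\<Sum>c\<in>UNIV. \<Sum>i\<in>UNIV. \<Sum>j\<in>UNIV.
          of_bool (c = d) * (of_bool (i = p) * (of_bool (j = q) * Y $ d $ p $ q)))" for d p q
    unfolding sum_component by (intro sum.cong refl) (auto simp: dyad_def outer_def axis_def)
  also have "\<dots> d p q = Y $ d $ p $ q" for d p q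
    by (simp add: sum_distrib_left[symmetric])
  finally show ?thesis unfolding vec_eq_iff by (intro allI) (rule sym)
qed

text \<open>With the complex factor in both slots its phase cancels; what remains is a real scalar,
  which a real-linear map respects.\<close>

lemma dyad_axis: "dyad c (axis i z) (axis i z) = (cmod z)\<^sup>2 *\<^sub>R dyad c (axis i 1) (axis i 1)"
proof -
  have "z * cnj z = (cmod z)\<^sup>2 *\<^sub>R 1"
    by (simp only: scaleR_conv_of_real complex_norm_square mult_1_right)
  then show ?thesis by (simp add: vec_eq_iff dyad_def outer_def axis_def)
qed

text \<open>The cross bound reduces every entry, from every dyad, to diagonal entries started at
  unit dyads, and dyads span. Unit vectors have entries in either scalar field, so this test can be
  met by admissible initial states.\<close>

lemma stable_kraus_opI:
  fixes \<Phi> :: "'c::finite \<Rightarrow> 'c \<Rightarrow> 'e::finite \<Rightarrow> complex^'n^'n" and \<Psi> :: "'c \<Rightarrow> 'c \<Rightarrow> 'e \<Rightarrow> complex^'p^'p"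
  assumes \<kappa>: "\<And>c d e. 0 \<le> \<kappa> c d e"
    and \<Phi>: "\<And>c i d j. (\<lambda>k. Re (((kraus_op \<kappa> \<Phi> \<Phi> ^^ k) (dyad c (axis i 1) (axis i 1))) $ d $ j $ j)) \<longlonglongrightarrow> 0"
    and \<Psi>: "\<And>c i d j. (\<lambda>k. Re (((kraus_op \<kappa> \<Psi> \<Psi> ^^ k) (dyad c (axis i 1) (axis i 1))) $ d $ j $ j)) \<longlonglongrightarrow> 0"
  shows "stable_map (kraus_op \<kappa> \<Phi> \<Psi>)"
proof -
  let ?T = "kraus_op \<kappa> \<Phi> \<Psi>"
  note lin = linear_funpow[OF linear_kraus_op]
  have dyad: "(\<lambda>k. (?T ^^ k) (dyad c (axis i z) (axis j 1))) \<longlonglongrightarrow> 0" for c i j z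
  proof (intro vec_tendstoI)
    fix d p q
    let ?b = "\<lambda>k. (cmod z)\<^sup>2 * Re (((kraus_op \<kappa> \<Phi> \<Phi> ^^ k) (dyad c (axis i 1) (axis i 1))) $ d $ p $ p)
      + Re (((kraus_op \<kappa> \<Psi> \<Psi> ^^ k) (dyad c (axis j 1) (axis j 1))) $ d $ q $ q)"
    have "?b \<longlonglongrightarrow> (cmod z)\<^sup>2 * 0 + 0" by (intro tendsto_intros \<Phi> \<Psi>)
    then have b: "?b \<longlonglongrightarrow> 0" by simp
    have "2 * norm (((?T ^^ k) (dyad c (axis i z) (axis j 1))) $ d $ p $ q) \<le> ?b k" for k
      using kraus_op_cross_bound[OF \<kappa>, where a = "axis p 1" and b = "axis q 1" and k = k and \<Phi> = \<Phi> and \<Psi> = \<Psi> and c = c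
          and u = "axis i z" and v = "axis j 1" and d = d]
      unfolding cdot_axis dyad_axis[of c i z] linear_scale[OF lin] by simp
    then have "norm (((?T ^^ k) (dyad c (axis i z) (axis j 1))) $ d $ p $ q) \<le> ?b k" for k
      by (rule order_trans[rotated]) simp
    then show "(\<lambda>k. ((?T ^^ k) (dyad c (axis i z) (axis j 1))) $ d $ p $ q) \<longlonglongrightarrow> 0 $ d $ p $ q"
      by (simp add: Lim_null_comparison[OF _ b])
  qed
  have "(\<lambda>k. (?T ^^ k) Y) \<longlonglongrightarrow> 0" for Y
  proof -
    have "(\<lambda>k. \<Sum>c\<in>UNIV. \<Sum>i\<in>UNIV. \<Sum>j\<in>UNIV. (?T ^^ k) (dyad c (axis i (Y $ c $ i $ j)) (axis j 1)))
      \<longlonglongrightarrow> (\<Sum>c\<in>(UNIV::'c set). \<Sum>i\<in>(UNIV::'n set). \<Sum>j\<in>(UNIV::'p set). 0)"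
      by (intro tendsto_sum dyad)
    moreover have "(?T ^^ k) Y = (\<Sum>c\<in>UNIV. \<Sum>i\<in>UNIV. \<Sum>j\<in>UNIV.
        (?T ^^ k) (dyad c (axis i (Y $ c $ i $ j)) (axis j 1)))" for k
      by (subst dyad_decomposition[of Y]) (simp only: linear_sum[OF lin])
    ultimately show ?thesis by simp
  qed
  then show ?thesis by (simp add: stable_map_def)
qed

lemma stable_map_entry:
  "stable_map T \<Longrightarrow> (\<lambda>k. Re (((T ^^ k) Y) $ d $ i $ j)) \<longlonglongrightarrow> 0"
  for T :: "complex^'p^'n^'d \<Rightarrow> complex^'p^'n^'d"
proof -
  assume "stable_map T"
  then have "(\<lambda>k. (T ^^ k) Y) \<longlonglongrightarrow> 0" by (simp add: stable_map_def)
  then have "(\<lambda>k. Re (((T ^^ k) Y) $ d $ i $ j)) \<longlonglongrightarrow> Re (0 $ d $ i $ j)"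
    by (intro tendsto_Re tendsto_vec_nth)
  then show ?thesis by simp
qed

lemma stable_kraus_op_cross:
  fixes \<Phi> :: "'c::finite \<Rightarrow> 'c \<Rightarrow> 'e::finite \<Rightarrow> complex^'n^'n" and \<Psi> :: "'c \<Rightarrow> 'c \<Rightarrow> 'e \<Rightarrow> complex^'p^'p"
  assumes "\<And>c d e. 0 \<le> \<kappa> c d e"
    and "stable_map (kraus_op \<kappa> \<Phi> \<Phi>)" "stable_map (kraus_op \<kappa> \<Psi> \<Psi>)"
  shows "stable_map (kraus_op \<kappa> \<Phi> \<Psi>)"
  by (rule stable_kraus_opI[OF assms(1) stable_map_entry[OF assms(2)] stable_map_entry[OF assms(3)]])

section \<open>Blocks of matrix tuples and block triangular operators\<close>

definition sub :: "('a \<Rightarrow> 'm) \<Rightarrow> ('b \<Rightarrow> 'n) \<Rightarrow> complex^'n^'m \<Rightarrow> complex^'b^'a" where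
  "sub f g M = (\<chi> i j. M $ f i $ g j)"

lemma linear_sub: "linear (sub f g)"
  by (rule linearI) (simp_all add: sub_def vec_eq_iff)

lemma sub_adj: "sub f g (adj M) = adj (sub g f M)"
  by (simp add: sub_def adj_def vec_eq_iff)

lemma sub_mult:
  "sub f g (M ** N) = sub f Inl M ** sub Inl g N + sub f Inr M ** sub Inr g N"
  by (simp add: sub_def vec_eq_iff matrix_matrix_mult_def UNIV_Plus_UNIV[symmetric] sum.Plus
      del: UNIV_Plus_UNIV)

definition subs :: "('a \<Rightarrow> 'm) \<Rightarrow> ('b \<Rightarrow> 'n) \<Rightarrow> complex^'n^'m^'c \<Rightarrow> complex^'b^'a^'c" where
  "subs f g Z = (\<chi> c. sub f g (Z $ c))"

lemma subs_nth: "subs f g Z $ c $ i $ j = Z $ c $ f i $ g j"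
  by (simp add: subs_def sub_def)

lemma sub_sandwich:
  "sub f g (M ** Z ** adj W) =
     sub f Inl M ** sub Inl Inl Z ** adj (sub g Inl W) + sub f Inl M ** sub Inl Inr Z ** adj (sub g Inr W) +
     sub f Inr M ** sub Inr Inl Z ** adj (sub g Inl W) + sub f Inr M ** sub Inr Inr Z ** adj (sub g Inr W)"
  by (simp only: sub_mult sub_adj matrix_mult_add_rdistrib add_ac)

text \<open>With \<open>Inl\<close> and \<open>Inr\<close> for \<open>f\<close> and \<open>g\<close>
  this is block multiplication: each block of the image is a sum of four operators of the same form,
  generally with different families on the two sides.\<close>

lemma subs_kraus_op:
  "subs f g (kraus_op \<kappa> \<Phi> \<Psi> Z) =
     kraus_op \<kappa> (\<lambda>c d e. sub f Inl (\<Phi> c d e)) (\<lambda>c d e. sub g Inl (\<Psi> c d e)) (subs Inl Inl Z) +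
     kraus_op \<kappa> (\<lambda>c d e. sub f Inl (\<Phi> c d e)) (\<lambda>c d e. sub g Inr (\<Psi> c d e)) (subs Inl Inr Z) +
     kraus_op \<kappa> (\<lambda>c d e. sub f Inr (\<Phi> c d e)) (\<lambda>c d e. sub g Inl (\<Psi> c d e)) (subs Inr Inl Z) +
     kraus_op \<kappa> (\<lambda>c d e. sub f Inr (\<Phi> c d e)) (\<lambda>c d e. sub g Inr (\<Psi> c d e)) (subs Inr Inr Z)"
  unfolding vec_eq_iff[of "subs _ _ _"]
proof
  fix d
  show "subs f g (kraus_op \<kappa> \<Phi> \<Psi> Z) $ d = (
     kraus_op \<kappa> (\<lambda>c d e. sub f Inl (\<Phi> c d e)) (\<lambda>c d e. sub g Inl (\<Psi> c d e)) (subs Inl Inl Z) +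
     kraus_op \<kappa> (\<lambda>c d e. sub f Inl (\<Phi> c d e)) (\<lambda>c d e. sub g Inr (\<Psi> c d e)) (subs Inl Inr Z) +
     kraus_op \<kappa> (\<lambda>c d e. sub f Inr (\<Phi> c d e)) (\<lambda>c d e. sub g Inl (\<Psi> c d e)) (subs Inr Inl Z) +
     kraus_op \<kappa> (\<lambda>c d e. sub f Inr (\<Phi> c d e)) (\<lambda>c d e. sub g Inr (\<Psi> c d e)) (subs Inr Inr Z)) $ d"
    by (simp only: subs_def kraus_op_def vec_lambda_beta vector_add_component
        linear_sum[OF linear_sub] linear_scale[OF linear_sub] sub_sandwich scaleR_add_right sum.distrib)
qed

lemma kraus_op_zero:
  "kraus_op \<kappa> (\<lambda>c d e. 0) \<Psi> Y = 0" "kraus_op \<kappa> \<Phi> (\<lambda>c d e. 0) Y = 0" "kraus_op \<kappa> \<Phi> \<Psi> 0 = 0"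
proof -
  have "adj 0 = (0 :: complex^'a^'b)" by (simp add: adj_def vec_eq_iff)
  then show "kraus_op \<kappa> (\<lambda>c d e. 0) \<Psi> Y = 0" "kraus_op \<kappa> \<Phi> (\<lambda>c d e. 0) Y = 0" "kraus_op \<kappa> \<Phi> \<Psi> 0 = 0"
    by (simp_all add: kraus_op_def vec_eq_iff matrix_matrix_mult_def adj_def)
qed

lemma sub_block_mat:
  "sub Inl Inl (block_mat A B C D) = A" "sub Inl Inr (block_mat A B C D) = B"
  "sub Inr Inl (block_mat A B C D) = C" "sub Inr Inr (block_mat A B C D) = D"
  by (simp_all add: sub_def block_mat_def vec_eq_iff)

lemma subs_eqI:
  fixes Y Z :: "complex^('p1::finite + 'p2::finite)^('n1::finite + 'n2::finite)^'c"
  assumes "subs Inl Inl Y = subs Inl Inl Z" "subs Inl Inr Y = subs Inl Inr Z"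
    "subs Inr Inl Y = subs Inr Inl Z" "subs Inr Inr Y = subs Inr Inr Z"
  shows "Y = Z"
  unfolding vec_eq_iff
proof (intro allI)
  fix c i j
  show "Y $ c $ i $ j = Z $ c $ i $ j"
    using assms by (cases i; cases j) (auto simp: subs_def sub_def vec_eq_iff)
qed

lemma subs_zero: "subs f g 0 = 0"
  by (simp add: subs_def sub_def vec_eq_iff)

lemma tendsto_subs: "x \<longlonglongrightarrow> z \<Longrightarrow> (\<lambda>k. subs f g (x k)) \<longlonglongrightarrow> subs f g z"
  by (intro vec_tendstoI) (simp only: subs_nth, intro tendsto_vec_nth)

lemma tendsto_subs_iff:
  fixes x :: "nat \<Rightarrow> complex^('p1::finite + 'p2::finite)^('n1::finite + 'n2::finite)^'c"
  shows "x \<longlonglongrightarrow> 0 \<longleftrightarrow>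
    (\<lambda>k. subs Inl Inl (x k)) \<longlonglongrightarrow> 0 \<and> (\<lambda>k. subs Inl Inr (x k)) \<longlonglongrightarrow> 0 \<and>
    (\<lambda>k. subs Inr Inl (x k)) \<longlonglongrightarrow> 0 \<and> (\<lambda>k. subs Inr Inr (x k)) \<longlonglongrightarrow> 0" (is "_ \<longleftrightarrow> ?r")
proof
  show "x \<longlonglongrightarrow> 0 \<Longrightarrow> ?r"
    by (intro conjI tendsto_subs[of x 0, unfolded subs_zero])
next
  assume r: ?r
  have nth: "(\<lambda>k. subs f g (x k) $ c $ i $ j) \<longlonglongrightarrow> 0"
    if "(\<lambda>k. subs f g (x k)) \<longlonglongrightarrow> 0" for f :: "'a::finite \<Rightarrow> _" and g :: "'b::finite \<Rightarrow> _" and c i j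
    using tendsto_vec_nth[OF tendsto_vec_nth[OF tendsto_vec_nth[OF that]]] by simp
  have "(\<lambda>k. x k $ c $ i $ j) \<longlonglongrightarrow> 0" for c i j
    using r by (cases i; cases j) (auto dest!: nth simp: subs_nth)
  then show "x \<longlonglongrightarrow> 0" by (intro vec_tendstoI) simp
qed

lemma tendsto_kraus_op_0:
  "Y \<longlonglongrightarrow> 0 \<Longrightarrow> (\<lambda>k. kraus_op \<kappa> \<Phi> \<Psi> (Y k)) \<longlonglongrightarrow> 0"
  for Y :: "nat \<Rightarrow> complex^'p^'n^'c"
proof -
  assume Y: "Y \<longlonglongrightarrow> 0"
  have "bounded_linear (kraus_op \<kappa> \<Phi> \<Psi>)"
    by (rule linear_conv_bounded_linear[THEN iffD1, OF linear_kraus_op])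
  then show ?thesis using Y by (rule bounded_linear.tendsto_zero)
qed

text \<open>The blocks form a cascade: the lower right one is autonomous, it drives the two mixed
  ones, and all three drive the upper left one. Stability is passed down the cascade as vanishing
  forcing.\<close>

lemma stable_kraus_op_block_triangular:
  fixes \<Phi> :: "'c::finite \<Rightarrow> 'c \<Rightarrow> 'e::finite \<Rightarrow> complex^'n^'n" and \<Psi> :: "'c \<Rightarrow> 'c \<Rightarrow> 'e \<Rightarrow> complex^'p^'p"
    and \<kappa> R
  defines "\<Xi> \<equiv> \<lambda>c d e. block_mat (\<Phi> c d e) (R c d e) 0 (\<Psi> c d e)"
  assumes \<kappa>: "\<And>c d e. 0 \<le> \<kappa> c d e"
  shows "stable_map (kraus_op \<kappa> \<Xi> \<Xi>) \<longleftrightarrow>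
    stable_map (kraus_op \<kappa> \<Phi> \<Phi>) \<and> stable_map (kraus_op \<kappa> \<Psi> \<Psi>)"
proof
  let ?T = "kraus_op \<kappa> \<Xi> \<Xi>"
  have subs_T: "subs Inr Inr (?T Z) = kraus_op \<kappa> \<Psi> \<Psi> (subs Inr Inr Z)"
    "subs Inl Inr (?T Z) = kraus_op \<kappa> \<Phi> \<Psi> (subs Inl Inr Z) + kraus_op \<kappa> R \<Psi> (subs Inr Inr Z)"
    "subs Inr Inl (?T Z) = kraus_op \<kappa> \<Psi> \<Phi> (subs Inr Inl Z) + kraus_op \<kappa> \<Psi> R (subs Inr Inr Z)"
    "subs Inl Inl (?T Z) = kraus_op \<kappa> \<Phi> \<Phi> (subs Inl Inl Z) + (kraus_op \<kappa> \<Phi> R (subs Inl Inr Z) +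
      kraus_op \<kappa> R \<Phi> (subs Inr Inl Z) + kraus_op \<kappa> R R (subs Inr Inr Z))" for Z
    by (simp_all add: subs_kraus_op \<Xi>_def sub_block_mat kraus_op_zero)
  {
    assume T: "stable_map ?T"
    have "(\<lambda>k. (kraus_op \<kappa> \<Psi> \<Psi> ^^ k) E) \<longlonglongrightarrow> 0" for E
    proof -
      define Z where "Z = (\<chi> c. block_mat (0 :: complex^'n^'n) (0 :: complex^'p^'n) 0 (E $ c))"
      have "subs Inr Inr ((?T ^^ k) Z) = (kraus_op \<kappa> \<Psi> \<Psi> ^^ k) E" for k
      proof (induction k)
        case 0
        show ?case by (simp add: Z_def subs_def sub_block_mat)
      qed (simp add: subs_T)
      moreover have "(\<lambda>k. subs Inr Inr ((?T ^^ k) Z)) \<longlonglongrightarrow> 0"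
        using T unfolding stable_map_def tendsto_subs_iff by blast
      ultimately show ?thesis by simp
    qed
    moreover have "(\<lambda>k. (kraus_op \<kappa> \<Phi> \<Phi> ^^ k) X) \<longlonglongrightarrow> 0" for X
    proof -
      \<comment> \<open>Tuples supported on the upper left block form an invariant subspace, because
        the lower left block of \<open>\<Xi>\<close> is 0.\<close>
      define J where "J = (\<lambda>X :: complex^'n^'n^'c. \<chi> c. block_mat (X $ c) (0 :: complex^'p^'n) 0 (0 :: complex^'p^'p))"
      have J: "subs Inl Inl (J X) = X" "subs Inl Inr (J X) = 0" "subs Inr Inl (J X) = 0"
        "subs Inr Inr (J X) = 0" for X :: "complex^'n^'n^'c"
        by (simp_all add: J_def subs_def sub_block_mat vec_eq_iff)
      have "?T (J X) = J (kraus_op \<kappa> \<Phi> \<Phi> X)" for X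
        by (rule subs_eqI) (simp_all add: subs_T J kraus_op_zero)
      then have "(?T ^^ k) (J X) = J ((kraus_op \<kappa> \<Phi> \<Phi> ^^ k) X)" for k
        by (induction k) auto
      then have "(kraus_op \<kappa> \<Phi> \<Phi> ^^ k) X = subs Inl Inl ((?T ^^ k) (J X))" for k
        by (simp add: J)
      moreover have "(\<lambda>k. subs Inl Inl ((?T ^^ k) (J X))) \<longlonglongrightarrow> 0"
        using T unfolding stable_map_def tendsto_subs_iff by blast
      ultimately show ?thesis by simp
    qed
    ultimately show "stable_map (kraus_op \<kappa> \<Phi> \<Phi>) \<and> stable_map (kraus_op \<kappa> \<Psi> \<Psi>)"
      by (simp add: stable_map_def)
  next
    assume "stable_map (kraus_op \<kappa> \<Phi> \<Phi>) \<and> stable_map (kraus_op \<kappa> \<Psi> \<Psi>)"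
    then have \<Phi>: "stable_map (kraus_op \<kappa> \<Phi> \<Phi>)" and \<Psi>: "stable_map (kraus_op \<kappa> \<Psi> \<Psi>)" by auto
    show "stable_map ?T"
      unfolding stable_map_def
    proof
      fix Z
      let ?Z = "\<lambda>k. (?T ^^ k) Z"
      have E: "(\<lambda>k. subs Inr Inr (?Z k)) \<longlonglongrightarrow> 0"
        by (rule stable_affine_tendsto_0[OF linear_kraus_op \<Psi>, of "\<lambda>_. 0"]) (simp_all add: subs_T)
      have Y: "(\<lambda>k. subs Inl Inr (?Z k)) \<longlonglongrightarrow> 0"
        by (rule stable_affine_tendsto_0[OF linear_kraus_op stable_kraus_op_cross[OF \<kappa> \<Phi> \<Psi>]
              tendsto_kraus_op_0[OF E]]) (simp_all add: subs_T)
      have Y': "(\<lambda>k. subs Inr Inl (?Z k)) \<longlonglongrightarrow> 0"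
        by (rule stable_affine_tendsto_0[OF linear_kraus_op stable_kraus_op_cross[OF \<kappa> \<Psi> \<Phi>]
              tendsto_kraus_op_0[OF E]]) (simp_all add: subs_T)
      have "(\<lambda>k. subs Inl Inl (?Z k)) \<longlonglongrightarrow> 0"
      proof (rule stable_affine_tendsto_0[OF linear_kraus_op \<Phi>])
        show "(\<lambda>k. kraus_op \<kappa> \<Phi> R (subs Inl Inr (?Z k)) + kraus_op \<kappa> R \<Phi> (subs Inr Inl (?Z k)) +
            kraus_op \<kappa> R R (subs Inr Inr (?Z k))) \<longlonglongrightarrow> 0"
          by (intro tendsto_add_zero tendsto_kraus_op_0[OF E] tendsto_kraus_op_0[OF Y]
              tendsto_kraus_op_0[OF Y'])
      qed (simp add: subs_T)
      with E Y Y' show "?Z \<longlonglongrightarrow> 0" unfolding tendsto_subs_iff by blast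
    qed
  }
qed

section \<open>Summing out the actuation channel\<close>

lemma sum_prod_UNIV: "(\<Sum>z\<in>UNIV. f z) = (\<Sum>x\<in>UNIV. \<Sum>y\<in>UNIV. f (x, y))"
  for f :: "'a::finite \<times> 'b::finite \<Rightarrow> 'c::comm_monoid_add"
  by (simp add: UNIV_Times_UNIV[symmetric] sum.cartesian_product del: UNIV_Times_UNIV)

text \<open>The sum \<open>S\<close> over the first mode intertwines the two operators and is onto,
  which gives one direction. It is not injective in general, so the other direction uses positivity:
  from a unit dyad, each diagonal entry lies between 0 and the corresponding entry of the
  sum.\<close>

lemma stable_kraus_op_marginal:
  fixes p :: "'m::finite \<Rightarrow> 'm \<Rightarrow> 'b::finite \<Rightarrow> real"
    and q :: "'s::finite \<Rightarrow> 's \<Rightarrow> 'e::finite \<Rightarrow> real"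
    and \<Phi> :: "'s \<Rightarrow> 's \<Rightarrow> 'e \<Rightarrow> complex^'n^'n"
  defines "\<kappa> \<equiv> \<lambda>c d e. p (fst c) (fst d) (fst e) * q (snd c) (snd d) (snd e)"
    and "\<Xi> \<equiv> \<lambda>c d e. \<Phi> (snd c) (snd d) (snd e)"
  assumes p: "\<And>l i b. 0 \<le> p l i b" "\<And>l. (\<Sum>i\<in>UNIV. \<Sum>b\<in>UNIV. p l i b) = 1"
    and q: "\<And>n m g. 0 \<le> q n m g"
  shows "stable_map (kraus_op \<kappa> \<Xi> \<Xi>) \<longleftrightarrow> stable_map (kraus_op q \<Phi> \<Phi>)"
proof
  let ?T = "kraus_op \<kappa> \<Xi> \<Xi>" and ?V = "kraus_op q \<Phi> \<Phi>"
  define S where "S = (\<lambda>Z :: complex^'n^'n^('m \<times> 's). \<chi> n. \<Sum>l\<in>UNIV. Z $ (l, n))"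
  have S_T: "S (?T Z) = ?V (S Z)" for Z
    unfolding vec_eq_iff[of "S _"]
  proof
    fix m
    let ?X = "\<lambda>n g Y. \<Phi> n m g ** Y ** adj (\<Phi> n m g)"
    let ?W = "\<lambda>l. \<Sum>n\<in>UNIV. \<Sum>g\<in>UNIV. q n m g *\<^sub>R ?X n g (Z $ (l, n))"
    have "S (?T Z) $ m = (\<Sum>i\<in>UNIV. \<Sum>l\<in>UNIV. \<Sum>n\<in>UNIV. \<Sum>b\<in>UNIV. \<Sum>g\<in>UNIV.
        p l i b *\<^sub>R q n m g *\<^sub>R ?X n g (Z $ (l, n)))"
      by (simp add: S_def kraus_op_def \<kappa>_def \<Xi>_def sum_prod_UNIV)
    also have "\<dots> = (\<Sum>i\<in>UNIV. \<Sum>l\<in>UNIV. \<Sum>b\<in>UNIV. p l i b *\<^sub>R ?W l)"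
      by (intro sum.cong refl, subst sum.swap) (simp only: scaleR_sum_right)
    also have "\<dots> = (\<Sum>l\<in>UNIV. (\<Sum>i\<in>UNIV. \<Sum>b\<in>UNIV. p l i b) *\<^sub>R ?W l)"
      by (subst sum.swap) (simp only: scaleR_sum_left)
    also have "\<dots> = (\<Sum>n\<in>UNIV. \<Sum>l\<in>UNIV. \<Sum>g\<in>UNIV. q n m g *\<^sub>R ?X n g (Z $ (l, n)))"
      unfolding p(2) scaleR_one by (rule sum.swap)
    also have "\<dots> = (\<Sum>n\<in>UNIV. \<Sum>g\<in>UNIV. \<Sum>l\<in>UNIV. q n m g *\<^sub>R ?X n g (Z $ (l, n)))"
      by (intro sum.cong refl, rule sum.swap)
    also have "\<dots> = ?V (S Z) $ m"
      by (simp add: kraus_op_def S_def linear_sum[OF linear_sandwich] scaleR_sum_right)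
    finally show "S (?T Z) $ m = ?V (S Z) $ m" .
  qed
  have S_funpow: "S ((?T ^^ k) Z) = (?V ^^ k) (S Z)" for k Z
    by (induction k) (auto simp: S_T)
  {
    assume T: "stable_map ?T"
    show "stable_map ?V"
      unfolding stable_map_def
    proof
      fix Y :: "complex^'n^'n^'s"
      obtain l :: 'm where True by simp
      \<comment> \<open>A preimage of \<open>Y\<close> under \<open>S\<close>: the whole mass sits
        at one arbitrary actuation mode.\<close>
      define Z :: "complex^'n^'n^('m \<times> 's)" where "Z = (\<chi> c. if fst c = l then Y $ snd c else 0)"
      have SZ: "S Z = Y" by (simp add: S_def Z_def vec_eq_iff[of "\<chi> n. _ n"])
      have "(\<lambda>k. (?T ^^ k) Z) \<longlonglongrightarrow> 0" using T by (simp add: stable_map_def)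
      then have "(\<lambda>k. S ((?T ^^ k) Z)) \<longlonglongrightarrow> 0"
        unfolding S_def
        by (intro vec_tendstoI)
          (simp, intro tendsto_null_sum, drule tendsto_vec_nth, drule tendsto_vec_nth, drule tendsto_vec_nth, simp)
      then show "(\<lambda>k. (?V ^^ k) Y) \<longlonglongrightarrow> 0" unfolding S_funpow SZ .
    qed
  next
    assume V: "stable_map ?V"
    have \<kappa>: "0 \<le> \<kappa> c d e" for c d e by (simp add: \<kappa>_def p q)
    have "(\<lambda>k. Re (((?T ^^ k) (dyad c (axis i 1) (axis i 1))) $ d $ j $ j)) \<longlonglongrightarrow> 0" for c i d j
    proof -
      obtain l n where d: "d = (l, n)" by (cases d)
      let ?Z = "\<lambda>k. (?T ^^ k) (dyad c (axis i 1) (axis i 1))"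
      have lower: "0 \<le> Re (?Z k $ d $ j $ j)" for k by (rule kraus_op_diag_nonneg[OF \<kappa>])
      have upper: "Re (?Z k $ d $ j $ j) \<le> Re (S (?Z k) $ n $ j $ j)" for k
      proof -
        have "Re (?Z k $ d $ j $ j) \<le> (\<Sum>l\<in>UNIV. Re (?Z k $ (l, n) $ j $ j))"
          unfolding d by (rule member_le_sum) (auto intro: kraus_op_diag_nonneg[OF \<kappa>])
        then show ?thesis by (simp add: S_def)
      qed
      have lim: "(\<lambda>k. Re (S (?Z k) $ n $ j $ j)) \<longlonglongrightarrow> 0"
        unfolding S_funpow by (rule stable_map_entry[OF V])
      show ?thesis
        by (rule tendsto_sandwich[OF always_eventually[OF allI[OF lower]]
              always_eventually[OF allI[OF upper]] tendsto_const lim])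
    qed
    then show "stable_map ?T" by (intro stable_kraus_opI[OF \<kappa>])
  }
qed

section \<open>The detectability operator\<close>

lemma detect_V_eq_kraus_op:
  "detect_V A L Q \<gamma>h M = kraus_op (\<lambda>n m g. Q $ n $ m * bernoulli_prob (\<gamma>h m) g)
     (\<lambda>n m g. A + of_bool g *\<^sub>R (M m ** L)) (\<lambda>n m g. A + of_bool g *\<^sub>R (M m ** L))"
proof (rule ext)
  fix S
  show "detect_V A L Q \<gamma>h M S = kraus_op (\<lambda>n m g. Q $ n $ m * bernoulli_prob (\<gamma>h m) g)
     (\<lambda>n m g. A + of_bool g *\<^sub>R (M m ** L)) (\<lambda>n m g. A + of_bool g *\<^sub>R (M m ** L)) S"
    unfolding vec_eq_iff[of "detect_V A L Q \<gamma>h M S"]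
    by (simp add: detect_V_def kraus_op_def detect_D_def UNIV_bool bernoulli_prob_def
        linear_sum[OF linear_sandwich] linear_scale[OF linear_sandwich] scaleR_sum_right
        sum.distrib mult.commute add.commute)
qed

lemma norm_vec_scale:
  fixes v w :: "'b::real_normed_vector^'n"
  assumes "\<And>i. norm (w $ i) = r * norm (v $ i)" "0 \<le> r"
  shows "norm w = r * norm v"
  using assms
  by (simp add: norm_vec_def L2_set_def power_mult_distrib sum_distrib_left[symmetric] real_sqrt_mult)

lemma stable_detect_V_iff:
  fixes A :: "complex^'x^'x" and Q :: "real^'s^'s"
  shows "stable_map (detect_V A L Q \<gamma>h M) \<longleftrightarrow> spec_radius (detect_V A L Q \<gamma>h M) < 1"
proof -
  define sc :: "complex \<Rightarrow> complex^'x^'x^'s \<Rightarrow> complex^'x^'x^'s" where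
    "sc = (\<lambda>\<mu> S. \<chi> n i j. \<mu> * S $ n $ i $ j)"
  \<comment> \<open>The norm of a tuple is nested in three layers, so complex homogeneity is lifted
    one layer at a time.\<close>
  have n1: "norm (\<chi> i. \<mu> * v $ i) = cmod \<mu> * norm v" for \<mu> and v :: "complex^'x"
    by (rule norm_vec_scale) (simp_all add: norm_mult)
  have n2: "norm (\<chi> i j. \<mu> * v $ i $ j) = cmod \<mu> * norm v" for \<mu> and v :: "complex^'x^'x"
    by (rule norm_vec_scale) (simp_all add: n1)
  have n3: "norm (sc \<mu> S) = cmod \<mu> * norm S" for \<mu> S
    unfolding sc_def by (rule norm_vec_scale) (simp_all add: n2)
  interpret complex_linear_map sc "detect_V A L Q \<gamma>h M"
  proof
    show "detect_V A L Q \<gamma>h M (x + y) = detect_V A L Q \<gamma>h M x + detect_V A L Q \<gamma>h M y" for x y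
      unfolding detect_V_eq_kraus_op by (rule linear_add[OF linear_kraus_op])
    show "detect_V A L Q \<gamma>h M (sc a x) = sc a (detect_V A L Q \<gamma>h M x)" for a x
      by (simp add: detect_V_eq_kraus_op kraus_op_def sc_def vec_eq_iff matrix_matrix_mult_def
          sum_distrib_left sum_distrib_right sum_component scaleR_sum_right mult_ac)
  qed (simp_all add: n3, simp_all add: sc_def vec_eq_iff algebra_simps
      scaleR_conv_of_real[where 'a = complex])
  have "eigenvalue_set (detect_V A L Q \<gamma>h M) = eigenvalues"
    unfolding eigenvalue_set_def eigenvalues_def by (simp add: sc_def)
  then show ?thesis unfolding spec_radius_def stable_map_iff_Max by simp
qed

section \<open>Second moments along channel histories\<close>

text \<open>
  A channel history is a list of entries \<open>((\<theta>\<^sub>j, \<eta>\<^sub>j), (\<nu>\<^sub>j, \<gamma>\<^sub>j))\<close>, the most recent one first; \<open>l\<close> stands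
  for the initial mode \<open>\<theta>\<^sub>-\<^sub>1\<close>.
\<close>

type_synonym ('m, 's) history = "(('m \<times> 's) \<times> (bool \<times> bool)) list"

text \<open>The joint transition probability of both channels: from the modes \<open>c\<close> to
  the modes \<open>d\<close>, with packet indicators \<open>e\<close> drawn at the new
  modes.\<close>

definition chan_weight ::
  "real^'m^'m \<Rightarrow> ('m \<Rightarrow> real) \<Rightarrow> real^'s^'s \<Rightarrow> ('s \<Rightarrow> real) \<Rightarrow> 'm \<times> 's \<Rightarrow> 'm \<times> 's \<Rightarrow> bool \<times> bool \<Rightarrow> real" where
  "chan_weight P \<nu>h Q \<gamma>h c d e = P $ fst c $ fst d * bernoulli_prob (\<nu>h (fst d)) (fst e) *
     (Q $ snd c $ snd d * bernoulli_prob (\<gamma>h (snd d)) (snd e))"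

text \<open>The observation delay appears here: the actuation mode is taken before the transition,
  the sensing mode and both indicators after it.\<close>

definition jump_mat :: "('m \<Rightarrow> bool \<Rightarrow> 's \<Rightarrow> bool \<Rightarrow> 'a) \<Rightarrow> 'm \<times> 's \<Rightarrow> 'm \<times> 's \<Rightarrow> bool \<times> bool \<Rightarrow> 'a" where
  "jump_mat \<Phi> c d e = \<Phi> (fst c) (fst e) (snd d) (snd e)"

definition jump_op ::
  "real^'m^'m \<Rightarrow> ('m \<Rightarrow> real) \<Rightarrow> real^'s^'s \<Rightarrow> ('s \<Rightarrow> real) \<Rightarrow>
   ('m \<Rightarrow> bool \<Rightarrow> 's \<Rightarrow> bool \<Rightarrow> complex^'n^'n) \<Rightarrow>
   complex^'n^'n^('m \<times> 's) \<Rightarrow> complex^'n^'n^('m \<times> 's)" where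
  "jump_op P \<nu>h Q \<gamma>h \<Phi> = kraus_op (chan_weight P \<nu>h Q \<gamma>h) (jump_mat \<Phi>) (jump_mat \<Phi>)"

definition prev_mode :: "'m \<Rightarrow> ('m, 's) history \<Rightarrow> 'm" where
  "prev_mode l cs = (case cs of [] \<Rightarrow> l | c # _ \<Rightarrow> fst (fst c))"

definition step_mat :: "('m \<Rightarrow> bool \<Rightarrow> 's \<Rightarrow> bool \<Rightarrow> 'a) \<Rightarrow> 'm \<Rightarrow> ('m \<times> 's) \<times> (bool \<times> bool) \<Rightarrow> 'a" where
  "step_mat \<Phi> l c = \<Phi> l (fst (snd c)) (snd (fst c)) (snd (snd c))"

definition noise_mat :: "('s \<Rightarrow> bool \<Rightarrow> 'a) \<Rightarrow> ('m \<times> 's) \<times> (bool \<times> bool) \<Rightarrow> 'a" where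
  "noise_mat \<Gamma> c = \<Gamma> (snd (fst c)) (snd (snd c))"

text \<open>The second moment of the state along a frozen channel history, \<open>X\<close> being
  that of the initial state; cross terms between state and noise are absent because they are
  uncorrelated.\<close>

primrec path_moment ::
  "('m \<Rightarrow> bool \<Rightarrow> 's \<Rightarrow> bool \<Rightarrow> complex^'n^'n) \<Rightarrow> ('s \<Rightarrow> bool \<Rightarrow> complex^'w^'n) \<Rightarrow> complex^'n^'n \<Rightarrow>
   'm \<Rightarrow> ('m, 's) history \<Rightarrow> complex^'n^'n" where
  "path_moment \<Phi> \<Gamma> X l [] = X"
| "path_moment \<Phi> \<Gamma> X l (c # cs) =
     step_mat \<Phi> (prev_mode l cs) c ** path_moment \<Phi> \<Gamma> X l cs ** adj (step_mat \<Phi> (prev_mode l cs) c)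
     + noise_mat \<Gamma> c ** adj (noise_mat \<Gamma> c)"

text \<open>Only extensions of nonempty histories are constrained, so the joint law of the initial
  mode \<open>l\<close> and the first entry stays free.\<close>

definition path_law ::
  "real^'m^'m \<Rightarrow> ('m \<Rightarrow> real) \<Rightarrow> real^'s^'s \<Rightarrow> ('s \<Rightarrow> real) \<Rightarrow> ('m \<Rightarrow> ('m, 's) history \<Rightarrow> real) \<Rightarrow> bool" where
  "path_law P \<nu>h Q \<gamma>h q \<longleftrightarrow>
     (\<forall>l c' c cs. q l (c' # c # cs) = q l (c # cs) * chan_weight P \<nu>h Q \<gamma>h (fst c) (fst c') (snd c'))"

text \<open>Index \<open>k\<close> counts the entries before the most recent one, so this is the
  second moment after \<open>Suc k\<close> steps, split by the modes at time \<open>k\<close>.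
  Histories start at length one because the transition law governs only the entries after the
  first.\<close>

definition moment ::
  "('m::finite \<Rightarrow> bool \<Rightarrow> 's::finite \<Rightarrow> bool \<Rightarrow> complex^'n^'n) \<Rightarrow> ('s \<Rightarrow> bool \<Rightarrow> complex^'w^'n) \<Rightarrow>
   ('m \<Rightarrow> ('m, 's) history \<Rightarrow> real) \<Rightarrow> complex^'n^'n \<Rightarrow> nat \<Rightarrow> complex^'n^'n^('m \<times> 's)" where
  "moment \<Phi> \<Gamma> q X k = (\<chi> c. \<Sum>l\<in>UNIV. \<Sum>e\<in>UNIV. \<Sum>cs | length cs = k.
     q l ((c, e) # cs) *\<^sub>R path_moment \<Phi> \<Gamma> X l ((c, e) # cs))"

definition mode_prob :: "('m::finite \<Rightarrow> ('m, 's::finite) history \<Rightarrow> real) \<Rightarrow> nat \<Rightarrow> 'm \<times> 's \<Rightarrow> real" where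
  "mode_prob q k c = (\<Sum>l\<in>UNIV. \<Sum>e\<in>UNIV. \<Sum>cs | length cs = k. q l ((c, e) # cs))"

definition noise_moment ::
  "real^'m^'m \<Rightarrow> ('m \<Rightarrow> real) \<Rightarrow> real^'s^'s \<Rightarrow> ('s \<Rightarrow> real) \<Rightarrow> ('s \<Rightarrow> bool \<Rightarrow> complex^'w^'n) \<Rightarrow>
   ('m \<times> 's \<Rightarrow> real) \<Rightarrow> complex^'n^'n^('m \<times> 's)" where
  "noise_moment P \<nu>h Q \<gamma>h \<Gamma> \<mu> = (\<chi> d. \<Sum>c\<in>UNIV. \<Sum>e\<in>UNIV.
     (chan_weight P \<nu>h Q \<gamma>h c d e * \<mu> c) *\<^sub>R (\<Gamma> (snd d) (snd e) ** adj (\<Gamma> (snd d) (snd e))))"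

lemma path_lawD:
  "path_law P \<nu>h Q \<gamma>h q \<Longrightarrow>
    q l (c' # c # cs) = q l (c # cs) * chan_weight P \<nu>h Q \<gamma>h (fst c) (fst c') (snd c')"
  unfolding path_law_def by blast

lemma sum_lists_Suc:
  "(\<Sum>cs | length cs = Suc k. f cs) = (\<Sum>c\<in>UNIV. \<Sum>cs | length cs = k. f (c # cs))"
  for f :: "'c::finite list \<Rightarrow> 'a::comm_monoid_add"
proof -
  have "{cs :: 'c list. length cs = Suc k} = (\<lambda>(c, cs). c # cs) ` (UNIV \<times> {cs. length cs = k})"
    by (auto simp: length_Suc_conv image_iff)
  moreover have "inj_on (\<lambda>(c, cs). c # cs) (UNIV \<times> {cs :: 'c list. length cs = k})"
    by (auto simp: inj_on_def)
  ultimately show ?thesis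
    by (simp only: sum.reindex sum.cartesian_product) (simp add: case_prod_beta)
qed

text \<open>The weight of a new entry and the matrix it applies depend on the past only through the
  latest modes \<open>c\<close>; summing over the older entries therefore reproduces
  \<open>moment\<close> at \<open>k\<close>.\<close>

lemma moment_Suc:
  assumes q: "path_law P \<nu>h Q \<gamma>h q"
  shows "moment \<Phi> \<Gamma> q X (Suc k) =
    jump_op P \<nu>h Q \<gamma>h \<Phi> (moment \<Phi> \<Gamma> q X k) + noise_moment P \<nu>h Q \<gamma>h \<Gamma> (mode_prob q k)"
proof (rule vec_eq_iff[THEN iffD2], rule allI)
  fix d
  let ?\<kappa> = "chan_weight P \<nu>h Q \<gamma>h" and ?M = "path_moment \<Phi> \<Gamma> X"
  let ?F = "\<lambda>c e. jump_mat \<Phi> c d e" and ?G = "\<lambda>e. \<Gamma> (snd d) (snd e)"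
  have step: "q l ((d, e) # (c, e') # cs) *\<^sub>R ?M l ((d, e) # (c, e') # cs) =
      ?\<kappa> c d e *\<^sub>R (?F c e ** (q l ((c, e') # cs) *\<^sub>R ?M l ((c, e') # cs)) ** adj (?F c e)) +
      q l ((c, e') # cs) *\<^sub>R ?\<kappa> c d e *\<^sub>R (?G e ** adj (?G e))" for l e c e' cs
  proof -
    have "q l ((d, e) # (c, e') # cs) = ?\<kappa> c d e * q l ((c, e') # cs)"
      by (simp add: path_lawD[OF q])
    moreover have "?M l ((d, e) # (c, e') # cs) =
        ?F c e ** ?M l ((c, e') # cs) ** adj (?F c e) + ?G e ** adj (?G e)"
      by (simp add: step_mat_def jump_mat_def noise_mat_def prev_mode_def)
    ultimately show ?thesis
      by (simp only: linear_scale[OF linear_sandwich] scaleR_add_right scaleR_scaleR mult.commute)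
  qed
  have "moment \<Phi> \<Gamma> q X (Suc k) $ d = (\<Sum>l\<in>UNIV. \<Sum>e\<in>UNIV. \<Sum>c\<in>UNIV. \<Sum>e'\<in>UNIV. \<Sum>cs | length cs = k.
      q l ((d, e) # (c, e') # cs) *\<^sub>R ?M l ((d, e) # (c, e') # cs))"
    unfolding moment_def vec_lambda_beta sum_lists_Suc sum_prod_UNIV[where 'b = "bool \<times> bool"] ..
  also have "\<dots> = (\<Sum>e\<in>UNIV. \<Sum>l\<in>UNIV. \<Sum>c\<in>UNIV. \<Sum>e'\<in>UNIV. \<Sum>cs | length cs = k.
      q l ((d, e) # (c, e') # cs) *\<^sub>R ?M l ((d, e) # (c, e') # cs))"
    by (rule sum.swap)
  also have "\<dots> = (\<Sum>e\<in>UNIV. \<Sum>c\<in>UNIV. \<Sum>l\<in>UNIV. \<Sum>e'\<in>UNIV. \<Sum>cs | length cs = k.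
      q l ((d, e) # (c, e') # cs) *\<^sub>R ?M l ((d, e) # (c, e') # cs))"
    by (rule sum.cong[OF refl], rule sum.swap)
  also have "\<dots> = (\<Sum>e\<in>UNIV. \<Sum>c\<in>UNIV.
      ?\<kappa> c d e *\<^sub>R (?F c e ** (moment \<Phi> \<Gamma> q X k $ c) ** adj (?F c e)) +
      mode_prob q k c *\<^sub>R ?\<kappa> c d e *\<^sub>R (?G e ** adj (?G e)))"
    unfolding step
    by (simp only: sum.distrib moment_def mode_prob_def vec_lambda_beta
        linear_sum[OF linear_sandwich] scaleR_sum_right scaleR_sum_left)
  also have "\<dots> = (\<Sum>c\<in>UNIV. \<Sum>e\<in>UNIV.
      ?\<kappa> c d e *\<^sub>R (?F c e ** (moment \<Phi> \<Gamma> q X k $ c) ** adj (?F c e)) +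
      mode_prob q k c *\<^sub>R ?\<kappa> c d e *\<^sub>R (?G e ** adj (?G e)))"
    by (rule sum.swap)
  also have "\<dots> = (jump_op P \<nu>h Q \<gamma>h \<Phi> (moment \<Phi> \<Gamma> q X k) +
      noise_moment P \<nu>h Q \<gamma>h \<Gamma> (mode_prob q k)) $ d"
    by (simp add: sum.distrib jump_op_def kraus_op_def noise_moment_def mult.commute)
  finally show "moment \<Phi> \<Gamma> q X (Suc k) $ d = (jump_op P \<nu>h Q \<gamma>h \<Phi> (moment \<Phi> \<Gamma> q X k) +
      noise_moment P \<nu>h Q \<gamma>h \<Gamma> (mode_prob q k)) $ d" .
qed

section \<open>Law of the pair of channel modes\<close>

lemma bernoulli_prob_sum: "(\<Sum>b\<in>UNIV. bernoulli_prob p b) = 1"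
  by (simp add: UNIV_bool bernoulli_prob_def)

lemma chan_weight_sum:
  "(\<Sum>e\<in>UNIV. chan_weight P \<nu>h Q \<gamma>h c d e) = P $ fst c $ fst d * Q $ snd c $ snd d"
  unfolding chan_weight_def sum_prod_UNIV
  by (simp add: sum_distrib_left[symmetric] bernoulli_prob_sum sum_distrib_right[symmetric])

lemma mode_prob_Suc:
  assumes q: "path_law P \<nu>h Q \<gamma>h q"
  shows "mode_prob q (Suc k) d = (\<Sum>c\<in>UNIV. mode_prob q k c * (P $ fst c $ fst d * Q $ snd c $ snd d))"
proof -
  let ?\<kappa> = "chan_weight P \<nu>h Q \<gamma>h"
  have step: "q l ((d, e) # (c, e') # cs) = q l ((c, e') # cs) * ?\<kappa> c d e" for l e c e' cs
    by (simp add: path_lawD[OF q])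
  have "mode_prob q (Suc k) d = (\<Sum>l\<in>UNIV. \<Sum>e\<in>UNIV. \<Sum>c\<in>UNIV. \<Sum>e'\<in>UNIV. \<Sum>cs | length cs = k.
      q l ((c, e') # cs) * ?\<kappa> c d e)"
    unfolding mode_prob_def sum_lists_Suc sum_prod_UNIV[where 'b = "bool \<times> bool"] step ..
  also have "\<dots> = (\<Sum>e\<in>UNIV. \<Sum>l\<in>UNIV. \<Sum>c\<in>UNIV. \<Sum>e'\<in>UNIV. \<Sum>cs | length cs = k.
      q l ((c, e') # cs) * ?\<kappa> c d e)"
    by (rule sum.swap)
  also have "\<dots> = (\<Sum>e\<in>UNIV. \<Sum>c\<in>UNIV. \<Sum>l\<in>UNIV. \<Sum>e'\<in>UNIV. \<Sum>cs | length cs = k.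
      q l ((c, e') # cs) * ?\<kappa> c d e)"
    by (rule sum.cong[OF refl], rule sum.swap)
  also have "\<dots> = (\<Sum>e\<in>UNIV. \<Sum>c\<in>UNIV. mode_prob q k c * ?\<kappa> c d e)"
    unfolding mode_prob_def sum_distrib_right ..
  also have "\<dots> = (\<Sum>c\<in>UNIV. \<Sum>e\<in>UNIV. mode_prob q k c * ?\<kappa> c d e)"
    by (rule sum.swap)
  also have "\<dots> = (\<Sum>c\<in>UNIV. mode_prob q k c * (P $ fst c $ fst d * Q $ snd c $ snd d))"
    by (simp add: sum_distrib_left[symmetric] chan_weight_sum)
  finally show ?thesis .
qed

text \<open>Independence makes the initial law of the pair a product, and the transitions preserve
  the product form; so the two ergodic chains converge separately and the pair chain needs no
  ergodicity argument.\<close>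

lemma mode_prob_converges:
  fixes P :: "real^'m^'m" and Q :: "real^'s^'s"
  assumes P: "ergodic_chain P" and Q: "ergodic_chain Q"
  shows "\<exists>\<pi>. \<forall>q a b. path_law P \<nu>h Q \<gamma>h q \<and> (\<forall>l n. mode_prob q 0 (l, n) = a l * b n) \<and>
    (\<Sum>l\<in>UNIV. a l) = 1 \<and> (\<Sum>n\<in>UNIV. b n) = 1 \<longrightarrow> (\<forall>c. (\<lambda>k. mode_prob q k c) \<longlonglongrightarrow> \<pi> c)"
proof -
  obtain p where p: "\<And>\<mu>. (\<And>k j. \<mu> (Suc k) j = (\<Sum>i\<in>UNIV. \<mu> k i * P $ i $ j)) \<Longrightarrow>
      (\<Sum>i\<in>UNIV. \<mu> 0 i) = 1 \<Longrightarrow> (\<forall>i. (\<lambda>k. \<mu> k i) \<longlonglongrightarrow> p i)"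
    using ergodic_chain_limit[OF P] by blast
  obtain r where r: "\<And>\<mu>. (\<And>k j. \<mu> (Suc k) j = (\<Sum>i\<in>UNIV. \<mu> k i * Q $ i $ j)) \<Longrightarrow>
      (\<Sum>i\<in>UNIV. \<mu> 0 i) = 1 \<Longrightarrow> (\<forall>i. (\<lambda>k. \<mu> k i) \<longlonglongrightarrow> r i)"
    using ergodic_chain_limit[OF Q] by blast
  have "(\<lambda>k. mode_prob q k c) \<longlonglongrightarrow> p (fst c) * r (snd c)"
    if q: "path_law P \<nu>h Q \<gamma>h q" and init: "\<And>l n. mode_prob q 0 (l, n) = a l * b n"
      and a: "(\<Sum>l\<in>UNIV. a l) = 1" and b: "(\<Sum>n\<in>UNIV. b n) = 1" for q a b c
  proof -
    define \<alpha> where "\<alpha> = rec_nat a (\<lambda>k \<mu> j. \<Sum>i\<in>UNIV. \<mu> i * P $ i $ j)"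
    define \<beta> where "\<beta> = rec_nat b (\<lambda>k \<mu> j. \<Sum>i\<in>UNIV. \<mu> i * Q $ i $ j)"
    have \<alpha>: "\<And>k j. \<alpha> (Suc k) j = (\<Sum>i\<in>UNIV. \<alpha> k i * P $ i $ j)" "\<alpha> 0 = a" by (simp_all add: \<alpha>_def)
    have \<beta>: "\<And>k j. \<beta> (Suc k) j = (\<Sum>i\<in>UNIV. \<beta> k i * Q $ i $ j)" "\<beta> 0 = b" by (simp_all add: \<beta>_def)
    have prod: "mode_prob q k (l, n) = \<alpha> k l * \<beta> k n" for k l n
    proof (induction k arbitrary: l n)
      case (Suc k)
      have "mode_prob q (Suc k) (l, n) = (\<Sum>i\<in>UNIV. \<Sum>j\<in>UNIV. \<alpha> k i * P $ i $ l * (\<beta> k j * Q $ j $ n))"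
        unfolding mode_prob_Suc[OF q] sum_prod_UNIV Suc by (simp add: mult_ac)
      also have "\<dots> = \<alpha> (Suc k) l * \<beta> (Suc k) n"
        by (simp only: \<alpha>(1) \<beta>(1) sum_product)
      finally show ?case .
    qed (simp add: init \<alpha> \<beta>)
    have "(\<lambda>k. \<alpha> k (fst c) * \<beta> k (snd c)) \<longlonglongrightarrow> p (fst c) * r (snd c)"
      using p[of \<alpha>, OF \<alpha>(1)] r[of \<beta>, OF \<beta>(1)] a b by (intro tendsto_mult) (simp_all add: \<alpha>(2) \<beta>(2))
    then show ?thesis using prod[of _ "fst c" "snd c"] by simp
  qed
  then show ?thesis by (intro exI[of _ "\<lambda>c. p (fst c) * r (snd c)"]) blast
qed

text \<open>The forcing converges to a limit fixed by the chains alone, so \<open>z\<close> is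
  independent of the initial second moment and of the initial law.\<close>

lemma moment_converges:
  fixes P :: "real^'m^'m" and Q :: "real^'s^'s"
  assumes P: "ergodic_chain P" and Q: "ergodic_chain Q"
    and stable: "stable_map (jump_op P \<nu>h Q \<gamma>h \<Phi>)"
  shows "\<exists>z. \<forall>q X a b. path_law P \<nu>h Q \<gamma>h q \<and> (\<forall>l n. mode_prob q 0 (l, n) = a l * b n) \<and>
    (\<Sum>l\<in>UNIV. a l) = 1 \<and> (\<Sum>n\<in>UNIV. b n) = 1 \<longrightarrow> moment \<Phi> \<Gamma> q X \<longlonglongrightarrow> z"
proof -
  let ?N = "noise_moment P \<nu>h Q \<gamma>h \<Gamma>"
  obtain \<pi> where \<pi>: "\<And>q a b c. path_law P \<nu>h Q \<gamma>h q \<Longrightarrow> (\<forall>l n. mode_prob q 0 (l, n) = a l * b n) \<Longrightarrow>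
      (\<Sum>l\<in>UNIV. a l) = 1 \<Longrightarrow> (\<Sum>n\<in>UNIV. b n) = 1 \<Longrightarrow> (\<lambda>k. mode_prob q k c) \<longlonglongrightarrow> \<pi> c"
    using mode_prob_converges[OF P Q, of \<nu>h \<gamma>h] by blast
  have lin: "linear (jump_op P \<nu>h Q \<gamma>h \<Phi>)" unfolding jump_op_def by (rule linear_kraus_op)
  obtain z where z: "\<And>x d. d \<longlonglongrightarrow> ?N \<pi> \<Longrightarrow>
      (\<forall>k. x (Suc k) = jump_op P \<nu>h Q \<gamma>h \<Phi> (x k) + d k) \<Longrightarrow> x \<longlonglongrightarrow> z"
    using stable_affine_limit[OF lin stable, of "?N \<pi>"] by blast
  have "moment \<Phi> \<Gamma> q X \<longlonglongrightarrow> z"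
    if q: "path_law P \<nu>h Q \<gamma>h q" "\<forall>l n. mode_prob q 0 (l, n) = a l * b n"
      "(\<Sum>l\<in>UNIV. a l) = 1" "(\<Sum>n\<in>UNIV. b n) = 1" for q X a b
  proof (rule z)
    show "(\<lambda>k. ?N (mode_prob q k)) \<longlonglongrightarrow> ?N \<pi>"
      unfolding noise_moment_def
    proof (rule vec_tendstoI)
      fix d
      show "(\<lambda>k. (\<chi> d. \<Sum>c\<in>UNIV. \<Sum>e\<in>UNIV. (chan_weight P \<nu>h Q \<gamma>h c d e * mode_prob q k c) *\<^sub>R
          (\<Gamma> (snd d) (snd e) ** adj (\<Gamma> (snd d) (snd e)))) $ d) \<longlonglongrightarrow>
        (\<chi> d. \<Sum>c\<in>UNIV. \<Sum>e\<in>UNIV. (chan_weight P \<nu>h Q \<gamma>h c d e * \<pi> c) *\<^sub>R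
          (\<Gamma> (snd d) (snd e) ** adj (\<Gamma> (snd d) (snd e)))) $ d"
        unfolding vec_lambda_beta by (intro tendsto_sum tendsto_scaleR tendsto_mult tendsto_const \<pi>[OF q])
    qed
  qed (simp add: moment_Suc[OF q(1)])
  then show ?thesis by blast
qed

lemma zero_matrix_mult: "0 ** A = (0 :: complex^'n^'m)"
  by (simp add: vec_eq_iff matrix_matrix_mult_def)

text \<open>\<open>path_moment\<close> is affine in \<open>X\<close>, and its value at 0 is the
  noise contribution.\<close>

lemma path_moment_diff:
  "path_moment \<Phi> \<Gamma> X l cs - path_moment \<Phi> \<Gamma> 0 l cs = path_moment \<Phi> (\<lambda>_ _. 0 :: complex^'w^'n) X l cs"
  for \<Gamma> :: "'s \<Rightarrow> bool \<Rightarrow> complex^'w^'n"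
proof (induction cs)
  case (Cons c cs)
  have "noise_mat (\<lambda>_ _. 0) c ** adj (noise_mat (\<lambda>_ _. 0 :: complex^'w^'n) c) = 0"
    by (simp add: noise_mat_def vec_eq_iff matrix_matrix_mult_def)
  then show ?case by (simp add: linear_diff[OF linear_sandwich, symmetric] Cons)
qed simp

lemma moment_diff:
  "moment \<Phi> \<Gamma> q X k - moment \<Phi> \<Gamma> q 0 k = moment \<Phi> (\<lambda>_ _. 0 :: complex^'w^'n) q X k"
  for \<Gamma> :: "'s::finite \<Rightarrow> bool \<Rightarrow> complex^'w^'n"
  unfolding path_moment_diff[of \<Phi> \<Gamma> X, symmetric] moment_def
  by (rule vec_eq_iff[THEN iffD2])
    (simp add: sum_subtractf scaleR_diff_right del: path_moment.simps)

lemma noise_moment_zero: "noise_moment P \<nu>h Q \<gamma>h (\<lambda>_ _. 0) \<mu> = 0"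
  by (simp add: noise_moment_def vec_eq_iff matrix_matrix_mult_def)

text \<open>The law \<open>q0\<close> of the first entry is that of a transition out of fictitious
  modes \<open>c\<^sub>0\<close> at time -1. The first step is then also an application of the
  operator, whence the exponent \<open>Suc k\<close>.\<close>

lemma moment_homogeneous:
  assumes q: "path_law P \<nu>h Q \<gamma>h q"
    and q0: "\<And>l c. q l [c] = (if l = fst c\<^sub>0 then chan_weight P \<nu>h Q \<gamma>h c\<^sub>0 (fst c) (snd c) else 0)"
  shows "moment \<Phi> (\<lambda>_ _. 0 :: complex^'w^'n) q (outer v v) k =
    (jump_op P \<nu>h Q \<gamma>h \<Phi> ^^ Suc k) (dyad c\<^sub>0 v v)"
proof (induction k)
  case 0
  have "moment \<Phi> (\<lambda>_ _. 0 :: complex^'w^'n) q (outer v v) 0 $ d =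
      jump_op P \<nu>h Q \<gamma>h \<Phi> (dyad c\<^sub>0 v v) $ d" for d
  proof -
    have "moment \<Phi> (\<lambda>_ _. 0 :: complex^'w^'n) q (outer v v) 0 $ d =
        (\<Sum>l\<in>UNIV. \<Sum>e\<in>UNIV. if l = fst c\<^sub>0 then chan_weight P \<nu>h Q \<gamma>h c\<^sub>0 d e *\<^sub>R
          (jump_mat \<Phi> c\<^sub>0 d e ** outer v v ** adj (jump_mat \<Phi> c\<^sub>0 d e)) else 0)"
      unfolding moment_def vec_lambda_beta
      by (intro sum.cong refl)
        (simp add: q0 prev_mode_def step_mat_def jump_mat_def noise_mat_def zero_matrix_mult)
    also have "\<dots> = (\<Sum>e\<in>UNIV. chan_weight P \<nu>h Q \<gamma>h c\<^sub>0 d e *\<^sub>R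
          (jump_mat \<Phi> c\<^sub>0 d e ** outer v v ** adj (jump_mat \<Phi> c\<^sub>0 d e)))"
      by (subst sum.swap) simp
    also have "\<dots> = (\<Sum>c\<in>UNIV. if c = c\<^sub>0 then (\<Sum>e\<in>UNIV. chan_weight P \<nu>h Q \<gamma>h c\<^sub>0 d e *\<^sub>R
          (jump_mat \<Phi> c\<^sub>0 d e ** outer v v ** adj (jump_mat \<Phi> c\<^sub>0 d e))) else 0)"
      by simp
    also have "\<dots> = jump_op P \<nu>h Q \<gamma>h \<Phi> (dyad c\<^sub>0 v v) $ d"
      unfolding jump_op_def kraus_op_def vec_lambda_beta dyad_def
      by (intro sum.cong refl) (simp add: linear_0[OF linear_sandwich])
    finally show ?thesis .
  qed
  then show ?case by (simp add: vec_eq_iff[of "moment _ _ _ _ _"])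
next
  case (Suc k)
  then show ?case by (simp add: moment_Suc[OF q] noise_moment_zero)
qed

lemma sum_moment:
  "(\<Sum>c\<in>UNIV. moment \<Phi> \<Gamma> q X k $ c) =
    (\<Sum>l\<in>UNIV. \<Sum>cs | length cs = Suc k. q l cs *\<^sub>R path_moment \<Phi> \<Gamma> X l cs)"
proof -
  have "(\<Sum>c\<in>UNIV. moment \<Phi> \<Gamma> q X k $ c) = (\<Sum>l\<in>UNIV. \<Sum>c\<in>UNIV. \<Sum>e\<in>UNIV. \<Sum>cs | length cs = k.
      q l ((c, e) # cs) *\<^sub>R path_moment \<Phi> \<Gamma> X l ((c, e) # cs))"
    unfolding moment_def vec_lambda_beta by (rule sum.swap)
  also have "\<dots> = (\<Sum>l\<in>UNIV. \<Sum>cs | length cs = Suc k. q l cs *\<^sub>R path_moment \<Phi> \<Gamma> X l cs)"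
    unfolding sum_lists_Suc sum_prod_UNIV[where 'b = "bool \<times> bool"] ..
  finally show ?thesis .
qed

section \<open>Square integrable random vectors\<close>

lemma linear_mat_vec: "linear (\<lambda>v. A *v v)" for A :: "complex^'n^'m"
  by (rule linearI)
    (simp_all add: vec_eq_iff matrix_vector_mult_def sum.distrib algebra_simps scaleR_sum_right)

lemma bounded_bilinear_outer: "bounded_bilinear (outer :: complex^'m \<Rightarrow> complex^'n \<Rightarrow> _)"
  unfolding bilinear_conv_bounded_bilinear[symmetric] bilinear_def
  by (auto intro!: linearI simp: outer_def vec_eq_iff algebra_simps)

lemma outer_mat_vec: "outer (A *v x) (B *v y) = A ** outer x y ** adj B"
  for A :: "complex^'n^'m" and B :: "complex^'q^'p"
proof -
  have "outer (A *v x) (B *v y) $ i $ j = (A ** outer x y ** adj B) $ i $ j" for i j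
    by (simp add: outer_def adj_def matrix_vector_mult_def matrix_matrix_mult_def sum_product
        sum_distrib_left sum_distrib_right mult_ac)
  then show ?thesis by (simp add: vec_eq_iff)
qed

definition sq_integrable :: "'a measure \<Rightarrow> ('a \<Rightarrow> 'b::real_normed_vector) \<Rightarrow> bool" where
  "sq_integrable M f \<longleftrightarrow> f \<in> borel_measurable M \<and> integrable M (\<lambda>x. (norm (f x))\<^sup>2)"

lemma sq_integrable_add:
  fixes f g :: "'a \<Rightarrow> 'b::euclidean_space"
  assumes f: "sq_integrable M f" and g: "sq_integrable M g"
  shows "sq_integrable M (\<lambda>x. f x + g x)"
proof -
  have [measurable]: "f \<in> borel_measurable M" "g \<in> borel_measurable M"
    using f g by (auto simp: sq_integrable_def)
  have int: "integrable M (\<lambda>x. 2 * (norm (f x))\<^sup>2 + 2 * (norm (g x))\<^sup>2)"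
    using f g by (auto simp: sq_integrable_def)
  have bound: "(norm (f x + g x))\<^sup>2 \<le> 2 * (norm (f x))\<^sup>2 + 2 * (norm (g x))\<^sup>2" for x
  proof -
    have "(norm (f x + g x))\<^sup>2 \<le> (norm (f x) + norm (g x))\<^sup>2"
      by (intro power_mono norm_triangle_ineq) simp
    also have "\<dots> \<le> 2 * (norm (f x))\<^sup>2 + 2 * (norm (g x))\<^sup>2"
      using sum_squares_bound[of "norm (f x)" "norm (g x)"] by (simp add: power2_sum)
    finally show ?thesis .
  qed
  have "integrable M (\<lambda>x. (norm (f x + g x))\<^sup>2)"
    by (rule Bochner_Integration.integrable_bound[OF int]) (use bound in auto)
  then show ?thesis by (simp add: sq_integrable_def)
qed

lemma sq_integrable_linear:
  fixes T :: "'b::euclidean_space \<Rightarrow> 'c::euclidean_space"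
  assumes T: "linear T" and f: "sq_integrable M f"
  shows "sq_integrable M (\<lambda>x. T (f x))"
proof -
  have bl: "bounded_linear T" using T by (rule linear_conv_bounded_linear[THEN iffD1])
  obtain K where K: "\<And>x. norm (T x) \<le> norm x * K" using bounded_linear.bounded[OF bl] by blast
  have [measurable]: "f \<in> borel_measurable M" using f by (simp add: sq_integrable_def)
  have meas: "(\<lambda>x. T (f x)) \<in> borel_measurable M"
    by (rule borel_measurable_continuous_on[OF linear_continuous_on[OF bl]]) simp
  have int: "integrable M (\<lambda>x. K\<^sup>2 * (norm (f x))\<^sup>2)"
    using f by (simp add: sq_integrable_def)
  have bound: "(norm (T (f x)))\<^sup>2 \<le> K\<^sup>2 * (norm (f x))\<^sup>2" for x
    using power_mono[OF K[of "f x"], of 2] by (simp add: power_mult_distrib mult.commute)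
  have "integrable M (\<lambda>x. (norm (T (f x)))\<^sup>2)"
    by (rule Bochner_Integration.integrable_bound[OF int]) (use meas bound in auto)
  with meas show ?thesis by (simp add: sq_integrable_def)
qed

lemma integrable_outer:
  assumes f: "sq_integrable M f" and g: "sq_integrable M g"
  shows "integrable M (\<lambda>x. outer (f x) (g x))"
proof -
  obtain K where K: "\<And>u v. norm (outer (u :: complex^'b) (v :: complex^'c)) \<le> norm u * norm v * K" "0 < K"
    using bounded_bilinear.pos_bounded[OF bounded_bilinear_outer] by blast
  have [measurable]: "f \<in> borel_measurable M" "g \<in> borel_measurable M"
    using f g by (auto simp: sq_integrable_def)
  have [measurable]: "(\<lambda>x. outer (f x) (g x)) \<in> borel_measurable M"
    by (rule borel_measurable_continuous_Pair[of f M g outer])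
      (measurable, intro bounded_bilinear.continuous_on[OF bounded_bilinear_outer] continuous_intros)
  have "integrable M (\<lambda>x. K * ((norm (f x))\<^sup>2 + (norm (g x))\<^sup>2))"
    using f g by (auto simp: sq_integrable_def)
  then show ?thesis
  proof (rule Bochner_Integration.integrable_bound)
    show "AE x in M. norm (outer (f x) (g x)) \<le> norm (K * ((norm (f x))\<^sup>2 + (norm (g x))\<^sup>2))"
    proof (rule AE_I2)
      fix x
      have "norm (f x) * norm (g x) \<le> (norm (f x))\<^sup>2 + (norm (g x))\<^sup>2"
        using sum_squares_bound[of "norm (f x)" "norm (g x)", unfolded mult.assoc]
          mult_nonneg_nonneg[OF norm_ge_zero[of "f x"] norm_ge_zero[of "g x"]] by linarith
      then have "norm (f x) * norm (g x) * K \<le> ((norm (f x))\<^sup>2 + (norm (g x))\<^sup>2) * K"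
        using K(2) by (intro mult_right_mono) auto
      then have "norm (outer (f x) (g x)) \<le> ((norm (f x))\<^sup>2 + (norm (g x))\<^sup>2) * K"
        by (rule order_trans[OF K(1)])
      then show "norm (outer (f x) (g x)) \<le> norm (K * ((norm (f x))\<^sup>2 + (norm (g x))\<^sup>2))"
        using K(2) by (simp add: mult.commute abs_mult)
    qed
  qed simp
qed

lemma (in prob_space) sq_integrable_integrable:
  fixes f :: "'a \<Rightarrow> 'b::euclidean_space"
  assumes "sq_integrable M f"
  shows "integrable M f"
proof -
  have [measurable]: "f \<in> borel_measurable M" using assms by (simp add: sq_integrable_def)
  have "integrable M (\<lambda>x. 1 + (norm (f x))\<^sup>2)" using assms by (simp add: sq_integrable_def)
  then show ?thesis
  proof (rule Bochner_Integration.integrable_bound)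
    show "AE x in M. norm (f x) \<le> norm (1 + (norm (f x))\<^sup>2)"
    proof (rule AE_I2)
      fix x
      have "0 \<le> (norm (f x) - 1)\<^sup>2" by simp
      then show "norm (f x) \<le> norm (1 + (norm (f x))\<^sup>2)"
        by (simp add: power2_diff) (smt (verit) norm_ge_zero)
    qed
  qed simp
qed

text \<open>Independence is supplied for whole sigma-algebras; those generated by \<open>X\<close>
  and \<open>Y\<close> are contained in them.\<close>

lemma (in prob_space) indep_set_integral_mult:
  fixes X Y :: "'a \<Rightarrow> 'b::{real_normed_field, banach, second_countable_topology}"
  assumes ind: "indep_set (sets A) (sets B)" and sp: "space A = space M" "space B = space M"
    and X: "X \<in> borel_measurable A" "integrable M X" and Y: "Y \<in> borel_measurable B" "integrable M Y"
  shows "(\<integral>x. X x * Y x \<partial>M) = (\<integral>x. X x \<partial>M) * (\<integral>x. Y x \<partial>M)"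
proof (rule indep_var_lebesgue_integral[OF _ X(2) Y(2)])
  let ?\<sigma> = "\<lambda>X. sigma_sets (space M) {X -` S \<inter> space M |S. S \<in> sets borel}"
  have \<sigma>: "?\<sigma> Z \<subseteq> sets C" if "Z \<in> borel_measurable C" "space C = space M" for Z :: "'a \<Rightarrow> 'b" and C
    unfolding that(2)[symmetric] using measurable_sets[OF that(1)]
    by (auto intro!: sets.sigma_sets_subset)
  have sub: "?\<sigma> X \<subseteq> sets A" "?\<sigma> Y \<subseteq> sets B" using \<sigma> X Y sp by auto
  have "indep_set (?\<sigma> X) (?\<sigma> Y)"
  proof (rule indep_setI)
    show "?\<sigma> X \<subseteq> events" "?\<sigma> Y \<subseteq> events"
      using sub indep_setD_ev1[OF ind] indep_setD_ev2[OF ind] by (blast intro: subset_trans)+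
    show "prob (a \<inter> b) = prob a * prob b" if "a \<in> ?\<sigma> X" "b \<in> ?\<sigma> Y" for a b
      by (rule indep_setD[OF ind subsetD[OF sub(1) that(1)] subsetD[OF sub(2) that(2)]])
  qed
  then show "indep_var borel X borel Y"
    unfolding indep_var_eq using borel_measurable_integrable[OF X(2)] borel_measurable_integrable[OF Y(2)]
    by simp
qed

text \<open>This takes the place of conditioning on a channel history \<open>E\<close>. It is proved
  coordinatewise, where the scalar product rule applies.\<close>

lemma (in prob_space) indep_set_integral_indicator:
  fixes X :: "'a \<Rightarrow> 'b::euclidean_space"
  assumes ind: "indep_set (sets A) (sets B)" and sp: "space A = space M" "space B = space M"
    and X: "X \<in> borel_measurable A" "integrable M X" and E: "E \<in> sets B"
  shows "(\<integral>x. indicator E x *\<^sub>R X x \<partial>M) = prob E *\<^sub>R (\<integral>x. X x \<partial>M)"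
proof (rule euclidean_eqI)
  fix b :: 'b assume "b \<in> Basis"
  have ev: "E \<in> events" using indep_setD_ev2[OF ind] E by blast
  have "(\<integral>x. indicator E x *\<^sub>R X x \<partial>M) \<bullet> b = (\<integral>x. (indicator E x *\<^sub>R X x) \<bullet> b \<partial>M)"
    using X(2) ev by (intro integral_inner_left[symmetric] integrable_mult_indicator) auto
  also have "\<dots> = (\<integral>x. (X x \<bullet> b) * indicator E x \<partial>M)" by (simp add: mult.commute)
  also have "\<dots> = (\<integral>x. X x \<bullet> b \<partial>M) * (\<integral>x. indicator E x \<partial>M)"
    using X E ev by (intro indep_set_integral_mult[OF ind sp]) (auto simp: emeasure_eq_measure)
  also have "\<dots> = (prob E *\<^sub>R (\<integral>x. X x \<partial>M)) \<bullet> b"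
    using X(2) ev by (simp add: mult.commute)
  finally show "(\<integral>x. indicator E x *\<^sub>R X x \<partial>M) \<bullet> b = (prob E *\<^sub>R (\<integral>x. X x \<partial>M)) \<bullet> b" .
qed

section \<open>Channel histories\<close>

primrec chan_hist :: "(nat \<Rightarrow> 'o \<Rightarrow> 'm) \<Rightarrow> (nat \<Rightarrow> 'o \<Rightarrow> bool) \<Rightarrow> nat \<Rightarrow> 'o \<Rightarrow> ('m \<times> bool) list" where
  "chan_hist \<theta> \<nu> 0 \<omega> = []"
| "chan_hist \<theta> \<nu> (Suc k) \<omega> = (\<theta> k \<omega>, \<nu> k \<omega>) # chan_hist \<theta> \<nu> k \<omega>"

lemma chan_hist_eq_iff:
  "length xs = k \<Longrightarrow> chan_hist \<theta> \<nu> k \<omega> = xs \<longleftrightarrow>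
    (\<forall>j<k. \<theta> j \<omega> = fst (rev xs ! j) \<and> \<nu> j \<omega> = snd (rev xs ! j))"
proof (induction k arbitrary: xs)
  case (Suc k)
  then obtain i b ys where xs: "xs = (i, b) # ys" "length ys = k" by (auto simp: length_Suc_conv)
  have "chan_hist \<theta> \<nu> (Suc k) \<omega> = xs \<longleftrightarrow> (\<theta> k \<omega> = i \<and> \<nu> k \<omega> = b) \<and>
      (\<forall>j<k. \<theta> j \<omega> = fst (rev ys ! j) \<and> \<nu> j \<omega> = snd (rev ys ! j))"
    using Suc.IH[OF xs(2)] by (auto simp: xs(1))
  also have "\<dots> \<longleftrightarrow> (\<forall>j<Suc k. \<theta> j \<omega> = fst (rev xs ! j) \<and> \<nu> j \<omega> = snd (rev xs ! j))"
    using xs(2) by (auto simp: xs(1) nth_append less_Suc_eq)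
  finally show ?case .
qed simp

text \<open>The conditional laws are prescribed only on events of positive probability. In product
  form they hold on null events too, both sides being 0.\<close>

lemma channel_process_hist:
  assumes \<Omega>: "prob_space \<Omega>" and ch: "channel_process \<Omega> P p c \<theta> \<nu>"
  shows "\<P>(\<omega> in \<Omega>. c \<omega> = d \<and> chan_hist \<theta> \<nu> (Suc 0) \<omega> = [(i, b)]) =
      \<P>(\<omega> in \<Omega>. c \<omega> = d \<and> \<theta> 0 \<omega> = i) * bernoulli_prob (p i) b" (is ?init)
    and "length xs = k \<Longrightarrow>
      \<P>(\<omega> in \<Omega>. c \<omega> = d \<and> chan_hist \<theta> \<nu> (Suc (Suc k)) \<omega> = (i, b) # (j, a) # xs) =
      \<P>(\<omega> in \<Omega>. c \<omega> = d \<and> chan_hist \<theta> \<nu> (Suc k) \<omega> = (j, a) # xs) * (P $ j $ i * bernoulli_prob (p i) b)"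
      (is "_ \<Longrightarrow> ?step")
proof -
  interpret prob_space \<Omega> by (rule \<Omega>)
  have [measurable]: "c \<in> measurable \<Omega> (count_space UNIV)" "\<theta> k \<in> measurable \<Omega> (count_space UNIV)"
    "\<nu> k \<in> measurable \<Omega> (count_space UNIV)" for k
    using ch by (auto simp: channel_process_def)
  have ch_step: "\<P>(\<omega> in \<Omega>. \<theta> (Suc k) \<omega> = i \<and> \<nu> (Suc k) \<omega> = b \<bar>
        c \<omega> = d \<and> (\<forall>j\<le>k. \<theta> j \<omega> = f j \<and> \<nu> j \<omega> = g j)) = bernoulli_prob (p i) b * P $ f k $ i"
    if "\<P>(\<omega> in \<Omega>. c \<omega> = d \<and> (\<forall>j\<le>k. \<theta> j \<omega> = f j \<and> \<nu> j \<omega> = g j)) \<noteq> 0" for k f g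
    using ch that unfolding channel_process_def by blast
  have cond: "\<P>(\<omega> in \<Omega>. R \<omega> \<and> S \<omega>) = \<P>(\<omega> in \<Omega>. S \<omega>) * r"
    if "\<P>(\<omega> in \<Omega>. S \<omega>) \<noteq> 0 \<longrightarrow> \<P>(\<omega> in \<Omega>. R \<omega> \<bar> S \<omega>) = r"
      "Measurable.pred \<Omega> S" for R S r
  proof (cases "\<P>(\<omega> in \<Omega>. S \<omega>) = 0")
    case True
    have "\<P>(\<omega> in \<Omega>. R \<omega> \<and> S \<omega>) \<le> \<P>(\<omega> in \<Omega>. S \<omega>)"
      using that(2) by (intro finite_measure_mono) auto
    then show ?thesis using True by (simp add: measure_le_0_iff)
  next
    case False
    then show ?thesis using that(1) by (auto simp: cond_prob_def divide_simps)
  qed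
  have "\<P>(\<omega> in \<Omega>. \<nu> 0 \<omega> = b \<and> (c \<omega> = d \<and> \<theta> 0 \<omega> = i)) =
      \<P>(\<omega> in \<Omega>. c \<omega> = d \<and> \<theta> 0 \<omega> = i) * bernoulli_prob (p i) b"
    using ch by (intro cond) (auto simp: channel_process_def)
  moreover have "{\<omega> \<in> space \<Omega>. c \<omega> = d \<and> chan_hist \<theta> \<nu> (Suc 0) \<omega> = [(i, b)]} =
      {\<omega> \<in> space \<Omega>. \<nu> 0 \<omega> = b \<and> (c \<omega> = d \<and> \<theta> 0 \<omega> = i)}" by auto
  ultimately show ?init by simp
  assume len: "length xs = k"
  let ?s = "\<lambda>l. fst (rev ((j, a) # xs) ! l)" and ?a = "\<lambda>l. snd (rev ((j, a) # xs) ! l)"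
  have hist: "chan_hist \<theta> \<nu> (Suc k) \<omega> = (j, a) # xs \<longleftrightarrow> (\<forall>l\<le>k. \<theta> l \<omega> = ?s l \<and> \<nu> l \<omega> = ?a l)" for \<omega>
    using chan_hist_eq_iff[of "(j, a) # xs" "Suc k" \<theta> \<nu> \<omega>] len by (simp only: less_Suc_eq_le) simp
  have "\<P>(\<omega> in \<Omega>. (\<theta> (Suc k) \<omega> = i \<and> \<nu> (Suc k) \<omega> = b) \<and>
        (c \<omega> = d \<and> (\<forall>l\<le>k. \<theta> l \<omega> = ?s l \<and> \<nu> l \<omega> = ?a l))) =
      \<P>(\<omega> in \<Omega>. c \<omega> = d \<and> (\<forall>l\<le>k. \<theta> l \<omega> = ?s l \<and> \<nu> l \<omega> = ?a l)) *
        (bernoulli_prob (p i) b * P $ ?s k $ i)"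
  proof (rule cond)
    show "\<P>(\<omega> in \<Omega>. c \<omega> = d \<and> (\<forall>l\<le>k. \<theta> l \<omega> = ?s l \<and> \<nu> l \<omega> = ?a l)) \<noteq> 0 \<longrightarrow>
        \<P>(\<omega> in \<Omega>. \<theta> (Suc k) \<omega> = i \<and> \<nu> (Suc k) \<omega> = b \<bar> c \<omega> = d \<and>
          (\<forall>l\<le>k. \<theta> l \<omega> = ?s l \<and> \<nu> l \<omega> = ?a l)) = bernoulli_prob (p i) b * P $ ?s k $ i"
      by (intro impI, rule ch_step)
  qed measurable
  moreover have "?s k = j" using len by (simp add: nth_append)
  moreover have "{\<omega> \<in> space \<Omega>. c \<omega> = d \<and> chan_hist \<theta> \<nu> (Suc (Suc k)) \<omega> = (i, b) # (j, a) # xs} =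
      {\<omega> \<in> space \<Omega>. (\<theta> (Suc k) \<omega> = i \<and> \<nu> (Suc k) \<omega> = b) \<and>
        (c \<omega> = d \<and> (\<forall>l\<le>k. \<theta> l \<omega> = ?s l \<and> \<nu> l \<omega> = ?a l))}"
    unfolding hist[symmetric] by auto
  ultimately show ?step unfolding hist by (simp add: mult.commute)
qed

section \<open>Moments of a realization\<close>

text \<open>Freezing the history leaves a linear function of \<open>x0\<close> and \<open>w\<close>
  with deterministic coefficients. The history \<open>cs\<close> covers the times before
  \<open>length cs\<close>, so the next noise vector has that index.\<close>

primrec path_state ::
  "('m \<Rightarrow> bool \<Rightarrow> 's \<Rightarrow> bool \<Rightarrow> complex^'n^'n) \<Rightarrow> ('s \<Rightarrow> bool \<Rightarrow> complex^'w^'n) \<Rightarrow> complex^'n \<Rightarrow>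
   (nat \<Rightarrow> complex^'w) \<Rightarrow> 'm \<Rightarrow> ('m, 's) history \<Rightarrow> complex^'n" where
  "path_state \<Phi> \<Gamma> x0 w l [] = x0"
| "path_state \<Phi> \<Gamma> x0 w l (c # cs) =
     step_mat \<Phi> (prev_mode l cs) c *v path_state \<Phi> \<Gamma> x0 w l cs + noise_mat \<Gamma> c *v w (length cs)"

lemma integral_vec_nth:
  fixes f :: "'a \<Rightarrow> 'b::euclidean_space^'n"
  shows "integrable M f \<Longrightarrow> (\<integral>x. f x \<partial>M) $ i = (\<integral>x. f x $ i \<partial>M)"
  by (rule integral_bounded_linear[OF bounded_linear_vec_nth, symmetric])

lemma integral_linear:
  fixes T :: "'b::euclidean_space \<Rightarrow> 'c::euclidean_space"
  assumes "linear T" "integrable M f"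
  shows "(\<integral>x. T (f x) \<partial>M) = T (\<integral>x. f x \<partial>M)"
  using integral_bounded_linear[OF linear_conv_bounded_linear[THEN iffD1, OF assms(1)] assms(2)] .

lemma linear_adj: "linear (adj :: complex^'n^'m \<Rightarrow> _)"
  by (rule linearI) (simp_all add: adj_def vec_eq_iff)

lemma outer_swap: "outer y x = adj (outer x y)"
  by (simp add: outer_def adj_def vec_eq_iff mult.commute)

lemma adj_zero: "adj 0 = 0"
  by (simp add: adj_def vec_eq_iff)

lemma outer_nth: "outer x y $ i $ j = x $ i * cnj (y $ j)"
  by (simp add: outer_def)

locale realized =
  fixes \<FF> :: "complex set" and W :: "(nat \<Rightarrow> complex^'w) measure"
    and P :: "real^'m^'m" and \<nu>h :: "'m \<Rightarrow> real" and Q :: "real^'s^'s" and \<gamma>h :: "'s \<Rightarrow> real"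
    and \<Omega> :: "'o measure" and \<xi>0 :: "'o \<Rightarrow> complex^'n" and \<theta>m :: "'o \<Rightarrow> 'm"
    and \<theta> \<nu> and \<eta> :: "nat \<Rightarrow> 'o \<Rightarrow> 's" and \<gamma> w
  assumes realization: "realization \<FF> W P \<nu>h Q \<gamma>h \<Omega> \<xi>0 \<theta>m \<theta> \<nu> \<eta> \<gamma> w"
    and noise: "noise_law \<FF> W"
begin

sublocale prob_space \<Omega>
  using realization by (simp add: realization_def)

section \<open>The independent sigma-algebras of a realization\<close>

definition state_algebra :: "'o measure" where
  "state_algebra = vimage_algebra (space \<Omega>) \<xi>0 borel"

definition noise_algebra :: "'o measure" where
  "noise_algebra = vimage_algebra (space \<Omega>) (\<lambda>\<omega> k. w k \<omega>) noise_space"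

definition act_algebra :: "'o measure" where
  "act_algebra = vimage_algebra (space \<Omega>) (\<lambda>\<omega>. (\<theta>m \<omega>, \<lambda>k. (\<theta> k \<omega>, \<nu> k \<omega>)))
     (count_space UNIV \<Otimes>\<^sub>M channel_space)"

definition sense_algebra :: "'o measure" where
  "sense_algebra = vimage_algebra (space \<Omega>) (\<lambda>\<omega> k. (\<eta> k \<omega>, \<gamma> k \<omega>)) channel_space"

text \<open>State and noise are pooled, as are the two channels below: averaging over histories uses
  that the channels together are independent of all that a frozen state depends on.\<close>

definition data_algebra :: "'o measure" where
  "data_algebra = sigma (space \<Omega>) (sets state_algebra \<union> sets noise_algebra)"

definition chan_algebra :: "'o measure" where
  "chan_algebra = sigma (space \<Omega>) (sets act_algebra \<union> sets sense_algebra)"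

lemma space_algebras [simp]:
  "space state_algebra = space \<Omega>" "space noise_algebra = space \<Omega>" "space act_algebra = space \<Omega>"
  "space sense_algebra = space \<Omega>" "space data_algebra = space \<Omega>" "space chan_algebra = space \<Omega>"
  by (simp_all add: state_algebra_def noise_algebra_def act_algebra_def sense_algebra_def
      data_algebra_def chan_algebra_def space_measure_of_conv)

lemma sets_data_algebra:
  "sets data_algebra = sigma_sets (space \<Omega>) (sets state_algebra \<union> sets noise_algebra)"
  unfolding data_algebra_def
  using sets.sets_into_space[of _ state_algebra] sets.sets_into_space[of _ noise_algebra]
  by (intro sets_measure_of) auto

lemma sets_chan_algebra:
  "sets chan_algebra = sigma_sets (space \<Omega>) (sets act_algebra \<union> sets sense_algebra)"
  unfolding chan_algebra_def
  using sets.sets_into_space[of _ act_algebra] sets.sets_into_space[of _ sense_algebra]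
  by (intro sets_measure_of) auto

lemma indep_algebras:
  "indep_sets (\<lambda>i. sets ([state_algebra, noise_algebra, act_algebra, sense_algebra] ! i)) {..<4}"
  using realization
  unfolding realization_def state_algebra_def noise_algebra_def act_algebra_def sense_algebra_def
  by (elim conjE)

lemma indep_pair:
  assumes "i < 4" "j < 4" "i \<noteq> j"
  shows "indep_set (sets ([state_algebra, noise_algebra, act_algebra, sense_algebra] ! i))
    (sets ([state_algebra, noise_algebra, act_algebra, sense_algebra] ! j))" (is "indep_set (?A i) (?A j)")
proof (rule indep_setI)
  show "?A i \<subseteq> events" "?A j \<subseteq> events"
    using indep_algebras assms unfolding indep_sets_def by auto
  show "prob (a \<inter> b) = prob a * prob b" if "a \<in> ?A i" "b \<in> ?A j" for a b
    using indep_setsD[OF indep_algebras, of "{i, j}" "\<lambda>k. if k = i then a else b"] assms that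
    by (simp add: Int_commute split: if_splits)
qed

lemma indep_state_noise: "indep_set (sets state_algebra) (sets noise_algebra)"
  using indep_pair[of 0 1] by simp

lemma indep_act_sense: "indep_set (sets act_algebra) (sets sense_algebra)"
  using indep_pair[of 2 3] by simp

lemma indep_data_chan: "indep_set (sets data_algebra) (sets chan_algebra)"
proof -
  let ?A = "\<lambda>i. sets ([state_algebra, noise_algebra, act_algebra, sense_algebra] ! i)"
  let ?I = "case_bool {0, 1} {2, 3 :: nat}"
  have "(\<Union>j\<in>UNIV. ?I j) = {..<4}" by (auto simp: UNIV_bool)
  then have "indep_sets ?A (\<Union>j\<in>UNIV. ?I j)" using indep_algebras by simp
  then have "indep_sets (\<lambda>j. sigma_sets (space \<Omega>) (\<Union>i\<in>?I j. ?A i)) UNIV"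
    by (rule indep_sets_collect_sigma)
      (auto simp: disjoint_family_on_def sets.Int_stable split: bool.splits)
  moreover have "(\<lambda>j. sigma_sets (space \<Omega>) (\<Union>i\<in>?I j. ?A i)) =
      case_bool (sets data_algebra) (sets chan_algebra)"
    by (rule ext) (auto simp: sets_data_algebra sets_chan_algebra split: bool.splits)
  ultimately show ?thesis by (simp add: indep_set_def)
qed

lemma sets_algebras_le:
  "sets state_algebra \<subseteq> sets data_algebra" "sets noise_algebra \<subseteq> sets data_algebra"
  "sets act_algebra \<subseteq> sets chan_algebra" "sets sense_algebra \<subseteq> sets chan_algebra"
  by (auto simp: sets_data_algebra sets_chan_algebra)

lemma state_measurable: "\<xi>0 \<in> borel_measurable state_algebra"
  unfolding state_algebra_def by (rule measurable_vimage_algebra1) simp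

lemma noise_measurable: "w k \<in> borel_measurable noise_algebra"
proof -
  have "(\<lambda>\<omega> k. w k \<omega>) \<in> measurable noise_algebra noise_space"
    unfolding noise_algebra_def by (rule measurable_vimage_algebra1) (simp add: space_PiM)
  from measurable_compose[OF this measurable_component_singleton[of k UNIV]] show ?thesis by simp
qed

lemma act_measurable:
  "\<theta>m \<in> measurable act_algebra (count_space UNIV)"
  "\<theta> k \<in> measurable act_algebra (count_space UNIV)" "\<nu> k \<in> measurable act_algebra (count_space UNIV)"
proof -
  have *: "(\<lambda>\<omega>. (\<theta>m \<omega>, \<lambda>k. (\<theta> k \<omega>, \<nu> k \<omega>))) \<in>
      measurable act_algebra (count_space UNIV \<Otimes>\<^sub>M channel_space)"
    unfolding act_algebra_def
    by (rule measurable_vimage_algebra1) (simp add: space_PiM space_pair_measure)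
  from measurable_compose[OF * measurable_fst] show "\<theta>m \<in> measurable act_algebra (count_space UNIV)"
    by simp
  have "(\<lambda>\<omega>. (\<theta> k \<omega>, \<nu> k \<omega>)) \<in> measurable act_algebra (count_space UNIV)"
    using measurable_compose[OF measurable_compose[OF * measurable_snd]
        measurable_component_singleton[of k UNIV]] by simp
  then have "(\<lambda>\<omega>. fst (\<theta> k \<omega>, \<nu> k \<omega>)) \<in> measurable act_algebra (count_space UNIV)"
    "(\<lambda>\<omega>. snd (\<theta> k \<omega>, \<nu> k \<omega>)) \<in> measurable act_algebra (count_space UNIV)"
    by (rule measurable_compose, simp)+
  then show "\<theta> k \<in> measurable act_algebra (count_space UNIV)" "\<nu> k \<in> measurable act_algebra (count_space UNIV)"
    by simp_all
qed

lemma sense_measurable: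
  "\<eta> k \<in> measurable sense_algebra (count_space UNIV)" "\<gamma> k \<in> measurable sense_algebra (count_space UNIV)"
proof -
  have *: "(\<lambda>\<omega> k. (\<eta> k \<omega>, \<gamma> k \<omega>)) \<in> measurable sense_algebra channel_space"
    unfolding sense_algebra_def by (rule measurable_vimage_algebra1) (simp add: space_PiM)
  have "(\<lambda>\<omega>. (\<eta> k \<omega>, \<gamma> k \<omega>)) \<in> measurable sense_algebra (count_space UNIV)"
    using measurable_compose[OF * measurable_component_singleton[of k UNIV]] by simp
  then have "(\<lambda>\<omega>. fst (\<eta> k \<omega>, \<gamma> k \<omega>)) \<in> measurable sense_algebra (count_space UNIV)"
    "(\<lambda>\<omega>. snd (\<eta> k \<omega>, \<gamma> k \<omega>)) \<in> measurable sense_algebra (count_space UNIV)"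
    by (rule measurable_compose, simp)+
  then show "\<eta> k \<in> measurable sense_algebra (count_space UNIV)" "\<gamma> k \<in> measurable sense_algebra (count_space UNIV)"
    by simp_all
qed

section \<open>Joint channel histories and their probabilities\<close>

primrec hist :: "nat \<Rightarrow> 'o \<Rightarrow> ('m, 's) history" where
  "hist 0 \<omega> = []"
| "hist (Suc k) \<omega> = ((\<theta> k \<omega>, \<eta> k \<omega>), (\<nu> k \<omega>, \<gamma> k \<omega>)) # hist k \<omega>"

lemma length_hist [simp]: "length (hist k \<omega>) = k"
  by (induction k) auto

lemma hist_eq_iff:
  "length cs = k \<Longrightarrow> hist k \<omega> = cs \<longleftrightarrow>
    chan_hist \<theta> \<nu> k \<omega> = map (\<lambda>c. (fst (fst c), fst (snd c))) cs \<and>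
    chan_hist \<eta> \<gamma> k \<omega> = map (\<lambda>c. (snd (fst c), snd (snd c))) cs"
proof (induction k arbitrary: cs)
  case (Suc k)
  then obtain i m b g ds where "cs = ((i, m), (b, g)) # ds" "length ds = k"
    by (auto simp: length_Suc_conv)
  then show ?case using Suc.IH[of ds] by auto
qed simp

definition act_event :: "'m \<Rightarrow> ('m \<times> bool) list \<Rightarrow> 'o set" where
  "act_event l xs = {\<omega> \<in> space \<Omega>. \<theta>m \<omega> = l \<and> chan_hist \<theta> \<nu> (length xs) \<omega> = xs}"

definition sense_event :: "('s \<times> bool) list \<Rightarrow> 'o set" where
  "sense_event ys = {\<omega> \<in> space \<Omega>. chan_hist \<eta> \<gamma> (length ys) \<omega> = ys}"

definition path_event :: "'m \<Rightarrow> ('m, 's) history \<Rightarrow> 'o set" where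
  "path_event l cs = {\<omega> \<in> space \<Omega>. \<theta>m \<omega> = l \<and> hist (length cs) \<omega> = cs}"

definition path_prob :: "'m \<Rightarrow> ('m, 's) history \<Rightarrow> real" where
  "path_prob l cs = prob (path_event l cs)"

lemma act_event_sets: "act_event l xs \<in> sets act_algebra"
proof -
  note [measurable] = act_measurable
  have "{\<omega> \<in> space act_algebra. \<theta>m \<omega> = l \<and> (\<forall>j<length xs.
      \<theta> j \<omega> = fst (rev xs ! j) \<and> \<nu> j \<omega> = snd (rev xs ! j))} \<in> sets act_algebra"
    by measurable
  then show ?thesis by (simp only: act_event_def chan_hist_eq_iff[OF refl] space_algebras)
qed

lemma sense_event_sets: "sense_event ys \<in> sets sense_algebra"
proof -
  note [measurable] = sense_measurable
  have "{\<omega> \<in> space sense_algebra. \<forall>j<length ys.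
      \<eta> j \<omega> = fst (rev ys ! j) \<and> \<gamma> j \<omega> = snd (rev ys ! j)} \<in> sets sense_algebra"
    by measurable
  then show ?thesis by (simp only: sense_event_def chan_hist_eq_iff[OF refl] space_algebras)
qed

lemma path_event_eq:
  "path_event l cs = act_event l (map (\<lambda>c. (fst (fst c), fst (snd c))) cs) \<inter>
    sense_event (map (\<lambda>c. (snd (fst c), snd (snd c))) cs)"
  by (auto simp: path_event_def act_event_def sense_event_def hist_eq_iff)

lemma path_event_sets: "path_event l cs \<in> sets chan_algebra"
  unfolding path_event_eq
  by (intro sets.Int subsetD[OF sets_algebras_le(3)] subsetD[OF sets_algebras_le(4)]
      act_event_sets sense_event_sets)

lemma path_prob_eq:
  "path_prob l cs = prob (act_event l (map (\<lambda>c. (fst (fst c), fst (snd c))) cs)) *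
    prob (sense_event (map (\<lambda>c. (snd (fst c), snd (snd c))) cs))"
  unfolding path_prob_def path_event_eq
  by (rule indep_setD[OF indep_act_sense act_event_sets sense_event_sets])

lemma channels:
  "channel_process \<Omega> P \<nu>h \<theta>m \<theta> \<nu>" "channel_process \<Omega> Q \<gamma>h (\<lambda>_. ()) \<eta> \<gamma>"
  using realization by (auto simp: realization_def)

text \<open>A joint history is the intersection of an actuation event and a sensing event, so its
  probability is a product in which each channel contributes its own transition factor.\<close>

lemma path_law_path_prob: "path_law P \<nu>h Q \<gamma>h path_prob"
proof -
  have act: "prob (act_event l ((i, b) # (j, a) # xs)) =
      prob (act_event l ((j, a) # xs)) * (P $ j $ i * bernoulli_prob (\<nu>h i) b)" for l i b j a xs
    unfolding act_event_def
    using channel_process_hist(2)[OF prob_space_axioms channels(1), of xs "length xs" l i b j a] by simp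
  have sense: "prob (sense_event ((i, b) # (j, a) # xs)) =
      prob (sense_event ((j, a) # xs)) * (Q $ j $ i * bernoulli_prob (\<gamma>h i) b)" for i b j a xs
    unfolding sense_event_def
    using channel_process_hist(2)[OF prob_space_axioms channels(2), of xs "length xs" "()" i b j a] by simp
  show ?thesis
    unfolding path_law_def path_prob_eq by (simp add: act sense chan_weight_def mult_ac)
qed

lemma path_prob_init:
  "path_prob l [c] = prob {\<omega> \<in> space \<Omega>. \<theta>m \<omega> = l \<and> \<theta> 0 \<omega> = fst (fst c)} *
    bernoulli_prob (\<nu>h (fst (fst c))) (fst (snd c)) *
    (prob {\<omega> \<in> space \<Omega>. \<eta> 0 \<omega> = snd (fst c)} * bernoulli_prob (\<gamma>h (snd (fst c))) (snd (snd c)))"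
proof -
  have act: "prob (act_event l [(i, b)]) =
      prob {\<omega> \<in> space \<Omega>. \<theta>m \<omega> = l \<and> \<theta> 0 \<omega> = i} * bernoulli_prob (\<nu>h i) b" for i b
    unfolding act_event_def
    using channel_process_hist(1)[OF prob_space_axioms channels(1), of l i b] by simp
  have sense: "prob (sense_event [(i, b)]) =
      prob {\<omega> \<in> space \<Omega>. \<eta> 0 \<omega> = i} * bernoulli_prob (\<gamma>h i) b" for i b
    unfolding sense_event_def
    using channel_process_hist(1)[OF prob_space_axioms channels(2), of "()" i b] by simp
  show ?thesis by (simp add: path_prob_eq act sense)
qed

lemma sum_prob_values:
  fixes f :: "'o \<Rightarrow> 'b::finite"
  assumes [measurable]: "f \<in> measurable \<Omega> (count_space UNIV)"
  shows "(\<Sum>x\<in>UNIV. prob {\<omega> \<in> space \<Omega>. f \<omega> = x}) = 1"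
proof -
  have "prob (\<Union>x\<in>UNIV. {\<omega> \<in> space \<Omega>. f \<omega> = x}) = (\<Sum>x\<in>UNIV. prob {\<omega> \<in> space \<Omega>. f \<omega> = x})"
    by (rule finite_measure_finite_Union) (auto simp: disjoint_family_on_def)
  moreover have "(\<Union>x\<in>UNIV. {\<omega> \<in> space \<Omega>. f \<omega> = x}) = space \<Omega>" by auto
  ultimately show ?thesis by (simp add: prob_space)
qed

text \<open>The two channels are independent, while \<open>\<theta>m\<close> and
  \<open>\<theta> 0\<close> may depend on each other; \<open>a\<close> is therefore the marginal of
  \<open>\<theta> 0\<close> after summing over \<open>\<theta>m\<close>.\<close>

lemma mode_prob_init:
  "\<exists>a b. (\<forall>l n. mode_prob path_prob 0 (l, n) = a l * b n) \<and> (\<Sum>l\<in>UNIV. a l) = 1 \<and> (\<Sum>n\<in>UNIV. b n) = 1"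
proof (intro exI conjI allI)
  note [measurable] = channels[unfolded channel_process_def, THEN conjunct1]
    channels[unfolded channel_process_def, THEN conjunct2, THEN conjunct1, rule_format]
  let ?a = "\<lambda>i. \<Sum>l\<in>UNIV. prob {\<omega> \<in> space \<Omega>. \<theta>m \<omega> = l \<and> \<theta> 0 \<omega> = i}"
  let ?b = "\<lambda>n. prob {\<omega> \<in> space \<Omega>. \<eta> 0 \<omega> = n}"
  show "mode_prob path_prob 0 (i, n) = ?a i * ?b n" for i n
  proof -
    have "mode_prob path_prob 0 (i, n) = (\<Sum>l\<in>UNIV. \<Sum>b\<in>UNIV. \<Sum>g\<in>UNIV.
        prob {\<omega> \<in> space \<Omega>. \<theta>m \<omega> = l \<and> \<theta> 0 \<omega> = i} * bernoulli_prob (\<nu>h i) b *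
        (?b n * bernoulli_prob (\<gamma>h n) g))"
      by (simp add: mode_prob_def path_prob_init sum_prod_UNIV)
    also have "\<dots> = (\<Sum>l\<in>UNIV. prob {\<omega> \<in> space \<Omega>. \<theta>m \<omega> = l \<and> \<theta> 0 \<omega> = i} * ?b n)"
      by (simp only: sum_distrib_left[symmetric] sum_distrib_right[symmetric] bernoulli_prob_sum mult_1_right)
    finally show ?thesis by (simp add: sum_distrib_right)
  qed
  have "(\<Sum>i\<in>UNIV. ?a i) = (\<Sum>x\<in>UNIV. prob {\<omega> \<in> space \<Omega>. (\<theta> 0 \<omega>, \<theta>m \<omega>) = x})"
    unfolding sum_prod_UNIV by (intro sum.cong refl arg_cong[where f = prob]) auto
  also have "\<dots> = 1" by (rule sum_prob_values) measurable
  finally show "(\<Sum>i\<in>UNIV. ?a i) = 1" .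
  show "(\<Sum>n\<in>UNIV. ?b n) = 1" by (rule sum_prob_values) measurable
qed

section \<open>Averaging over channel histories\<close>

lemma finite_histories: "finite {cs :: ('m, 's) history. length cs = k}"
  using finite_lists_length_eq[of "UNIV :: (('m \<times> 's) \<times> (bool \<times> bool)) set" k] by simp

text \<open>Total expectation over the finitely many histories: on each history event the integrand
  is a frozen function of the data, and the event is independent of the data.\<close>

lemma hist_integral:
  fixes F :: "'m \<Rightarrow> ('m, 's) history \<Rightarrow> 'o \<Rightarrow> 'b::euclidean_space"
  assumes F: "\<And>l cs. F l cs \<in> borel_measurable data_algebra" "\<And>l cs. integrable \<Omega> (F l cs)"
  shows "(\<integral>\<omega>. F (\<theta>m \<omega>) (hist k \<omega>) \<omega> \<partial>\<Omega>) =
      (\<Sum>l\<in>UNIV. \<Sum>cs | length cs = k. path_prob l cs *\<^sub>R (\<integral>\<omega>. F l cs \<omega> \<partial>\<Omega>))" (is ?eq)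
    and "integrable \<Omega> (\<lambda>\<omega>. F (\<theta>m \<omega>) (hist k \<omega>) \<omega>)" (is ?int)
proof -
  have ev: "path_event l cs \<in> events" for l cs
    using path_event_sets indep_setD_ev2[OF indep_data_chan] by blast
  have split: "F (\<theta>m \<omega>) (hist k \<omega>) \<omega> =
      (\<Sum>l\<in>UNIV. \<Sum>cs | length cs = k. indicator (path_event l cs) \<omega> *\<^sub>R F l cs \<omega>)"
    if "\<omega> \<in> space \<Omega>" for \<omega>
  proof -
    have "(\<Sum>l\<in>UNIV. \<Sum>cs | length cs = k. indicator (path_event l cs) \<omega> *\<^sub>R F l cs \<omega>) =
        (\<Sum>l\<in>UNIV. \<Sum>cs | length cs = k. if l = \<theta>m \<omega> then if cs = hist k \<omega> then F l cs \<omega> else 0 else 0)"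
      using that by (intro sum.cong refl) (auto simp: path_event_def indicator_def)
    also have "\<dots> = (\<Sum>l\<in>UNIV. if l = \<theta>m \<omega> then \<Sum>cs | length cs = k. if cs = hist k \<omega> then F l cs \<omega> else 0 else 0)"
      by (intro sum.cong refl) auto
    also have "\<dots> = F (\<theta>m \<omega>) (hist k \<omega>) \<omega>"
      using finite_histories[of k] by simp
    finally show ?thesis by simp
  qed
  have int: "integrable \<Omega> (\<lambda>\<omega>. indicator (path_event l cs) \<omega> *\<^sub>R F l cs \<omega>)" for l cs
    using F(2) ev by (intro integrable_mult_indicator) auto
  have int2: "integrable \<Omega> (\<lambda>\<omega>. \<Sum>l\<in>UNIV. \<Sum>cs | length cs = k. indicator (path_event l cs) \<omega> *\<^sub>R F l cs \<omega>)"
    by (intro Bochner_Integration.integrable_sum int)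
  show ?int
    by (rule Bochner_Integration.integrable_cong[THEN iffD2, OF refl split int2])
  have "(\<integral>\<omega>. F (\<theta>m \<omega>) (hist k \<omega>) \<omega> \<partial>\<Omega>) =
      (\<integral>\<omega>. (\<Sum>l\<in>UNIV. \<Sum>cs | length cs = k. indicator (path_event l cs) \<omega> *\<^sub>R F l cs \<omega>) \<partial>\<Omega>)"
    by (rule Bochner_Integration.integral_cong[OF refl split])
  also have "\<dots> = (\<Sum>l\<in>UNIV. \<Sum>cs | length cs = k. \<integral>\<omega>. indicator (path_event l cs) \<omega> *\<^sub>R F l cs \<omega> \<partial>\<Omega>)"
    by (subst Bochner_Integration.integral_sum, intro Bochner_Integration.integrable_sum int,
        subst Bochner_Integration.integral_sum, rule int, rule refl)
  also have "\<dots> = (\<Sum>l\<in>UNIV. \<Sum>cs | length cs = k. path_prob l cs *\<^sub>R (\<integral>\<omega>. F l cs \<omega> \<partial>\<Omega>))"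
    unfolding path_prob_def
    by (intro sum.cong refl indep_set_integral_indicator[OF indep_data_chan] F path_event_sets) simp_all
  finally show ?eq .
qed

abbreviation pstate where
  "pstate \<Phi> \<Gamma> l cs \<equiv> \<lambda>\<omega>. path_state \<Phi> \<Gamma> (\<xi>0 \<omega>) (\<lambda>j. w j \<omega>) l cs"

lemma borel_measurable_linear:
  fixes T :: "'b::euclidean_space \<Rightarrow> 'c::euclidean_space"
  shows "linear T \<Longrightarrow> f \<in> borel_measurable M \<Longrightarrow> (\<lambda>x. T (f x)) \<in> borel_measurable M"
  by (rule borel_measurable_continuous_on[OF linear_continuous_on])
    (simp_all add: linear_conv_bounded_linear)

lemma data_measurable: "\<xi>0 \<in> borel_measurable data_algebra" "w k \<in> borel_measurable data_algebra"
  using measurable_mono[of borel borel state_algebra data_algebra]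
    measurable_mono[of borel borel noise_algebra data_algebra] sets_algebras_le
    state_measurable noise_measurable[of k] by auto

lemma path_state_measurable: "pstate \<Phi> \<Gamma> l cs \<in> borel_measurable data_algebra"
proof (induction cs)
  case Nil
  show ?case using data_measurable by simp
next
  case (Cons c cs)
  show ?case
    unfolding path_state.simps
    by (intro borel_measurable_add borel_measurable_linear[OF linear_mat_vec] Cons data_measurable)
qed

section \<open>Second order statistics of noise and initial state\<close>

lemma noise_random: "(\<lambda>\<omega> k. w k \<omega>) \<in> measurable \<Omega> noise_space"
  using realization unfolding realization_def
  by (intro measurable_PiM_single') (auto simp: space_PiM)

lemma noise_distr: "distr \<Omega> noise_space (\<lambda>\<omega> k. w k \<omega>) = W"
  using realization unfolding realization_def by (elim conjE)

lemma noise_integral: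
  fixes f :: "(nat \<Rightarrow> complex^'w) \<Rightarrow> 'b::{banach, second_countable_topology}"
  assumes "f \<in> borel_measurable noise_space"
  shows "(\<integral>x. f x \<partial>W) = (\<integral>\<omega>. f (\<lambda>k. w k \<omega>) \<partial>\<Omega>)"
    and "integrable W f \<longleftrightarrow> integrable \<Omega> (\<lambda>\<omega>. f (\<lambda>k. w k \<omega>))"
  unfolding noise_distr[symmetric]
  by (rule integral_distr[OF noise_random assms], rule integrable_distr_eq[OF noise_random assms])

lemma component_measurable: "(\<lambda>x. x k) \<in> borel_measurable (noise_space :: (nat \<Rightarrow> complex^'w) measure)"
  by (rule measurable_component_singleton) simp

lemma noise_sq_integrable: "sq_integrable \<Omega> (w k)"
proof -
  have "integrable W (\<lambda>x. (norm (x k))\<^sup>2)" using noise by (simp add: noise_law_def)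
  moreover have "(\<lambda>x :: nat \<Rightarrow> complex^'w. (norm (x k))\<^sup>2) \<in> borel_measurable noise_space"
    using component_measurable[of k] by measurable
  ultimately have "integrable \<Omega> (\<lambda>\<omega>. (norm (w k \<omega>))\<^sup>2)" by (simp add: noise_integral)
  then show ?thesis using realization by (simp add: sq_integrable_def realization_def)
qed

lemma noise_mean: "(\<integral>\<omega>. w k \<omega> \<partial>\<Omega>) = 0"
  using noise_integral(1)[OF component_measurable[of k]] noise by (simp add: noise_law_def)

lemma noise_cov: "(\<integral>\<omega>. outer (w k \<omega>) (w j \<omega>) \<partial>\<Omega>) = (if k = j then mat 1 else 0)"
proof -
  have "(\<lambda>x :: nat \<Rightarrow> complex^'w. outer (x k) (x j)) \<in> borel_measurable noise_space"
    using component_measurable[of k] component_measurable[of j]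
    by (rule borel_measurable_continuous_Pair)
      (intro bounded_bilinear.continuous_on[OF bounded_bilinear_outer] continuous_intros)
  from noise_integral(1)[OF this] noise show ?thesis by (simp add: noise_law_def)
qed

lemma state_sq_integrable: "sq_integrable \<Omega> \<xi>0"
  using realization by (simp add: sq_integrable_def realization_def)

lemma state_noise_cov: "(\<integral>\<omega>. outer (\<xi>0 \<omega>) (w k \<omega>) \<partial>\<Omega>) = 0"
proof -
  note int\<xi> = sq_integrable_integrable[OF state_sq_integrable]
  note intw = sq_integrable_integrable[OF noise_sq_integrable[of k]]
  have "(\<integral>\<omega>. outer (\<xi>0 \<omega>) (w k \<omega>) \<partial>\<Omega>) $ i $ j = 0" for i j
  proof -
    note int = integrable_outer[OF state_sq_integrable noise_sq_integrable[of k]]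
    have wj: "integrable \<Omega> (\<lambda>\<omega>. w k \<omega> $ j)"
      by (rule integrable_bounded_linear[OF bounded_linear_vec_nth intw])
    have "(\<integral>\<omega>. outer (\<xi>0 \<omega>) (w k \<omega>) \<partial>\<Omega>) $ i $ j = (\<integral>\<omega>. \<xi>0 \<omega> $ i * cnj (w k \<omega> $ j) \<partial>\<Omega>)"
      by (simp only: integral_vec_nth[OF int] outer_nth
          integral_vec_nth[OF integrable_bounded_linear[OF bounded_linear_vec_nth int]])
    also have "\<dots> = (\<integral>\<omega>. \<xi>0 \<omega> $ i \<partial>\<Omega>) * (\<integral>\<omega>. cnj (w k \<omega> $ j) \<partial>\<Omega>)"
    proof (rule indep_set_integral_mult[OF indep_state_noise])
      show "(\<lambda>\<omega>. \<xi>0 \<omega> $ i) \<in> borel_measurable state_algebra"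
        by (rule borel_measurable_linear[OF bounded_linear.linear[OF bounded_linear_vec_nth] state_measurable])
      show "(\<lambda>\<omega>. cnj (w k \<omega> $ j)) \<in> borel_measurable noise_algebra"
        by (intro borel_measurable_linear[OF bounded_linear.linear[OF bounded_linear_cnj]]
            borel_measurable_linear[OF bounded_linear.linear[OF bounded_linear_vec_nth] noise_measurable])
      show "integrable \<Omega> (\<lambda>\<omega>. \<xi>0 \<omega> $ i)"
        by (rule integrable_bounded_linear[OF bounded_linear_vec_nth int\<xi>])
      show "integrable \<Omega> (\<lambda>\<omega>. cnj (w k \<omega> $ j))"
        by (rule integrable_bounded_linear[OF bounded_linear_cnj wj])
    qed simp_all
    also have "(\<integral>\<omega>. cnj (w k \<omega> $ j) \<partial>\<Omega>) = cnj ((\<integral>\<omega>. w k \<omega> \<partial>\<Omega>) $ j)"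
      by (simp only: integral_vec_nth[OF intw] integral_bounded_linear[OF bounded_linear_cnj wj])
    finally show ?thesis by (simp add: noise_mean)
  qed
  then show ?thesis by (simp add: vec_eq_iff)
qed

lemma path_state_sq_integrable: "sq_integrable \<Omega> (pstate \<Phi> \<Gamma> l cs)"
proof (induction cs)
  case Nil
  show ?case using state_sq_integrable by simp
next
  case (Cons c cs)
  show ?case
    unfolding path_state.simps
    by (intro sq_integrable_add sq_integrable_linear[OF linear_mat_vec] Cons noise_sq_integrable)
qed

lemma integral_outer_swap:
  assumes "sq_integrable \<Omega> f" "sq_integrable \<Omega> g"
  shows "(\<integral>\<omega>. outer (g \<omega>) (f \<omega>) \<partial>\<Omega>) = adj (\<integral>\<omega>. outer (f \<omega>) (g \<omega>) \<partial>\<Omega>)"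
  using integral_linear[OF linear_adj integrable_outer[OF assms]] by (simp only: outer_swap[symmetric])

lemma integral_outer_mat_vec:
  fixes A :: "complex^'a^'b" and B :: "complex^'c^'d"
  assumes "sq_integrable \<Omega> f" "sq_integrable \<Omega> g"
  shows "(\<integral>\<omega>. outer (A *v f \<omega>) (B *v g \<omega>) \<partial>\<Omega>) = A ** (\<integral>\<omega>. outer (f \<omega>) (g \<omega>) \<partial>\<Omega>) ** adj B"
  unfolding outer_mat_vec by (rule integral_linear[OF linear_sandwich integrable_outer[OF assms]])

lemma integral_outer_add:
  assumes f: "sq_integrable \<Omega> f" "sq_integrable \<Omega> f'" and g: "sq_integrable \<Omega> g"
  shows "(\<integral>\<omega>. outer (f \<omega> + f' \<omega>) (g \<omega>) \<partial>\<Omega>) =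
      (\<integral>\<omega>. outer (f \<omega>) (g \<omega>) \<partial>\<Omega>) + (\<integral>\<omega>. outer (f' \<omega>) (g \<omega>) \<partial>\<Omega>)"
    "(\<integral>\<omega>. outer (g \<omega>) (f \<omega> + f' \<omega>) \<partial>\<Omega>) =
      (\<integral>\<omega>. outer (g \<omega>) (f \<omega>) \<partial>\<Omega>) + (\<integral>\<omega>. outer (g \<omega>) (f' \<omega>) \<partial>\<Omega>)"
  using f g
  by (simp_all add: bounded_bilinear.add_left[OF bounded_bilinear_outer]
      bounded_bilinear.add_right[OF bounded_bilinear_outer] integrable_outer)

text \<open>After at most \<open>j\<close> steps a frozen state involves only the initial state and
  noise with index below \<open>j\<close>, all uncorrelated with \<open>w j\<close>.\<close>

lemma path_state_noise_cov:
  "length cs \<le> j \<Longrightarrow> (\<integral>\<omega>. outer (pstate \<Phi> \<Gamma> l cs \<omega>) (w j \<omega>) \<partial>\<Omega>) = 0"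
proof (induction cs)
  case Nil
  show ?case using state_noise_cov by simp
next
  case (Cons c cs)
  let ?A = "step_mat \<Phi> (prev_mode l cs) c" and ?B = "noise_mat \<Gamma> c"
  \<comment> \<open>The identity matrix brings the second factor into the form that
    \<open>integral_outer_mat_vec\<close> expects.\<close>
  have split: "outer x (w j \<omega>) = outer x (mat 1 *v w j \<omega>)" for x \<omega> by simp
  have "(\<integral>\<omega>. outer (pstate \<Phi> \<Gamma> l (c # cs) \<omega>) (w j \<omega>) \<partial>\<Omega>) =
      (\<integral>\<omega>. outer (?A *v pstate \<Phi> \<Gamma> l cs \<omega>) (mat 1 *v w j \<omega>) \<partial>\<Omega>) +
      (\<integral>\<omega>. outer (?B *v w (length cs) \<omega>) (mat 1 *v w j \<omega>) \<partial>\<Omega>)"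
    unfolding path_state.simps split
    by (intro integral_outer_add sq_integrable_linear[OF linear_mat_vec] path_state_sq_integrable
        noise_sq_integrable)
  also have "\<dots> = 0"
    using Cons
    by (simp only: integral_outer_mat_vec path_state_sq_integrable noise_sq_integrable noise_cov)
      (simp add: linear_0[OF linear_sandwich])
  finally show ?case .
qed

lemma path_state_moment:
  "(\<integral>\<omega>. outer (pstate \<Phi> \<Gamma> l cs \<omega>) (pstate \<Phi> \<Gamma> l cs \<omega>) \<partial>\<Omega>) =
    path_moment \<Phi> \<Gamma> (\<integral>\<omega>. outer (\<xi>0 \<omega>) (\<xi>0 \<omega>) \<partial>\<Omega>) l cs"
proof (induction cs)
  case (Cons c cs)
  let ?A = "step_mat \<Phi> (prev_mode l cs) c" and ?B = "noise_mat \<Gamma> c"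
  let ?x = "pstate \<Phi> \<Gamma> l cs" and ?w = "w (length cs)"
  note sq = path_state_sq_integrable noise_sq_integrable sq_integrable_linear[OF linear_mat_vec]
    sq_integrable_add
  have xw: "(\<integral>\<omega>. outer (?x \<omega>) (?w \<omega>) \<partial>\<Omega>) = 0" by (rule path_state_noise_cov) simp
  then have wx: "(\<integral>\<omega>. outer (?w \<omega>) (?x \<omega>) \<partial>\<Omega>) = 0"
    by (subst integral_outer_swap) (simp_all add: sq adj_zero)
  have "(\<integral>\<omega>. outer (pstate \<Phi> \<Gamma> l (c # cs) \<omega>) (pstate \<Phi> \<Gamma> l (c # cs) \<omega>) \<partial>\<Omega>) =
      (\<integral>\<omega>. outer (?A *v ?x \<omega>) (?A *v ?x \<omega>) \<partial>\<Omega>) + (\<integral>\<omega>. outer (?A *v ?x \<omega>) (?B *v ?w \<omega>) \<partial>\<Omega>) +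
      ((\<integral>\<omega>. outer (?B *v ?w \<omega>) (?A *v ?x \<omega>) \<partial>\<Omega>) + (\<integral>\<omega>. outer (?B *v ?w \<omega>) (?B *v ?w \<omega>) \<partial>\<Omega>))"
    unfolding path_state.simps by (simp only: integral_outer_add sq)
  also have "\<dots> = ?A ** (\<integral>\<omega>. outer (?x \<omega>) (?x \<omega>) \<partial>\<Omega>) ** adj ?A + ?B ** adj ?B"
    by (simp add: integral_outer_mat_vec sq xw wx noise_cov linear_0[OF linear_sandwich])
  finally show ?case by (simp add: Cons)
qed simp

lemma path_state_mean:
  fixes \<Gamma> :: "'s \<Rightarrow> bool \<Rightarrow> complex^'w^'n" and cs :: "('m, 's) history"
  shows "(\<integral>\<omega>. pstate \<Phi> \<Gamma> l cs \<omega> \<partial>\<Omega>) = (\<integral>\<omega>. pstate \<Phi> (\<lambda>_ _. 0 :: complex^'w^'n) l cs \<omega> \<partial>\<Omega>)"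
proof (induction cs)
  case (Cons c cs)
  have "(\<integral>\<omega>. pstate \<Phi> \<Gamma> l (c # cs) \<omega> \<partial>\<Omega>) =
      step_mat \<Phi> (prev_mode l cs) c *v (\<integral>\<omega>. pstate \<Phi> \<Gamma> l cs \<omega> \<partial>\<Omega>)" for \<Gamma> :: "'s \<Rightarrow> bool \<Rightarrow> complex^'w^'n"
  proof -
    note int = sq_integrable_integrable[OF path_state_sq_integrable[of \<Phi> \<Gamma> l cs]]
      sq_integrable_integrable[OF noise_sq_integrable[of "length cs"]]
    note int' = sq_integrable_integrable[OF sq_integrable_linear[OF linear_mat_vec]]
    show ?thesis
      by (simp add: Bochner_Integration.integral_add int' path_state_sq_integrable
          noise_sq_integrable integral_linear[OF linear_mat_vec] int noise_mean)
  qed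
  then show ?case using Cons by simp
qed simp

section \<open>Moments of the trajectory\<close>

abbreviation trajectory where
  "trajectory \<Phi> \<Gamma> \<equiv> \<lambda>k \<omega>. mjls \<Phi> \<Gamma> (\<xi>0 \<omega>) (delayed (\<theta>m \<omega>) (\<lambda>j. \<theta> j \<omega>))
     (\<lambda>j. \<nu> j \<omega>) (\<lambda>j. \<eta> j \<omega>) (\<lambda>j. \<gamma> j \<omega>) (\<lambda>j. w j \<omega>) k"

lemma trajectory_eq: "trajectory \<Phi> \<Gamma> k \<omega> = pstate \<Phi> \<Gamma> (\<theta>m \<omega>) (hist k \<omega>) \<omega>"
proof (induction k)
  case (Suc k)
  have "delayed (\<theta>m \<omega>) (\<lambda>j. \<theta> j \<omega>) k = prev_mode (\<theta>m \<omega>) (hist k \<omega>)"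
    by (cases k) (simp_all add: delayed_def prev_mode_def)
  then show ?case by (simp add: Suc step_mat_def noise_mat_def)
qed simp

lemma trajectory_moment:
  "(\<integral>\<omega>. outer (trajectory \<Phi> \<Gamma> (Suc k) \<omega>) (trajectory \<Phi> \<Gamma> (Suc k) \<omega>) \<partial>\<Omega>) =
    (\<Sum>c\<in>UNIV. moment \<Phi> \<Gamma> path_prob (\<integral>\<omega>. outer (\<xi>0 \<omega>) (\<xi>0 \<omega>) \<partial>\<Omega>) k $ c)"
proof -
  have meas: "(\<lambda>\<omega>. outer (pstate \<Phi> \<Gamma> l cs \<omega>) (pstate \<Phi> \<Gamma> l cs \<omega>)) \<in> borel_measurable data_algebra" for l cs
    using path_state_measurable path_state_measurable
    by (rule borel_measurable_continuous_Pair)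
      (intro bounded_bilinear.continuous_on[OF bounded_bilinear_outer] continuous_intros)
  show ?thesis
    unfolding sum_moment trajectory_eq path_state_moment[symmetric]
    by (rule hist_integral(1)[OF meas])
      (intro integrable_outer path_state_sq_integrable)
qed

text \<open>The noise has mean 0 along every history. Passing to the noise-free system matters
  because its second moments tend to 0 under stability and bound the mean, whereas those of the
  noisy system need not vanish.\<close>

lemma trajectory_mean:
  "(\<integral>\<omega>. trajectory \<Phi> \<Gamma> k \<omega> \<partial>\<Omega>) = (\<integral>\<omega>. trajectory \<Phi> (\<lambda>_ _. 0 :: complex^'w^'n) k \<omega> \<partial>\<Omega>)"
proof -
  note int = sq_integrable_integrable[OF path_state_sq_integrable]
  show ?thesis
    unfolding trajectory_eq
      hist_integral(1)[where F = "pstate \<Phi> \<Gamma>", OF path_state_measurable int]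
      hist_integral(1)[where F = "pstate \<Phi> (\<lambda>_ _. 0)", OF path_state_measurable int]
      path_state_mean[of \<Phi> \<Gamma>] ..
qed

lemma trajectory_sq_integrable: "sq_integrable \<Omega> (trajectory \<Phi> \<Gamma> k)"
proof -
  note int = sq_integrable_integrable[OF path_state_sq_integrable]
  have "integrable \<Omega> (\<lambda>\<omega>. pstate \<Phi> \<Gamma> (\<theta>m \<omega>) (hist k \<omega>) \<omega>)"
    by (rule hist_integral(2)[where F = "pstate \<Phi> \<Gamma>", OF path_state_measurable int])
  moreover have "integrable \<Omega> (\<lambda>\<omega>. (norm (pstate \<Phi> \<Gamma> (\<theta>m \<omega>) (hist k \<omega>) \<omega>))\<^sup>2)"
  proof (rule hist_integral(2)[where F = "\<lambda>l cs \<omega>. (norm (pstate \<Phi> \<Gamma> l cs \<omega>))\<^sup>2"])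
    show "(\<lambda>\<omega>. (norm (pstate \<Phi> \<Gamma> l cs \<omega>))\<^sup>2) \<in> borel_measurable data_algebra" for l cs
      using path_state_measurable[of \<Phi> \<Gamma> l cs] by measurable
    show "integrable \<Omega> (\<lambda>\<omega>. (norm (pstate \<Phi> \<Gamma> l cs \<omega>))\<^sup>2)" for l cs
      using path_state_sq_integrable[of \<Phi> \<Gamma> l cs] by (simp add: sq_integrable_def)
  qed
  ultimately show ?thesis
    unfolding sq_integrable_def trajectory_eq using borel_measurable_integrable by blast
qed

text \<open>The norm of a mean is at most the mean of the norms, whose square is at most the mean
  square because variances are nonnegative.\<close>

lemma mean_sq_le_moment:
  fixes f :: "'o \<Rightarrow> complex^'k"
  assumes f: "sq_integrable \<Omega> f"
  shows "(cmod ((\<integral>\<omega>. f \<omega> \<partial>\<Omega>) $ i))\<^sup>2 \<le> Re ((\<integral>\<omega>. outer (f \<omega>) (f \<omega>) \<partial>\<Omega>) $ i $ i)"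
proof -
  note int = sq_integrable_integrable[OF f]
  note into = integrable_outer[OF f f]
  have fi: "integrable \<Omega> (\<lambda>\<omega>. f \<omega> $ i)" by (rule integrable_bounded_linear[OF bounded_linear_vec_nth int])
  note oi = integrable_bounded_linear[OF bounded_linear_vec_nth[of i] into]
  note oii = integrable_bounded_linear[OF bounded_linear_vec_nth[of i] oi]
  have "Re ((\<integral>\<omega>. outer (f \<omega>) (f \<omega>) \<partial>\<Omega>) $ i $ i) = (\<integral>\<omega>. Re (outer (f \<omega>) (f \<omega>) $ i $ i) \<partial>\<Omega>)"
    by (simp only: integral_vec_nth[OF into] integral_vec_nth[OF oi]
        integral_bounded_linear[OF bounded_linear_Re oii])
  also have "\<dots> = (\<integral>\<omega>. (cmod (f \<omega> $ i))\<^sup>2 \<partial>\<Omega>)"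
    by (simp add: outer_def complex_mult_cnj cmod_power2)
  finally have moment: "Re ((\<integral>\<omega>. outer (f \<omega>) (f \<omega>) \<partial>\<Omega>) $ i $ i) = (\<integral>\<omega>. (cmod (f \<omega> $ i))\<^sup>2 \<partial>\<Omega>)" .
  have "integrable \<Omega> (\<lambda>\<omega>. Re (outer (f \<omega>) (f \<omega>) $ i $ i))"
    by (rule integrable_bounded_linear[OF bounded_linear_Re oii])
  then have sq: "integrable \<Omega> (\<lambda>\<omega>. (cmod (f \<omega> $ i))\<^sup>2)"
    by (simp add: outer_def complex_mult_cnj cmod_power2)
  have "cmod ((\<integral>\<omega>. f \<omega> \<partial>\<Omega>) $ i) \<le> (\<integral>\<omega>. cmod (f \<omega> $ i) \<partial>\<Omega>)"
    unfolding integral_vec_nth[OF int] by (rule integral_norm_bound)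
  then have "(cmod ((\<integral>\<omega>. f \<omega> \<partial>\<Omega>) $ i))\<^sup>2 \<le> (\<integral>\<omega>. cmod (f \<omega> $ i) \<partial>\<Omega>)\<^sup>2"
    by (intro power_mono) auto
  also have "\<dots> \<le> (\<integral>\<omega>. (cmod (f \<omega> $ i))\<^sup>2 \<partial>\<Omega>)"
    using variance_positive[of "\<lambda>\<omega>. cmod (f \<omega> $ i)"] variance_eq[OF integrable_norm[OF fi] sq] by simp
  finally show ?thesis unfolding moment .
qed

end

section \<open>Existence of realizations\<close>

definition step_pmf :: "real^'m^'m \<Rightarrow> ('m \<Rightarrow> real) \<Rightarrow> 'm \<Rightarrow> ('m \<times> bool) pmf" where
  "step_pmf P p i = embed_pmf (\<lambda>c. P $ i $ fst c * bernoulli_prob (p (fst c)) (snd c))"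

text \<open>These conditions make the weights in \<open>step_pmf\<close> a probability
  distribution.\<close>

definition chan_params :: "real^'m^'m \<Rightarrow> ('m \<Rightarrow> real) \<Rightarrow> bool" where
  "chan_params P p \<longleftrightarrow> stochastic P \<and> (\<forall>i. 0 \<le> p i \<and> p i \<le> 1)"

lemma pmf_step_pmf:
  assumes "chan_params P p"
  shows "pmf (step_pmf P p i) c = P $ i $ fst c * bernoulli_prob (p (fst c)) (snd c)"
proof -
  let ?f = "\<lambda>c. P $ i $ fst c * bernoulli_prob (p (fst c)) (snd c)"
  have nonneg: "0 \<le> ?f c" for c
    using assms by (auto simp: chan_params_def stochastic_def bernoulli_prob_def)
  have "(\<Sum>c\<in>UNIV. ?f c) = 1"
    using assms unfolding sum_prod_UNIV
    by (simp add: sum_distrib_left[symmetric] bernoulli_prob_sum chan_params_def stochastic_def)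
  then have "(\<integral>\<^sup>+c. ennreal (?f c) \<partial>count_space UNIV) = 1"
    by (simp add: nn_integral_count_space_finite sum_ennreal nonneg)
  then show ?thesis unfolding step_pmf_def by (rule pmf_embed_pmf[OF nonneg])
qed

text \<open>
  The chain is driven by independent random maps: the map drawn at time \<open>k\<close> sends each mode to the
  mode and packet indicator that follow it.
\<close>

definition step_space :: "real^'m^'m \<Rightarrow> ('m \<Rightarrow> real) \<Rightarrow> (nat \<Rightarrow> 'm \<Rightarrow> 'm \<times> bool) measure" where
  "step_space P p = (\<Pi>\<^sub>M k\<in>UNIV. measure_pmf (Pi_pmf UNIV undefined (step_pmf P p)))"

text \<open>The mode \<open>l\<close> sits at time -1, so the mode at time 0 is already distributed
  by row \<open>l\<close> of the transition matrix.\<close>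

primrec chain :: "'m \<Rightarrow> (nat \<Rightarrow> 'm \<Rightarrow> 'm \<times> bool) \<Rightarrow> nat \<Rightarrow> 'm \<times> bool" where
  "chain l r 0 = r 0 l"
| "chain l r (Suc k) = r (Suc k) (fst (chain l r k))"

definition chain_law :: "real^'m^'m \<Rightarrow> ('m \<Rightarrow> real) \<Rightarrow> 'm \<Rightarrow> (nat \<Rightarrow> 'm \<times> bool) measure" where
  "chain_law P p l = distr (step_space P p) channel_space (chain l)"

lemma prob_space_step_space: "prob_space (step_space P p)"
  unfolding step_space_def by (intro prob_space_PiM prob_space_measure_pmf)

lemma chain_measurable: "chain l \<in> measurable (step_space P p) channel_space"
proof -
  have comp: "(\<lambda>r. r k i) \<in> measurable (step_space P p) (count_space UNIV)" for k i
  proof -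
    have "(\<lambda>r. r k) \<in> measurable (step_space P p) (measure_pmf (Pi_pmf UNIV undefined (step_pmf P p)))"
      unfolding step_space_def by (rule measurable_component_singleton) simp
    then show ?thesis by (rule measurable_compose) simp
  qed
  have "(\<lambda>r. chain l r k) \<in> measurable (step_space P p) (count_space UNIV)" for k
  proof (induction k)
    case 0
    show ?case using comp by simp
  next
    case (Suc k)
    have "(\<lambda>r. r (Suc k) (fst (chain l r k))) \<in> measurable (step_space P p) (count_space UNIV)"
      by (rule measurable_compose_countable[where f = "\<lambda>c r. r (Suc k) (fst c)", OF comp Suc])
    then show ?case by simp
  qed
  then show ?thesis
    by (intro measurable_PiM_single') (auto simp: space_PiM)
qed

lemma prob_space_chain_law: "prob_space (chain_law P p l)"
  unfolding chain_law_def by (rule prob_space.prob_space_distr[OF prob_space_step_space chain_measurable])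

lemma sets_chain_law [simp]: "sets (chain_law P p l) = sets channel_space"
  by (simp add: chain_law_def)

definition prev_state :: "'m \<Rightarrow> (nat \<Rightarrow> 'm \<times> bool) \<Rightarrow> nat \<Rightarrow> 'm" where
  "prev_state l s j = (case j of 0 \<Rightarrow> l | Suc i \<Rightarrow> fst (s i))"

text \<open>Prescribing the trajectory fixes one value of each random map. These are conditions on
  different independent coordinates, so cylinder probabilities become products.\<close>

lemma chain_eq_iff:
  "(\<forall>j<k. chain l r j = s j) \<longleftrightarrow> (\<forall>j<k. r j (prev_state l s j) = s j)"
proof (induction k)
  case (Suc k)
  have "chain l r k = r k (prev_state l s k)" if "\<forall>j<k. chain l r j = s j"
    using that by (cases k) (auto simp: prev_state_def)
  then show ?case using Suc by (auto simp: less_Suc_eq)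
qed simp

lemma chain_law_cylinder:
  fixes P :: "real^'m^'m"
  assumes params: "chan_params P p"
  shows "measure (chain_law P p l) {t. \<forall>j<k. t j = s j} =
    (\<Prod>j<k. P $ prev_state l s j $ fst (s j) * bernoulli_prob (p (fst (s j))) (snd (s j)))"
proof -
  let ?R = "Pi_pmf UNIV undefined (step_pmf P p)"
  interpret product_prob_space "\<lambda>_ :: nat. measure_pmf ?R" UNIV
    by (rule product_prob_spaceI) (rule prob_space_measure_pmf)
  have meas: "{t. \<forall>j<k. t j = s j} \<in> sets channel_space"
  proof -
    have "{t \<in> space channel_space. \<forall>j<k. t j = s j} \<in> sets channel_space"
      by measurable
    then show ?thesis by (simp add: space_PiM)
  qed
  have pmf: "measure (measure_pmf ?R) {r. r i = c} = P $ i $ fst c * bernoulli_prob (p (fst c)) (snd c)" for i c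
  proof -
    have "measure (measure_pmf ?R) {r. r i = c} = pmf (map_pmf (\<lambda>r. r i) ?R) c"
      by (simp add: pmf_map vimage_def)
    also have "\<dots> = pmf (step_pmf P p i) c"
      by (subst Pi_pmf_component) simp_all
    finally show ?thesis by (simp add: pmf_step_pmf[OF params])
  qed
  have "measure (chain_law P p l) {t. \<forall>j<k. t j = s j} =
      measure (step_space P p) {r \<in> space (step_space P p). \<forall>j<k. chain l r j = s j}"
    unfolding chain_law_def
    by (subst measure_distr[OF chain_measurable meas]) (auto intro: arg_cong2[where f = measure])
  also have "\<dots> = measure (PiM UNIV (\<lambda>_ :: nat. measure_pmf ?R))
      {r \<in> space (PiM UNIV (\<lambda>_ :: nat. measure_pmf ?R)). \<forall>j\<in>{..<k}. r j \<in> {r. r (prev_state l s j) = s j}}"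
    unfolding chain_eq_iff step_space_def by (intro arg_cong2[where f = measure] refl) auto
  also have "\<dots> = (\<Prod>j<k. measure (measure_pmf ?R) {r. r (prev_state l s j) = s j})"
    unfolding measure_def
    by (subst emeasure_PiM_Collect) (simp_all add: measure_pmf.emeasure_eq_measure prod_ennreal prod_nonneg)
  finally show ?thesis by (simp add: pmf)
qed

lemma channel_process_chain:
  fixes t :: "'o \<Rightarrow> nat \<Rightarrow> 'm::finite \<times> bool"
  assumes \<Omega>: "prob_space \<Omega>" and t: "t \<in> measurable \<Omega> channel_space"
    and law: "distr \<Omega> channel_space t = chain_law P p l" and params: "chan_params P p"
  shows "channel_process \<Omega> P p (\<lambda>_. d0) (\<lambda>k \<omega>. fst (t \<omega> k)) (\<lambda>k \<omega>. snd (t \<omega> k))"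
    and "measure \<Omega> {\<omega> \<in> space \<Omega>. fst (t \<omega> 0) = i} = P $ l $ i"
proof -
  interpret prob_space \<Omega> by (rule \<Omega>)
  have tk: "(\<lambda>\<omega>. t \<omega> k) \<in> measurable \<Omega> (count_space UNIV)" for k
    using measurable_compose[OF t measurable_component_singleton[of k UNIV]] by simp
  have comp [measurable]: "(\<lambda>\<omega>. fst (t \<omega> k)) \<in> measurable \<Omega> (count_space UNIV)"
    "(\<lambda>\<omega>. snd (t \<omega> k)) \<in> measurable \<Omega> (count_space UNIV)" for k
    by (rule measurable_compose[OF tk], simp)+
  let ?w = "\<lambda>s j. P $ prev_state l s j $ fst (s j) * bernoulli_prob (p (fst (s j))) (snd (s j))"
  have cyl: "prob {\<omega> \<in> space \<Omega>. \<forall>j<k. t \<omega> j = s j} = (\<Prod>j<k. ?w s j)" for k s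
  proof -
    have "{t. \<forall>j<k. t j = s j} \<in> sets channel_space"
    proof -
      have "{t \<in> space channel_space. \<forall>j<k. t j = s j} \<in> sets channel_space" by measurable
      then show ?thesis by (simp add: space_PiM)
    qed
    from measure_distr[OF t this]
    have "prob {\<omega> \<in> space \<Omega>. \<forall>j<k. t \<omega> j = s j} =
        measure (distr \<Omega> channel_space t) {t. \<forall>j<k. t j = s j}"
      by (simp add: vimage_def Int_def conj_commute)
    then show ?thesis unfolding law chain_law_cylinder[OF params] .
  qed
  have first: "prob {\<omega> \<in> space \<Omega>. t \<omega> 0 = c} = P $ l $ fst c * bernoulli_prob (p (fst c)) (snd c)" for c
    using cyl[of 1 "\<lambda>_. c"] by (simp add: prev_state_def)
  show mode0: "prob {\<omega> \<in> space \<Omega>. fst (t \<omega> 0) = i} = P $ l $ i" for i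
  proof -
    have "prob {\<omega> \<in> space \<Omega>. fst (t \<omega> 0) = i} = prob (\<Union>b. {\<omega> \<in> space \<Omega>. t \<omega> 0 = (i, b)})"
      by (intro arg_cong[where f = prob]) (auto simp: prod_eq_iff)
    also have "\<dots> = (\<Sum>b\<in>UNIV. prob {\<omega> \<in> space \<Omega>. t \<omega> 0 = (i, b)})"
      using tk[of 0] by (intro finite_measure_finite_Union) (auto simp: disjoint_family_on_def)
    also have "\<dots> = P $ l $ i * (\<Sum>b\<in>UNIV. bernoulli_prob (p i) b)"
      by (simp add: first sum_distrib_left)
    finally show ?thesis by (simp add: bernoulli_prob_sum)
  qed
  show "channel_process \<Omega> P p (\<lambda>_. d0) (\<lambda>k \<omega>. fst (t \<omega> k)) (\<lambda>k \<omega>. snd (t \<omega> k))"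
    unfolding channel_process_def
  proof (intro conjI allI impI)
    show "(\<lambda>_. d0) \<in> measurable \<Omega> (count_space UNIV)" by simp
  next
    fix d i b
    assume nz: "prob {\<omega> \<in> space \<Omega>. d0 = d \<and> fst (t \<omega> 0) = i} \<noteq> 0"
    \<comment> \<open>Otherwise the conditioning event would be empty.\<close>
    then have "d0 = d" by (rule contrapos_np) simp
    then have "prob {\<omega> \<in> space \<Omega>. snd (t \<omega> 0) = b \<and> d0 = d \<and> fst (t \<omega> 0) = i} =
        prob {\<omega> \<in> space \<Omega>. t \<omega> 0 = (i, b)}"
      by (intro arg_cong[where f = prob]) (auto simp: prod_eq_iff)
    then show "\<P>(\<omega> in \<Omega>. snd (t \<omega> 0) = b \<bar> d0 = d \<and> fst (t \<omega> 0) = i) = bernoulli_prob (p i) b"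
      using nz \<open>d0 = d\<close> by (simp add: cond_prob_def first mode0)
  next
    fix k d s a i b
    assume nz: "prob {\<omega> \<in> space \<Omega>. d0 = d \<and> (\<forall>j\<le>k. fst (t \<omega> j) = s j \<and> snd (t \<omega> j) = a j)} \<noteq> 0"
    then have "d0 = d" by (rule contrapos_np) simp
    \<comment> \<open>One sequence describes both the past and its prolongation, so the conditional
      probability is a quotient of cylinder probabilities in which all but the last factor
      cancel.\<close>
    let ?c = "\<lambda>j. if j \<le> k then (s j, a j) else (i, b)"
    have past: "(d0 = d \<and> (\<forall>j\<le>k. fst (t \<omega> j) = s j \<and> snd (t \<omega> j) = a j)) \<longleftrightarrow> (\<forall>j<Suc k. t \<omega> j = ?c j)" for \<omega>
      using \<open>d0 = d\<close> by (auto simp: prod_eq_iff less_Suc_eq_le)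
    have "(fst (t \<omega> (Suc k)) = i \<and> snd (t \<omega> (Suc k)) = b) \<and> (\<forall>j<Suc k. t \<omega> j = ?c j) \<longleftrightarrow>
        (\<forall>j<Suc (Suc k). t \<omega> j = ?c j)" for \<omega>
      by (auto simp: prod_eq_iff less_Suc_eq)
    then have "\<P>(\<omega> in \<Omega>. fst (t \<omega> (Suc k)) = i \<and> snd (t \<omega> (Suc k)) = b \<bar> \<forall>j<Suc k. t \<omega> j = ?c j) =
        (\<Prod>j<Suc (Suc k). ?w ?c j) / (\<Prod>j<Suc k. ?w ?c j)"
      by (simp only: cond_prob_def cyl)
    also have "\<dots> = ?w ?c (Suc k)"
      unfolding prod.lessThan_Suc[of _ "Suc k"]
      by (rule nonzero_mult_div_cancel_left[OF nz[unfolded past cyl]])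
    finally show "\<P>(\<omega> in \<Omega>. fst (t \<omega> (Suc k)) = i \<and> snd (t \<omega> (Suc k)) = b \<bar>
        d0 = d \<and> (\<forall>j\<le>k. fst (t \<omega> j) = s j \<and> snd (t \<omega> j) = a j)) = bernoulli_prob (p i) b * P $ s k $ i"
      unfolding past by (simp add: prev_state_def)
  qed (use comp in simp_all)
qed

section \<open>Products of four probability spaces\<close>

lemma measure_pair_rect:
  assumes "prob_space M" "prob_space N" "X \<in> sets M" "Y \<in> sets N"
  shows "measure (M \<Otimes>\<^sub>M N) (X \<times> Y) = measure M X * measure N Y"
proof -
  interpret N: prob_space N by fact
  show ?thesis using assms by (simp add: measure_def N.emeasure_pair_measure_Times enn2real_mult)
qed

lemma prob_space_pair_measure: "prob_space M \<Longrightarrow> prob_space N \<Longrightarrow> prob_space (M \<Otimes>\<^sub>M N)"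
proof -
  assume "prob_space M" "prob_space N"
  then interpret M: prob_space M + N: prob_space N by auto
  interpret pair_prob_space M N by unfold_locales
  show ?thesis by unfold_locales
qed

locale product4 = M0: prob_space M0 + M1: prob_space M1 + M2: prob_space M2 + M3: prob_space M3
  for M0 :: "'a measure" and M1 :: "'b measure" and M2 :: "'c measure" and M3 :: "'d measure"
begin

definition prod4 :: "('a \<times> 'b \<times> 'c \<times> 'd) measure" where
  "prod4 = M0 \<Otimes>\<^sub>M (M1 \<Otimes>\<^sub>M (M2 \<Otimes>\<^sub>M M3))"

lemma prob_space_prod4: "prob_space prod4"
  unfolding prod4_def
  by (intro prob_space_pair_measure M0.prob_space_axioms M1.prob_space_axioms M2.prob_space_axioms
      M3.prob_space_axioms)

sublocale prob_space prod4
  by (rule prob_space_prod4)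

lemma space_prod4: "space prod4 = space M0 \<times> space M1 \<times> space M2 \<times> space M3"
  by (simp add: prod4_def space_pair_measure)

lemma rect:
  assumes "A \<in> sets M0" "B \<in> sets M1" "C \<in> sets M2" "D \<in> sets M3"
  shows "prob (A \<times> B \<times> C \<times> D) = measure M0 A * (measure M1 B * (measure M2 C * measure M3 D))"
  unfolding prod4_def using assms
  by (simp add: measure_pair_rect prob_space_pair_measure M0.prob_space_axioms M1.prob_space_axioms
      M2.prob_space_axioms M3.prob_space_axioms)

lemma projections:
  "fst \<in> measurable prod4 M0" "(\<lambda>\<omega>. fst (snd \<omega>)) \<in> measurable prod4 M1"
  "(\<lambda>\<omega>. fst (snd (snd \<omega>))) \<in> measurable prod4 M2" "(\<lambda>\<omega>. snd (snd (snd \<omega>))) \<in> measurable prod4 M3"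
  unfolding prod4_def by measurable

lemma prob_projections:
  "A \<in> sets M0 \<Longrightarrow> prob (fst -` A \<inter> space prod4) = measure M0 A"
  "B \<in> sets M1 \<Longrightarrow> prob ((\<lambda>\<omega>. fst (snd \<omega>)) -` B \<inter> space prod4) = measure M1 B"
  "C \<in> sets M2 \<Longrightarrow> prob ((\<lambda>\<omega>. fst (snd (snd \<omega>))) -` C \<inter> space prod4) = measure M2 C"
  "D \<in> sets M3 \<Longrightarrow> prob ((\<lambda>\<omega>. snd (snd (snd \<omega>))) -` D \<inter> space prod4) = measure M3 D"
proof -
  note full = sets.top[of M0] sets.top[of M1] sets.top[of M2] sets.top[of M3]
  note one = M0.prob_space M1.prob_space M2.prob_space M3.prob_space
  show "prob (fst -` A \<inter> space prod4) = measure M0 A" if A: "A \<in> sets M0"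
  proof -
    have "fst -` A \<inter> space prod4 = A \<times> space M1 \<times> space M2 \<times> space M3"
      using sets.sets_into_space[OF A] by (auto simp: space_prod4)
    then show ?thesis by (simp add: rect A full one)
  qed
  show "prob ((\<lambda>\<omega>. fst (snd \<omega>)) -` B \<inter> space prod4) = measure M1 B" if B: "B \<in> sets M1"
  proof -
    have "(\<lambda>\<omega>. fst (snd \<omega>)) -` B \<inter> space prod4 = space M0 \<times> B \<times> space M2 \<times> space M3"
      using sets.sets_into_space[OF B] by (auto simp: space_prod4)
    then show ?thesis by (simp add: rect B full one)
  qed
  show "prob ((\<lambda>\<omega>. fst (snd (snd \<omega>))) -` C \<inter> space prod4) = measure M2 C" if C: "C \<in> sets M2"
  proof -
    have "(\<lambda>\<omega>. fst (snd (snd \<omega>))) -` C \<inter> space prod4 = space M0 \<times> space M1 \<times> C \<times> space M3"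
      using sets.sets_into_space[OF C] by (auto simp: space_prod4)
    then show ?thesis by (simp add: rect C full one)
  qed
  show "prob ((\<lambda>\<omega>. snd (snd (snd \<omega>))) -` D \<inter> space prod4) = measure M3 D" if D: "D \<in> sets M3"
  proof -
    have "(\<lambda>\<omega>. snd (snd (snd \<omega>))) -` D \<inter> space prod4 = space M0 \<times> space M1 \<times> space M2 \<times> D"
      using sets.sets_into_space[OF D] by (auto simp: space_prod4)
    then show ?thesis by (simp add: rect D full one)
  qed
qed

lemma distr_eqI:
  assumes T: "T \<in> measurable prod4 N" and M: "prob_space M" "sets M = sets N"
    and eq: "\<And>B. B \<in> sets N \<Longrightarrow> prob (T -` B \<inter> space prod4) = measure M B"
  shows "distr prod4 N T = M"
proof (rule measure_eqI)
  interpret M: prob_space M by fact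
  show "sets (distr prod4 N T) = sets M" by (simp add: M)
  fix B assume "B \<in> sets (distr prod4 N T)"
  then have "B \<in> sets N" by simp
  then show "emeasure (distr prod4 N T) B = emeasure M B"
    using T eq[of B] by (simp add: emeasure_distr emeasure_eq_measure M.emeasure_eq_measure)
qed

lemma indep_projections:
  "indep_sets (\<lambda>i. sets ([vimage_algebra (space prod4) fst M0,
     vimage_algebra (space prod4) (\<lambda>\<omega>. fst (snd \<omega>)) M1,
     vimage_algebra (space prod4) (\<lambda>\<omega>. fst (snd (snd \<omega>))) M2,
     vimage_algebra (space prod4) (\<lambda>\<omega>. snd (snd (snd \<omega>))) M3] ! i)) {..<4}"
    (is "indep_sets ?F _")
proof -
  have four: "{..<4} = {0, 1, 2, 3 :: nat}" by auto
  have F: "?F 0 = {fst -` A \<inter> space prod4 | A. A \<in> sets M0}"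
    "?F 1 = {(\<lambda>\<omega>. fst (snd \<omega>)) -` A \<inter> space prod4 | A. A \<in> sets M1}"
    "?F 2 = {(\<lambda>\<omega>. fst (snd (snd \<omega>))) -` A \<inter> space prod4 | A. A \<in> sets M2}"
    "?F 3 = {(\<lambda>\<omega>. snd (snd (snd \<omega>))) -` A \<inter> space prod4 | A. A \<in> sets M3}"
    using projections[THEN measurable_space] by (simp_all add: sets_vimage_algebra2 Pi_iff)
  show ?thesis
  \<comment> \<open>Each family contains the whole space, so the product formula for all four events
    at once yields it for every subfamily.\<close>
  proof (subst indep_sets_finite)
    show "?F i \<subseteq> events" if "i \<in> {..<4}" for i
      using that F measurable_sets[OF projections(1)] measurable_sets[OF projections(2)]
        measurable_sets[OF projections(3)] measurable_sets[OF projections(4)]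
      unfolding four by auto
    show "space prod4 \<in> ?F i" if "i \<in> {..<4}" for i
      using that unfolding four by (auto simp: sets_vimage_algebra_space)
    show "\<forall>A\<in>Pi {..<4} ?F. prob (\<Inter>j\<in>{..<4}. A j) = (\<Prod>j\<in>{..<4}. prob (A j))"
    proof
      fix A assume A: "A \<in> Pi {..<4} ?F"
      have "A 0 \<in> ?F 0" "A 1 \<in> ?F 1" "A 2 \<in> ?F 2" "A 3 \<in> ?F 3"
        by (rule Pi_mem[OF A], simp)+
      then obtain B0 B1 B2 B3 where
        B: "B0 \<in> sets M0" "B1 \<in> sets M1" "B2 \<in> sets M2" "B3 \<in> sets M3" and
        AB: "A 0 = fst -` B0 \<inter> space prod4" "A 1 = (\<lambda>\<omega>. fst (snd \<omega>)) -` B1 \<inter> space prod4"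
          "A 2 = (\<lambda>\<omega>. fst (snd (snd \<omega>))) -` B2 \<inter> space prod4"
          "A 3 = (\<lambda>\<omega>. snd (snd (snd \<omega>))) -` B3 \<inter> space prod4"
        unfolding F by blast
      have "(\<Inter>j\<in>{..<4}. A j) = A 0 \<inter> (A 1 \<inter> (A 2 \<inter> A 3))" unfolding four by simp
      also have "\<dots> = B0 \<times> B1 \<times> B2 \<times> B3"
        unfolding AB using B[THEN sets.sets_into_space] by (auto simp: space_prod4)
      finally have "prob (\<Inter>j\<in>{..<4}. A j) = prob (A 0) * (prob (A 1) * (prob (A 2) * prob (A 3)))"
        unfolding AB by (simp add: rect B prob_projections)
      then show "prob (\<Inter>j\<in>{..<4}. A j) = (\<Prod>j\<in>{..<4}. prob (A j))"
        unfolding four by simp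
    qed
  qed (simp_all add: four)
qed

end

section \<open>Realizations with prescribed initial modes\<close>

lemma sets_vimage_algebra_compose:
  assumes p: "p \<in> X \<rightarrow> space M" and h: "h \<in> measurable M N"
  shows "sets (vimage_algebra X (\<lambda>x. h (p x)) N) \<subseteq> sets (vimage_algebra X p M)"
proof -
  have "(\<lambda>x. h (p x)) \<in> X \<rightarrow> space N" using p measurable_space[OF h] by auto
  then have "sets (vimage_algebra X (\<lambda>x. h (p x)) N) = {(\<lambda>x. h (p x)) -` A \<inter> X | A. A \<in> sets N}"
    by (rule sets_vimage_algebra2)
  also have "\<dots> \<subseteq> {p -` B \<inter> X | B. B \<in> sets M}"
  proof safe
    fix A assume A: "A \<in> sets N"
    have "p x \<in> space M" if "x \<in> X" for x using p that by auto
    then have "(\<lambda>x. h (p x)) -` A \<inter> X = p -` (h -` A \<inter> space M) \<inter> X" by blast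
    then show "\<exists>B. (\<lambda>x. h (p x)) -` A \<inter> X = p -` B \<inter> X \<and> B \<in> sets M"
      using measurable_sets[OF h A] by blast
  qed
  also have "\<dots> = sets (vimage_algebra X p M)" using p by (simp only: sets_vimage_algebra2)
  finally show ?thesis .
qed

text \<open>The space, channels and noise are chosen before \<open>v\<close>, so starts at
  \<open>v\<close> and at 0 can be compared on the same data. The chains leave from \<open>l\<close>
  and from a fictitious sensing mode \<open>n\<close> at time -1, which yields the initial law
  required by \<open>moment_homogeneous\<close>.\<close>

lemma realization_exists:
  fixes W :: "(nat \<Rightarrow> complex^'w) measure" and P :: "real^'m^'m" and Q :: "real^'s^'s"
  assumes noise: "noise_law \<FF> W" and P: "chan_params P \<nu>h" and Q: "chan_params Q \<gamma>h"
  shows "\<exists>(\<Omega> :: ('n::finite, 'w, 'm, 's) path measure) \<theta> \<nu> \<eta> \<gamma> w.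
    (\<forall>v. vec_over \<FF> v \<longrightarrow> realization \<FF> W P \<nu>h Q \<gamma>h \<Omega> (\<lambda>_. v :: complex^'n) (\<lambda>_. l) \<theta> \<nu> \<eta> \<gamma> w) \<and>
    (\<forall>i. measure \<Omega> {\<omega> \<in> space \<Omega>. \<theta> 0 \<omega> = i} = P $ l $ i) \<and>
    (\<forall>m. measure \<Omega> {\<omega> \<in> space \<Omega>. \<eta> 0 \<omega> = m} = Q $ n $ m)"
proof -
  have W: "prob_space W" "sets W = sets noise_space" using noise by (auto simp: noise_law_def)
  let ?M2 = "return (count_space UNIV) l \<Otimes>\<^sub>M chain_law P \<nu>h l"
  have dirac: "prob_space (return (count_space UNIV) l)" by (rule prob_space_return) simp
  interpret product4 "return borel (0 :: complex^'n)" W ?M2 "chain_law Q \<gamma>h n"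
    unfolding product4_def
    by (intro conjI prob_space_return W prob_space_pair_measure prob_space_chain_law dirac) simp
  define t where "t = (\<lambda>\<omega> :: ('n, 'w, 'm, 's) path. snd (fst (snd (snd \<omega>))))"
  define s where "s = (\<lambda>\<omega> :: ('n, 'w, 'm, 's) path. snd (snd (snd \<omega>)))"
  have setsM2: "sets ?M2 = sets (count_space UNIV \<Otimes>\<^sub>M channel_space)"
    by (rule sets_pair_measure_cong) simp_all
  have snd_M2: "snd \<in> measurable ?M2 channel_space"
    using measurable_snd[of "count_space UNIV" channel_space] setsM2 by (simp cong: measurable_cong_sets)
  have t: "t \<in> measurable prod4 channel_space"
    unfolding t_def by (rule measurable_compose[OF projections(3) snd_M2])
  have s: "s \<in> measurable prod4 channel_space"
    unfolding s_def using projections(4) by (simp cong: measurable_cong_sets)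
  have t_law: "distr prod4 channel_space t = chain_law P \<nu>h l"
  proof (rule distr_eqI[OF t prob_space_chain_law])
    fix B :: "(nat \<Rightarrow> 'm \<times> bool) set" assume B: "B \<in> sets channel_space"
    have "t -` B \<inter> space prod4 = (\<lambda>\<omega>. fst (snd (snd \<omega>))) -` (UNIV \<times> B) \<inter> space prod4"
      by (auto simp: t_def)
    also have "prob \<dots> = measure ?M2 (UNIV \<times> B)" using B by (intro prob_projections) simp
    also have "\<dots> = measure (chain_law P \<nu>h l) B"
      using B prob_space.prob_space[OF dirac]
      by (subst measure_pair_rect) (simp_all add: dirac prob_space_chain_law)
    finally show "prob (t -` B \<inter> space prod4) = measure (chain_law P \<nu>h l) B" .
  qed simp
  have s_law: "distr prod4 channel_space s = chain_law Q \<gamma>h n"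
    by (rule distr_eqI[OF s prob_space_chain_law]) (simp_all add: s_def prob_projections)
  have w_law: "distr prod4 noise_space (\<lambda>\<omega>. fst (snd \<omega>)) = W"
  proof (rule distr_eqI[OF _ W])
    show "(\<lambda>\<omega>. fst (snd \<omega>)) \<in> measurable prod4 noise_space"
      using projections(2) W(2) by (simp cong: measurable_cong_sets)
  qed (use W(2) prob_projections(2) in simp)
  have wk: "(\<lambda>\<omega>. fst (snd \<omega>) k) \<in> borel_measurable prod4" for k
  proof -
    have "(\<lambda>x. x k) \<in> borel_measurable W"
      using measurable_component_singleton[of k UNIV "\<lambda>_. borel :: (complex^'w) measure"] W(2)
      by (simp cong: measurable_cong_sets)
    then show ?thesis by (rule measurable_compose[OF projections(2)])
  qed
  note t_chan = channel_process_chain[OF prob_space_axioms t t_law P]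
  note s_chan = channel_process_chain[OF prob_space_axioms s s_law Q]
  have indep: "indep_sets (\<lambda>i. sets ([vimage_algebra (space prod4) (\<lambda>_. v) borel,
      vimage_algebra (space prod4) (\<lambda>\<omega> k. fst (snd \<omega>) k) noise_space,
      vimage_algebra (space prod4) (\<lambda>\<omega>. (l, \<lambda>k. (fst (t \<omega> k), snd (t \<omega> k)))) (count_space UNIV \<Otimes>\<^sub>M channel_space),
      vimage_algebra (space prod4) (\<lambda>\<omega> k. (fst (s \<omega> k), snd (s \<omega> k))) channel_space] ! i)) {..<4}"
    for v :: "complex^'n"
  proof (rule indep_sets_mono_sets[OF indep_projections])
    fix i :: nat assume "i \<in> {..<4}"
    note space = projections[THEN measurable_space]
    have 0: "sets (vimage_algebra (space prod4) (\<lambda>_. v) borel) \<subseteq>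
        sets (vimage_algebra (space prod4) fst (return borel (0 :: complex^'n)))"
      using space by (intro sets_vimage_algebra_compose[where h = "\<lambda>_. v"]) auto
    have 1: "sets (vimage_algebra (space prod4) (\<lambda>\<omega> k. fst (snd \<omega>) k) noise_space) =
        sets (vimage_algebra (space prod4) (\<lambda>\<omega>. fst (snd \<omega>)) W)"
      by (rule sets_vimage_algebra_cong) (simp add: W(2))
    have "(\<lambda>x. (l, snd x)) \<in> measurable ?M2 (count_space UNIV \<Otimes>\<^sub>M channel_space)"
      using snd_M2 by (intro measurable_Pair) simp_all
    then have 2: "sets (vimage_algebra (space prod4) (\<lambda>\<omega>. (l, \<lambda>k. (fst (t \<omega> k), snd (t \<omega> k))))
          (count_space UNIV \<Otimes>\<^sub>M channel_space)) \<subseteq>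
        sets (vimage_algebra (space prod4) (\<lambda>\<omega>. fst (snd (snd \<omega>))) ?M2)"
      using space sets_vimage_algebra_compose[where h = "\<lambda>x. (l, snd x)" and M = ?M2
          and p = "\<lambda>\<omega>. fst (snd (snd \<omega>))" and X = "space prod4"]
      by (auto simp: t_def Pi_iff)
    have 3: "sets (vimage_algebra (space prod4) (\<lambda>\<omega> k. (fst (s \<omega> k), snd (s \<omega> k))) channel_space) =
        sets (vimage_algebra (space prod4) (\<lambda>\<omega>. snd (snd (snd \<omega>))) (chain_law Q \<gamma>h n))"
      unfolding prod.collapse s_def by (rule sets_vimage_algebra_cong) simp
    have "i = 0 \<or> i = 1 \<or> i = 2 \<or> i = 3" using \<open>i \<in> {..<4}\<close> by auto
    then show "sets ([vimage_algebra (space prod4) (\<lambda>_. v) borel,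
        vimage_algebra (space prod4) (\<lambda>\<omega> k. fst (snd \<omega>) k) noise_space,
        vimage_algebra (space prod4) (\<lambda>\<omega>. (l, \<lambda>k. (fst (t \<omega> k), snd (t \<omega> k)))) (count_space UNIV \<Otimes>\<^sub>M channel_space),
        vimage_algebra (space prod4) (\<lambda>\<omega> k. (fst (s \<omega> k), snd (s \<omega> k))) channel_space] ! i) \<subseteq>
      sets ([vimage_algebra (space prod4) fst (return borel (0 :: complex^'n)),
        vimage_algebra (space prod4) (\<lambda>\<omega>. fst (snd \<omega>)) W,
        vimage_algebra (space prod4) (\<lambda>\<omega>. fst (snd (snd \<omega>))) ?M2,
        vimage_algebra (space prod4) (\<lambda>\<omega>. snd (snd (snd \<omega>))) (chain_law Q \<gamma>h n)] ! i)"
      using 0 1 2 3 by (elim disjE) simp_all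
  qed
  show ?thesis
  proof (intro exI conjI allI impI)
    show "realization \<FF> W P \<nu>h Q \<gamma>h prod4 (\<lambda>_. v) (\<lambda>_. l) (\<lambda>k \<omega>. fst (t \<omega> k)) (\<lambda>k \<omega>. snd (t \<omega> k))
        (\<lambda>k \<omega>. fst (s \<omega> k)) (\<lambda>k \<omega>. snd (s \<omega> k)) (\<lambda>k \<omega>. fst (snd \<omega>) k)" if "vec_over \<FF> v" for v :: "complex^'n"
      unfolding realization_def
      using that by (intro conjI allI ballI prob_space_axioms indep t_chan(1) s_chan(1) wk w_law) simp_all
    show "prob {\<omega> \<in> space prod4. fst (t \<omega> 0) = i} = P $ l $ i" for i by (rule t_chan(2))
    show "prob {\<omega> \<in> space prod4. fst (s \<omega> 0) = m} = Q $ n $ m" for m by (rule s_chan(2))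
  qed
qed

section \<open>Mean square stability\<close>

lemma chan_weight_nonneg:
  "chan_params P \<nu>h \<Longrightarrow> chan_params Q \<gamma>h \<Longrightarrow> 0 \<le> chan_weight P \<nu>h Q \<gamma>h c d e"
  by (simp add: chan_params_def stochastic_def chan_weight_def bernoulli_prob_def)

lemma mean_square_stable_iff:
  fixes W :: "(nat \<Rightarrow> complex^'w) measure" and P :: "real^'m^'m" and Q :: "real^'s^'s"
    and \<Phi> :: "'m \<Rightarrow> bool \<Rightarrow> 's \<Rightarrow> bool \<Rightarrow> complex^'n^'n"
  assumes \<FF>: "0 \<in> \<FF>" "1 \<in> \<FF>" and P: "ergodic_chain P" "\<forall>i. 0 \<le> \<nu>h i \<and> \<nu>h i \<le> 1"
    and Q: "ergodic_chain Q" "\<forall>n. 0 \<le> \<gamma>h n \<and> \<gamma>h n \<le> 1" and noise: "noise_law \<FF> W"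
  shows "mean_square_stable \<FF> W P \<nu>h Q \<gamma>h \<Phi> \<Gamma> \<longleftrightarrow> stable_map (jump_op P \<nu>h Q \<gamma>h \<Phi>)"
proof
  let ?T = "jump_op P \<nu>h Q \<gamma>h \<Phi>"
  have params: "chan_params P \<nu>h" "chan_params Q \<gamma>h"
    using P Q by (auto simp: chan_params_def ergodic_chain_def)
  have lin: "linear ?T" unfolding jump_op_def by (rule linear_kraus_op)
  {
    assume stable: "stable_map ?T"
    obtain z where z: "\<And>q X a b. path_law P \<nu>h Q \<gamma>h q \<Longrightarrow> \<forall>l n. mode_prob q 0 (l, n) = a l * b n \<Longrightarrow>
        (\<Sum>l\<in>UNIV. a l) = 1 \<Longrightarrow> (\<Sum>n\<in>UNIV. b n) = 1 \<Longrightarrow> moment \<Phi> \<Gamma> q X \<longlonglongrightarrow> z"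
      using moment_converges[OF P(1) Q(1) stable, of \<Gamma>] by blast
    have limits: "(\<lambda>k. \<integral>\<omega>. \<xi> k \<omega> \<partial>\<Omega>) \<longlonglongrightarrow> 0 \<and> (\<lambda>k. \<integral>\<omega>. outer (\<xi> k \<omega>) (\<xi> k \<omega>) \<partial>\<Omega>) \<longlonglongrightarrow> (\<Sum>c\<in>UNIV. z $ c)"
      if real: "realization \<FF> W P \<nu>h Q \<gamma>h \<Omega> \<xi>0 \<theta>m \<theta> \<nu> \<eta> \<gamma> w"
        and \<xi>: "\<xi> = (\<lambda>k \<omega>. mjls \<Phi> \<Gamma> (\<xi>0 \<omega>) (delayed (\<theta>m \<omega>) (\<lambda>j. \<theta> j \<omega>))
          (\<lambda>j. \<nu> j \<omega>) (\<lambda>j. \<eta> j \<omega>) (\<lambda>j. \<gamma> j \<omega>) (\<lambda>j. w j \<omega>) k)"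
      for \<Omega> :: "('n, 'w, 'm, 's) path measure" and \<xi>0 \<theta>m \<theta> \<nu> \<eta> \<gamma> w \<xi>
    proof
      interpret realized \<FF> W P \<nu>h Q \<gamma>h \<Omega> \<xi>0 \<theta>m \<theta> \<nu> \<eta> \<gamma> w
        using real noise by unfold_locales
      let ?X = "\<integral>\<omega>. outer (\<xi>0 \<omega>) (\<xi>0 \<omega>) \<partial>\<Omega>" and ?\<zeta> = "trajectory \<Phi> (\<lambda>_ _. 0 :: complex^'w^'n)"
      obtain a b where ab: "\<forall>l n. mode_prob path_prob 0 (l, n) = a l * b n"
          "(\<Sum>l\<in>UNIV. a l) = 1" "(\<Sum>n\<in>UNIV. b n) = 1"
        using mode_prob_init by blast
      have "moment \<Phi> \<Gamma> path_prob ?X \<longlonglongrightarrow> z" by (rule z[OF path_law_path_prob ab])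
      then have "(\<lambda>k. \<Sum>c\<in>UNIV. moment \<Phi> \<Gamma> path_prob ?X k $ c) \<longlonglongrightarrow> (\<Sum>c\<in>UNIV. z $ c)"
        by (intro tendsto_sum tendsto_vec_nth)
      then show "(\<lambda>k. \<integral>\<omega>. outer (\<xi> k \<omega>) (\<xi> k \<omega>) \<partial>\<Omega>) \<longlonglongrightarrow> (\<Sum>c\<in>UNIV. z $ c)"
        unfolding trajectory_moment[symmetric] \<xi> by (rule filterlim_sequentially_Suc[THEN iffD1])
      \<comment> \<open>Without noise the moment recursion has no forcing, so its solution vanishes
        in the limit; this drives the mean to 0.\<close>
      have "moment \<Phi> (\<lambda>_ _. 0 :: complex^'w^'n) path_prob ?X \<longlonglongrightarrow> 0"
        by (rule stable_affine_tendsto_0[OF lin stable, of "\<lambda>_. 0"])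
          (simp_all add: moment_Suc[OF path_law_path_prob] noise_moment_zero)
      then have "(\<lambda>k. \<Sum>c\<in>UNIV. moment \<Phi> (\<lambda>_ _. 0 :: complex^'w^'n) path_prob ?X k $ c) \<longlonglongrightarrow>
          (\<Sum>c\<in>(UNIV :: ('m \<times> 's) set). 0 $ c)"
        by (intro tendsto_sum tendsto_vec_nth)
      then have hom: "(\<lambda>k. \<integral>\<omega>. outer (?\<zeta> (Suc k) \<omega>) (?\<zeta> (Suc k) \<omega>) \<partial>\<Omega>) \<longlonglongrightarrow> 0"
        unfolding trajectory_moment by simp
      have "(\<lambda>k. (\<integral>\<omega>. \<xi> (Suc k) \<omega> \<partial>\<Omega>) $ i) \<longlonglongrightarrow> 0" for i
      proof -
        have "(\<lambda>k. Re ((\<integral>\<omega>. outer (?\<zeta> (Suc k) \<omega>) (?\<zeta> (Suc k) \<omega>) \<partial>\<Omega>) $ i $ i)) \<longlonglongrightarrow> Re (0 $ i $ i)"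
          by (intro tendsto_Re tendsto_vec_nth hom)
        then have lim: "(\<lambda>k. Re ((\<integral>\<omega>. outer (?\<zeta> (Suc k) \<omega>) (?\<zeta> (Suc k) \<omega>) \<partial>\<Omega>) $ i $ i)) \<longlonglongrightarrow> 0"
          by simp
        have "(\<lambda>k. (cmod ((\<integral>\<omega>. ?\<zeta> (Suc k) \<omega> \<partial>\<Omega>) $ i))\<^sup>2) \<longlonglongrightarrow> 0"
          by (rule tendsto_sandwich[OF always_eventually[OF allI[OF zero_le_power2]]
                always_eventually[OF allI[OF mean_sq_le_moment[OF trajectory_sq_integrable]]]
                tendsto_const lim])
        then have "(\<lambda>k. sqrt ((cmod ((\<integral>\<omega>. ?\<zeta> (Suc k) \<omega> \<partial>\<Omega>) $ i))\<^sup>2)) \<longlonglongrightarrow> sqrt 0"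
          by (rule tendsto_real_sqrt)
        then have "(\<lambda>k. (\<integral>\<omega>. ?\<zeta> (Suc k) \<omega> \<partial>\<Omega>) $ i) \<longlonglongrightarrow> 0"
          by (simp add: tendsto_norm_zero_iff)
        then show ?thesis unfolding \<xi> trajectory_mean[of \<Phi> \<Gamma>] .
      qed
      then have "(\<lambda>k. \<integral>\<omega>. \<xi> (Suc k) \<omega> \<partial>\<Omega>) \<longlonglongrightarrow> 0" by (intro vec_tendstoI) simp
      then show "(\<lambda>k. \<integral>\<omega>. \<xi> k \<omega> \<partial>\<Omega>) \<longlonglongrightarrow> 0" by (rule filterlim_sequentially_Suc[THEN iffD1])
    qed
    show "mean_square_stable \<FF> W P \<nu>h Q \<gamma>h \<Phi> \<Gamma>"
      unfolding mean_square_stable_def Let_def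
    proof (intro exI allI impI conjI)
      fix \<Omega> :: "('n, 'w, 'm, 's) path measure" and \<xi>0 :: "_ \<Rightarrow> complex^'n" and \<theta>m \<theta> \<nu> \<eta> \<gamma> w
      assume real: "realization \<FF> W P \<nu>h Q \<gamma>h \<Omega> \<xi>0 \<theta>m \<theta> \<nu> \<eta> \<gamma> w"
      note lim = limits[OF real refl]
      show "(\<lambda>k. norm ((\<integral>\<omega>. mjls \<Phi> \<Gamma> (\<xi>0 \<omega>) (delayed (\<theta>m \<omega>) (\<lambda>j. \<theta> j \<omega>)) (\<lambda>j. \<nu> j \<omega>)
          (\<lambda>j. \<eta> j \<omega>) (\<lambda>j. \<gamma> j \<omega>) (\<lambda>j. w j \<omega>) k \<partial>\<Omega>) - 0)) \<longlonglongrightarrow> 0"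
        by (rule tendsto_norm_zero[OF LIM_zero[OF conjunct1[OF lim]]])
      show "(\<lambda>k. norm ((\<integral>\<omega>. outer
          (mjls \<Phi> \<Gamma> (\<xi>0 \<omega>) (delayed (\<theta>m \<omega>) (\<lambda>j. \<theta> j \<omega>)) (\<lambda>j. \<nu> j \<omega>) (\<lambda>j. \<eta> j \<omega>) (\<lambda>j. \<gamma> j \<omega>) (\<lambda>j. w j \<omega>) k)
          (mjls \<Phi> \<Gamma> (\<xi>0 \<omega>) (delayed (\<theta>m \<omega>) (\<lambda>j. \<theta> j \<omega>)) (\<lambda>j. \<nu> j \<omega>) (\<lambda>j. \<eta> j \<omega>) (\<lambda>j. \<gamma> j \<omega>) (\<lambda>j. w j \<omega>) k)
          \<partial>\<Omega>) - (\<Sum>c\<in>UNIV. z $ c))) \<longlonglongrightarrow> 0"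
        by (rule tendsto_norm_zero[OF LIM_zero[OF conjunct2[OF lim]]])
    qed
  next
    assume "mean_square_stable \<FF> W P \<nu>h Q \<gamma>h \<Phi> \<Gamma>"
    then obtain Qe where Qe: "\<And>(\<Omega> :: ('n, 'w, 'm, 's) path measure) \<xi>0 \<theta>m \<theta> \<nu> \<eta> \<gamma> w.
        realization \<FF> W P \<nu>h Q \<gamma>h \<Omega> \<xi>0 \<theta>m \<theta> \<nu> \<eta> \<gamma> w \<Longrightarrow>
        (\<lambda>k. norm ((\<integral>\<omega>. outer
          (mjls \<Phi> \<Gamma> (\<xi>0 \<omega>) (delayed (\<theta>m \<omega>) (\<lambda>j. \<theta> j \<omega>)) (\<lambda>j. \<nu> j \<omega>) (\<lambda>j. \<eta> j \<omega>) (\<lambda>j. \<gamma> j \<omega>) (\<lambda>j. w j \<omega>) k)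
          (mjls \<Phi> \<Gamma> (\<xi>0 \<omega>) (delayed (\<theta>m \<omega>) (\<lambda>j. \<theta> j \<omega>)) (\<lambda>j. \<nu> j \<omega>) (\<lambda>j. \<eta> j \<omega>) (\<lambda>j. \<gamma> j \<omega>) (\<lambda>j. w j \<omega>) k)
          \<partial>\<Omega>) - Qe)) \<longlonglongrightarrow> 0"
      unfolding mean_square_stable_def Let_def by blast
    have "(\<lambda>k. Re (((?T ^^ k) (dyad c\<^sub>0 (axis i 1) (axis i 1))) $ d $ j $ j)) \<longlonglongrightarrow> 0" for c\<^sub>0 i d j
    proof -
      let ?v = "axis i 1 :: complex^'n"
      let ?Z = "\<lambda>k. (?T ^^ k) (dyad c\<^sub>0 ?v ?v)"
      \<comment> \<open>Both starts are admissible over the reals as well as over the complex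
        numbers.\<close>
      have v: "vec_over \<FF> ?v" "vec_over \<FF> (0 :: complex^'n)"
        using \<FF> by (auto simp: vec_over_def axis_def)
      obtain \<Omega> :: "('n, 'w, 'm, 's) path measure" and \<theta> \<nu> \<eta> \<gamma> w where
        real: "\<And>v :: complex^'n. vec_over \<FF> v \<Longrightarrow>
          realization \<FF> W P \<nu>h Q \<gamma>h \<Omega> (\<lambda>_. v) (\<lambda>_. fst c\<^sub>0) \<theta> \<nu> \<eta> \<gamma> w"
        and init: "\<And>i. measure \<Omega> {\<omega> \<in> space \<Omega>. \<theta> 0 \<omega> = i} = P $ fst c\<^sub>0 $ i"
          "\<And>m. measure \<Omega> {\<omega> \<in> space \<Omega>. \<eta> 0 \<omega> = m} = Q $ snd c\<^sub>0 $ m"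
        using realization_exists[OF noise params, of "fst c\<^sub>0" "snd c\<^sub>0"] by blast
      interpret V: realized \<FF> W P \<nu>h Q \<gamma>h \<Omega> "\<lambda>_. ?v" "\<lambda>_. fst c\<^sub>0" \<theta> \<nu> \<eta> \<gamma> w
        using real[OF v(1)] noise by unfold_locales
      interpret O: realized \<FF> W P \<nu>h Q \<gamma>h \<Omega> "\<lambda>_. 0 :: complex^'n" "\<lambda>_. fst c\<^sub>0" \<theta> \<nu> \<eta> \<gamma> w
        using real[OF v(2)] noise by unfold_locales
      \<comment> \<open>\<open>path_prob\<close> depends only on the channels, so it is the same for
        both starts and the two moment sequences can be subtracted termwise.\<close>
      let ?q = "V.path_prob"
      have q0: "?q l [c] = (if l = fst c\<^sub>0 then chan_weight P \<nu>h Q \<gamma>h c\<^sub>0 (fst c) (snd c) else 0)" for l c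
        by (auto simp: V.path_prob_init init chan_weight_def)
      have diff: "(\<integral>\<omega>. outer (V.trajectory \<Phi> \<Gamma> (Suc k) \<omega>) (V.trajectory \<Phi> \<Gamma> (Suc k) \<omega>) \<partial>\<Omega>) -
          (\<integral>\<omega>. outer (O.trajectory \<Phi> \<Gamma> (Suc k) \<omega>) (O.trajectory \<Phi> \<Gamma> (Suc k) \<omega>) \<partial>\<Omega>) =
          (\<Sum>c\<in>UNIV. ?Z (Suc k) $ c)" for k
      proof -
        have "outer 0 0 = (0 :: complex^'n^'n)" by (simp add: outer_def vec_eq_iff)
        then have "(\<integral>\<omega>. outer (V.trajectory \<Phi> \<Gamma> (Suc k) \<omega>) (V.trajectory \<Phi> \<Gamma> (Suc k) \<omega>) \<partial>\<Omega>) -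
            (\<integral>\<omega>. outer (O.trajectory \<Phi> \<Gamma> (Suc k) \<omega>) (O.trajectory \<Phi> \<Gamma> (Suc k) \<omega>) \<partial>\<Omega>) =
            (\<Sum>c\<in>UNIV. (moment \<Phi> \<Gamma> ?q (outer ?v ?v) k - moment \<Phi> \<Gamma> ?q 0 k) $ c)"
          unfolding V.trajectory_moment O.trajectory_moment by (simp add: V.prob_space sum_subtractf)
        then show ?thesis
          unfolding moment_diff moment_homogeneous[OF V.path_law_path_prob q0] .
      qed
      have "(\<lambda>k. (\<integral>\<omega>. outer (V.trajectory \<Phi> \<Gamma> (Suc k) \<omega>) (V.trajectory \<Phi> \<Gamma> (Suc k) \<omega>) \<partial>\<Omega>) -
          (\<integral>\<omega>. outer (O.trajectory \<Phi> \<Gamma> (Suc k) \<omega>) (O.trajectory \<Phi> \<Gamma> (Suc k) \<omega>) \<partial>\<Omega>)) \<longlonglongrightarrow> Qe - Qe"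
      proof (intro tendsto_diff)
        show "(\<lambda>k. \<integral>\<omega>. outer (V.trajectory \<Phi> \<Gamma> (Suc k) \<omega>) (V.trajectory \<Phi> \<Gamma> (Suc k) \<omega>) \<partial>\<Omega>) \<longlonglongrightarrow> Qe"
          by (rule LIMSEQ_Suc[OF LIM_zero_cancel[OF tendsto_norm_zero_cancel[OF Qe[OF V.realization]]]])
        show "(\<lambda>k. \<integral>\<omega>. outer (O.trajectory \<Phi> \<Gamma> (Suc k) \<omega>) (O.trajectory \<Phi> \<Gamma> (Suc k) \<omega>) \<partial>\<Omega>) \<longlonglongrightarrow> Qe"
          by (rule LIMSEQ_Suc[OF LIM_zero_cancel[OF tendsto_norm_zero_cancel[OF Qe[OF O.realization]]]])
      qed
      then have "(\<lambda>k. \<Sum>c\<in>UNIV. ?Z (Suc k) $ c) \<longlonglongrightarrow> 0" unfolding diff by simp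
      then have "(\<lambda>k. Re ((\<Sum>c\<in>UNIV. ?Z (Suc k) $ c) $ j $ j)) \<longlonglongrightarrow> Re (0 $ j $ j)"
        by (intro tendsto_Re tendsto_vec_nth)
      then have lim: "(\<lambda>k. \<Sum>c\<in>UNIV. Re (?Z (Suc k) $ c $ j $ j)) \<longlonglongrightarrow> 0" by simp
      \<comment> \<open>Mean square stability controls only the sum over the modes; nonnegative
        summands make each single mode vanish as well.\<close>
      have nonneg: "0 \<le> Re (?Z k $ c $ j $ j)" for k c
        unfolding jump_op_def by (rule kraus_op_diag_nonneg) (rule chan_weight_nonneg[OF params])
      have le: "Re (?Z (Suc k) $ d $ j $ j) \<le> (\<Sum>c\<in>UNIV. Re (?Z (Suc k) $ c $ j $ j))" for k
        by (rule member_le_sum[where f = "\<lambda>c. Re (?Z (Suc k) $ c $ j $ j)"])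
          (simp_all only: nonneg UNIV_I finite_class.finite_UNIV)
      have "(\<lambda>k. Re (?Z (Suc k) $ d $ j $ j)) \<longlonglongrightarrow> 0"
        by (rule tendsto_sandwich[OF always_eventually[OF allI[OF nonneg]]
              always_eventually[OF allI[OF le]] tendsto_const lim])
      then show ?thesis by (rule filterlim_sequentially_Suc[THEN iffD1])
    qed
    then show "stable_map ?T"
      unfolding jump_op_def by (intro stable_kraus_opI[OF chan_weight_nonneg[OF params]])
  }
qed

theorem theorem3:
  fixes \<FF> :: "complex set"
    and A :: "complex^'x^'x" and B :: "complex^'u^'x" and G :: "complex^'w^'x"
    and L :: "complex^'x^'y" and H :: "complex^'w^'y"
    and C :: "complex^'x^'z" and D :: "complex^'u^'z"
    and P :: "real^'m^'m" and \<nu>h :: "'m \<Rightarrow> real"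
    and Q :: "real^'s^'s" and \<gamma>h :: "'s \<Rightarrow> real"
    and W :: "(nat \<Rightarrow> complex^'w) measure"
  assumes "\<FF> = \<real> \<or> \<FF> = UNIV"
    and "mat_over \<FF> A" "mat_over \<FF> B" "mat_over \<FF> G" "mat_over \<FF> L" "mat_over \<FF> H"
      "mat_over \<FF> C" "mat_over \<FF> D"
    and "pos_semidef (G ** adj G)" and "G ** adj H = 0" and "pos_def (H ** adj H)"
    and "adj C ** D = 0" and "pos_def (adj D ** D)"
    and "ergodic_chain P" and "\<forall>i. 0 \<le> \<nu>h i \<and> \<nu>h i \<le> 1"
    and "ergodic_chain Q" and "\<forall>n. 0 \<le> \<gamma>h n \<and> \<gamma>h n \<le> 1"
    and "noise_law \<FF> W"
  shows "(\<exists>F M. (\<forall>l. mat_over \<FF> (F l :: complex^'x^'u)) \<and> (\<forall>n. mat_over \<FF> (M n :: complex^'y^'x)) \<and>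
            mean_square_stable \<FF> W P \<nu>h Q \<gamma>h (closed_loop A B L F M) (closed_loop_noise G H M))
     \<longleftrightarrow> ms_detectable \<FF> Q \<gamma>h A L \<and> ms_stabilizable_delay \<FF> W P \<nu>h Q \<gamma>h A B G"
proof -
  have \<FF>: "0 \<in> \<FF>" "1 \<in> \<FF>" using assms(1) by auto
  note stable_iff = mean_square_stable_iff[OF \<FF> \<open>ergodic_chain P\<close> \<open>\<forall>i. 0 \<le> \<nu>h i \<and> \<nu>h i \<le> 1\<close>
      \<open>ergodic_chain Q\<close> \<open>\<forall>n. 0 \<le> \<gamma>h n \<and> \<gamma>h n \<le> 1\<close> \<open>noise_law \<FF> W\<close>]
  have params: "chan_params P \<nu>h" "chan_params Q \<gamma>h"
    using assms by (auto simp: chan_params_def ergodic_chain_def)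
  \<comment> \<open>The equivalence holds for each fixed pair of gains. One side depends on
    \<open>F\<close> alone and the other on \<open>M\<close> alone, so the existential quantifiers
    separate at the end.\<close>
  have "mean_square_stable \<FF> W P \<nu>h Q \<gamma>h (closed_loop A B L F M) (closed_loop_noise G H M) \<longleftrightarrow>
      mean_square_stable \<FF> W P \<nu>h Q \<gamma>h (state_feedback A B F) (\<lambda>n \<gamma>. G) \<and>
      spec_radius (detect_V A L Q \<gamma>h M) < 1" for F M
  proof -
    let ?\<kappa> = "chan_weight P \<nu>h Q \<gamma>h" and ?\<Phi> = "jump_mat (state_feedback A B F)"
    let ?E = "\<lambda>n m g. A + of_bool g *\<^sub>R (M m ** L)"
    let ?\<Psi> = "\<lambda>c d e. ?E (snd c) (snd d) (snd e)"
    \<comment> \<open>The feedback of the error enters only the upper right block.\<close>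
    have closed: "jump_mat (closed_loop A B L F M) = (\<lambda>c d e. block_mat (?\<Phi> c d e)
        (- (of_bool (fst e) *\<^sub>R (B ** F (fst c)))) 0 (?\<Psi> c d e))"
      by (intro ext) (simp add: jump_mat_def closed_loop_def state_feedback_def)
    \<comment> \<open>The error matrices ignore the actuation channel and the weights factor over
      the two channels, so the actuation modes can be summed out.\<close>
    have "stable_map (kraus_op ?\<kappa> ?\<Psi> ?\<Psi>) \<longleftrightarrow> stable_map (detect_V A L Q \<gamma>h M)"
      unfolding detect_V_eq_kraus_op chan_weight_def
      using params
      by (intro stable_kraus_op_marginal)
        (auto simp: chan_params_def stochastic_def bernoulli_prob_def UNIV_bool simp flip: distrib_left)
    then show ?thesis
      unfolding stable_iff jump_op_def closed stable_detect_V_iff[symmetric]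
      by (subst stable_kraus_op_block_triangular[OF chan_weight_nonneg[OF params]]) simp
  qed
  then show ?thesis unfolding ms_detectable_def ms_stabilizable_delay_def by blast
qed

end
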